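(* Let $K$ be a kernel such that: $K\in C([0,\infty)\times[0,\infty))$ with $K(x,y)=K(y,x)\ge 0$ for all $x,y\in[0,\infty)$; $K(ax,ay)=aK(x,y)$ for all $x,y\in(0,\infty)$ and $a>0$; and there are constants $K_0>0$ and $\alpha>0$ with $|K(x,1)-1|\le K_0x^\alpha$ for every $x\in[0,1]$. Then there exists $\rho_*>0$ such that for every $\rho\in(0,\rho_* )$ and for $b=\frac{1+\rho}{\rho}$ there is a positive function $g\in C^1((0,\infty))$ solving $$b\,x\,g(x)=\int_0^x\int_{x-y}^\infty \frac{K(y,z)}{z}\,g(y)g(z)\,\mathrm{d}z\,\mathrm{d}y\qquad\text{for all }x\in(0,\infty),$$ with $\int_0^\infty g(x)\,\mathrm{d}x=1$ and $$g(x)\sim x^{-\frac{1}{1+\rho}}\quad\text{as }x\to0,\qquad g(x)\sim \frac{1}{x^{1+\rho}}\quad\text{as }x\to\infty.$$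
   Context: For positive functions $g,h$, the notation $g(x)\sim h(x)$ as $x\to x_0$ means that $g$ and $h$ are of the same order: there are constants $0<c\le C<\infty$ (which may depend on $\rho$ and $K$) such that $c\,h(x)\le g(x)\le C\,h(x)$ for all $x$ sufficiently close to $x_0$ (respectively, for all sufficiently large $x$ when $x_0=\infty$). *)

theory Defs
  imports "HOL-Analysis.Analysis" "HOL-Library.Landau_Symbols"
begin

text \<open>
  The kernel acts on the closed quadrant; its values outside are irrelevant.
\<close>
definition admissible_kernel :: "(real \<Rightarrow> real \<Rightarrow> real) \<Rightarrow> bool" where
  "admissible_kernel K \<longleftrightarrow>
     continuous_on ({0..} \<times> {0..}) (\<lambda>(x, y). K x y) \<and>
     (\<forall>x\<ge>0. \<forall>y\<ge>0. K x y = K y x \<and> K x y \<ge> 0) \<and>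
     (\<forall>x>0. \<forall>y>0. \<forall>a>0. K (a * x) (a * y) = a * K x y) \<and>
     (\<exists>K0>0. \<exists>\<alpha>>0. \<forall>x\<in>{0..1}. \<bar>K x 1 - 1\<bar> \<le> K0 * x powr \<alpha>)"

text \<open>
  All integrands are nonnegative, so the equation is stated with the nonnegative Lebesgue
  integral. As the left-hand side is finite, this entails convergence of the double integral.
\<close>
definition solves_profile_equation ::
    "(real \<Rightarrow> real \<Rightarrow> real) \<Rightarrow> real \<Rightarrow> (real \<Rightarrow> real) \<Rightarrow> bool" where
  "solves_profile_equation K b g \<longleftrightarrow>
     (\<forall>x>0. ennreal (b * x * g x) =
        (\<integral>\<^sup>+y\<in>{0<..<x}. (\<integral>\<^sup>+z\<in>{x - y<..}. ennreal (K y z / z * g y * g z) \<partial>lborel) \<partial>lborel))"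

end

theory Submission
  imports Defs
begin

text \<open>
  In the variable \<open>u = ln x\<close> with \<open>\<epsilon> = 1/b = \<rho>/(1 + \<rho>)\<close>, the mass distribution
  \<open>G(x) = \<integral>{0..x} g\<close> varies on the scale \<open>1/\<epsilon>\<close>, on which only pairs of very different sizes matter and
  \<open>K(y,z)/z\<close> is \<open>1\<close> for \<open>y \<lless> z\<close>. To leading order it solves the logistic equation
  \<open>b G' = G (1 - G)\<close>. Write the exact solution as \<open>G = \<sigma>(L)\<close> with \<open>\<sigma>\<close> the logistic function,
  \<open>L(0) = 0\<close> (this fixes the scaling invariance) and \<open>L' = \<epsilon> (1 + r)\<close>. The equation becomes a
  fixed-point problem \<open>r = \<Psi>(r)\<close>, where \<open>\<Psi>(r)\<close> is the quotient by \<open>G (1 - G)\<close> of the difference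
  between the full bilinear form and \<open>G (1 - G)\<close>. Since \<open>K(x,1) = 1 + O(x\<^sup>\<alpha>)\<close>, this difference
  is local in \<open>u\<close> up to one factor of bounded mass, so \<open>\<Psi>\<close> is a contraction with constant \<open>O(\<epsilon>)\<close>.

  As \<open>u \<rightarrow> -\<infinity>\<close> the fixed point decays exponentially, so \<open>L = \<epsilon> u + O(1)\<close>. As \<open>u \<rightarrow> \<infinity>\<close> the only
  contribution that survives comes from \<open>y\<close> close to \<open>x\<close> and \<open>z\<close> small and equals \<open>\<epsilon> (1 + r) G\<close>, so
  \<open>r \<rightarrow> \<epsilon>/(1 - \<epsilon>) = \<rho>\<close> exponentially fast and \<open>L = \<rho> u + O(1)\<close>.
\<close>


text \<open>The bound 1/2 on \<open>r\<close> keeps L' between \<epsilon>/2 and 3\<epsilon>/2, so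
  the decay rates of the profile are known before the fixed point is found. Two obstacles shape the
  estimates. Size: with y = s x and z = t x, the weight for y close to x behaves like 1/t^2 on
  sections of length t, that is like dt/t, which has infinite mass. Only the decay of the profile at
  z, of the form exp(-\<epsilon>|u + ln t|/4), makes the integral finite, of size 1/\<epsilon>. The
  two densities bring \<epsilon>^2, so one factor \<epsilon> survives and pays for the contraction.
  Drift: changing \<open>r\<close> by \<eta> moves L by up to \<epsilon> \<eta> |u|, which is
  unbounded. Written with logarithms, this drift cancels between the factor at y and the denominator
  G (1 - G) at x up to a multiple of \<epsilon> \<eta> |ln(y/x)|. What remains is absorbed by a
  small power of y/x and by part of the decay at z. This is the reason for the weights exp(a|P|) and
  for the condition 3\<epsilon> \<le> a.\<close>

definition C1_small :: "(real \<Rightarrow> real) \<Rightarrow> (real \<Rightarrow> real) \<Rightarrow> bool" where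
  "C1_small r s \<longleftrightarrow> (\<forall>u. (r has_real_derivative s u) (at u)) \<and> continuous_on UNIV s
     \<and> (\<forall>u. \<bar>r u\<bar> \<le> 1/2) \<and> (\<forall>u. \<bar>s u\<bar> \<le> 1/2)"

lemma C1_small_continuous: "C1_small r s \<Longrightarrow> continuous_on UNIV r"
  unfolding C1_small_def by (metis DERIV_isCont continuous_at_imp_continuous_on)

text \<open>Needed for completeness of the space on which the contraction acts: its elements are
  pairs whose second component is the derivative of the first, and this tie has to survive uniform
  limits.\<close>

lemma DERIV_uniform_limit:
  fixes f f' :: "nat \<Rightarrow> real \<Rightarrow> real"
  assumes d: "\<And>n u. (f n has_real_derivative f' n u) (at u)"
    and f: "uniform_limit UNIV f g sequentially"
    and f': "uniform_limit UNIV f' g' sequentially"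
  shows "(g has_real_derivative g' u) (at u)"
proof -
  have pt: "(\<lambda>n. f n x) \<longlonglongrightarrow> g x" for x
    using tendsto_uniform_limitI[OF f, of x] by simp
  have "\<exists>h. \<forall>x\<in>UNIV. (\<lambda>n. f n x) \<longlonglongrightarrow> h x \<and> (h has_derivative (\<lambda>t. g' x * t)) (at x within UNIV)"
  proof (rule has_derivative_sequence[where f' = "\<lambda>n x t. f' n x * t"])
    show "(f n has_derivative (\<lambda>t. f' n x * t)) (at x within UNIV)" for n x
      using d[of n x] by (simp add: has_field_derivative_def)
    show "\<forall>\<^sub>F n in sequentially. \<forall>x\<in>UNIV. \<forall>h. norm (f' n x * h - g' x * h) \<le> e * norm h"
      if "e > 0" for e
      using uniform_limitD[OF f' that]
    proof eventually_elim
      case (elim n)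
      show ?case
      proof (intro ballI allI)
        fix x h :: real
        have "\<bar>f' n x - g' x\<bar> \<le> e" using elim by (auto simp: dist_real_def less_imp_le)
        then have "\<bar>f' n x - g' x\<bar> * \<bar>h\<bar> \<le> e * \<bar>h\<bar>" by (rule mult_right_mono) simp
        then show "norm (f' n x * h - g' x * h) \<le> e * norm h"
          by (simp add: left_diff_distrib[symmetric] abs_mult)
      qed
    qed
    show "(\<lambda>n. f n 0) \<longlonglongrightarrow> g 0" by (rule pt)
  qed auto
  then obtain h where h: "\<And>x. (\<lambda>n. f n x) \<longlonglongrightarrow> h x" "\<And>x. (h has_derivative (\<lambda>t. g' x * t)) (at x)"
    by auto
  have "h = g" using LIMSEQ_unique[OF h(1) pt] by auto
  with h(2) show ?thesis by (simp add: has_field_derivative_def)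
qed

text \<open>
  The kernel is merely continuous, so the equation does not improve the regularity of its
  solutions. The derivative is therefore carried along in the contraction.
\<close>

theorem C1_contraction:
  fixes \<Psi> :: "(real \<Rightarrow> real) \<Rightarrow> real \<Rightarrow> real"
    and \<Psi>' :: "(real \<Rightarrow> real) \<Rightarrow> (real \<Rightarrow> real) \<Rightarrow> real \<Rightarrow> real"
  assumes self: "\<And>r s. C1_small r s \<Longrightarrow> C1_small (\<Psi> r) (\<Psi>' r s)"
    and contr: "\<And>r1 s1 r2 s2 \<eta> u. \<lbrakk>C1_small r1 s1; C1_small r2 s2;
        \<And>v. \<bar>r1 v - r2 v\<bar> \<le> \<eta>; \<And>v. \<bar>s1 v - s2 v\<bar> \<le> \<eta>\<rbrakk>
      \<Longrightarrow> \<bar>\<Psi> r1 u - \<Psi> r2 u\<bar> \<le> \<eta> / 4 \<and> \<bar>\<Psi>' r1 s1 u - \<Psi>' r2 s2 u\<bar> \<le> \<eta> / 4"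
  shows "\<exists>r s. C1_small r s \<and> \<Psi> r = r"
proof -
  define Y where "Y = {p :: (real \<Rightarrow>\<^sub>C real) \<times> (real \<Rightarrow>\<^sub>C real).
     C1_small (apply_bcontfun (fst p)) (apply_bcontfun (snd p))}"
  define T where "T = (\<lambda>p :: (real \<Rightarrow>\<^sub>C real) \<times> (real \<Rightarrow>\<^sub>C real).
     (Bcontfun (\<Psi> (apply_bcontfun (fst p))), Bcontfun
         (\<Psi>' (apply_bcontfun (fst p)) (apply_bcontfun (snd p)))))"
  have B: "apply_bcontfun (Bcontfun r) = r" "apply_bcontfun (Bcontfun s) = s" if "C1_small r s" for r s
  proof -
    have "r \<in> bcontfun" "s \<in> bcontfun"
      using that C1_small_continuous[OF that]
      by (auto intro!: bcontfun_normI[of _ "1/2"] simp: C1_small_def)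
    then show "apply_bcontfun (Bcontfun r) = r" "apply_bcontfun (Bcontfun s) = s"
      by (simp_all add: Bcontfun_inverse)
  qed
  \<comment> \<open>\<open>Bcontfun\<close> is meaningful only on bounded continuous functions, so
    \<open>T\<close> is unfolded on \<open>Y\<close> only, where \<open>self\<close> guarantees that
    the images are of this kind.\<close>
  have T: "apply_bcontfun (fst (T p)) = \<Psi> (apply_bcontfun (fst p))"
    "apply_bcontfun (snd (T p)) = \<Psi>' (apply_bcontfun (fst p)) (apply_bcontfun (snd p))" if "p \<in> Y" for p
  proof -
    have "C1_small (\<Psi> (apply_bcontfun (fst p))) (\<Psi>' (apply_bcontfun (fst p)) (apply_bcontfun (snd p)))"
      using self that by (auto simp: Y_def)
    from B[OF this] show "apply_bcontfun (fst (T p)) = \<Psi> (apply_bcontfun (fst p))"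
      "apply_bcontfun (snd (T p)) = \<Psi>' (apply_bcontfun (fst p)) (apply_bcontfun (snd p))"
      by (auto simp: T_def)
  qed
  have "\<exists>!p. p \<in> Y \<and> T p = p"
  \<comment> \<open>The distance of pairs is at most the sum of the two component distances, and
    each of these shrinks to a quarter.\<close>
  proof (rule Banach_fix[of Y "1/2"])
    have "closed Y"
      unfolding closed_sequential_limits
    proof (intro allI impI)
      fix x l assume "(\<forall>n. x n \<in> Y) \<and> x \<longlonglongrightarrow> l"
      then have xY: "\<And>n. x n \<in> Y" and xl: "x \<longlonglongrightarrow> l" by auto
      have uf: "uniform_limit UNIV (\<lambda>n. apply_bcontfun (fst (x n))) (apply_bcontfun (fst l))
          sequentially"
        by (rule tendsto_bcontfun_uniform_limit) (rule tendsto_fst[OF xl])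
      have us: "uniform_limit UNIV (\<lambda>n. apply_bcontfun (snd (x n))) (apply_bcontfun (snd l))
          sequentially"
        by (rule tendsto_bcontfun_uniform_limit) (rule tendsto_snd[OF xl])
      have "\<bar>apply_bcontfun (fst l) u\<bar> \<le> 1/2" for u
        by (rule LIMSEQ_le_const2[OF tendsto_rabs[OF tendsto_uniform_limitI[OF uf, of u]]])
          (use xY in \<open>auto simp: Y_def C1_small_def\<close>)
      moreover have "\<bar>apply_bcontfun (snd l) u\<bar> \<le> 1/2" for u
        by (rule LIMSEQ_le_const2[OF tendsto_rabs[OF tendsto_uniform_limitI[OF us, of u]]])
          (use xY in \<open>auto simp: Y_def C1_small_def\<close>)
      moreover have "(apply_bcontfun (fst l) has_real_derivative apply_bcontfun (snd l) u) (at u)" for u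
        by (rule DERIV_uniform_limit[OF _ uf us]) (use xY in \<open>auto simp: Y_def C1_small_def\<close>)
      ultimately show "l \<in> Y" by (auto simp: Y_def C1_small_def)
    qed
    then show "complete Y" by (simp add: complete_eq_closed)
    have "C1_small (\<lambda>_. 0) (\<lambda>_. 0)" by (auto simp: C1_small_def)
    with B[OF this] show "Y \<noteq> {}" by (auto simp: Y_def intro!: exI[of _ "Bcontfun (\<lambda>_. 0)"])
    show "T ` Y \<subseteq> Y" using T self by (auto simp: Y_def)
    show "dist (T p) (T q) \<le> 1/2 * dist p q" if "p \<in> Y" "q \<in> Y" for p q
    proof -
      have d: "dist (fst p) (fst q) \<le> dist p q" "dist (snd p) (snd q) \<le> dist p q"
        by (auto intro: dist_fst_le dist_snd_le)
      have 1: "\<bar>apply_bcontfun (fst p) v - apply_bcontfun (fst q) v\<bar> \<le> dist p q" for v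
        using dist_bounded[of "fst p" v "fst q"] d by (auto simp: dist_real_def)
      have 2: "\<bar>apply_bcontfun (snd p) v - apply_bcontfun (snd q) v\<bar> \<le> dist p q" for v
        using dist_bounded[of "snd p" v "snd q"] d by (auto simp: dist_real_def)
      have c: "\<bar>\<Psi> (apply_bcontfun (fst p)) u - \<Psi> (apply_bcontfun (fst q)) u\<bar> \<le> dist p q / 4
          \<and> \<bar>\<Psi>' (apply_bcontfun (fst p)) (apply_bcontfun (snd p)) u
            - \<Psi>' (apply_bcontfun (fst q)) (apply_bcontfun (snd q)) u\<bar> \<le> dist p q / 4" for u
        by (rule contr) (use that 1 2 in \<open>auto simp: Y_def\<close>)
      have "dist (fst (T p)) (fst (T q)) \<le> dist p q / 4" "dist (snd (T p)) (snd (T q)) \<le> dist p q / 4"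
        by (rule dist_bound, use c in \<open>simp add: T[OF that(1)] T[OF that(2)] dist_real_def\<close>)+
      moreover have "dist (T p) (T q) \<le> dist (fst (T p)) (fst (T q)) + dist (snd (T p)) (snd (T q))"
        by (simp add: dist_prod_def sqrt_sum_squares_le_sum)
      ultimately show ?thesis by simp
    qed
  qed auto
  then obtain p where p: "p \<in> Y" "T p = p" by auto
  then have "C1_small (apply_bcontfun (fst p)) (apply_bcontfun (snd p))"
    "\<Psi> (apply_bcontfun (fst p)) = apply_bcontfun (fst p)"
    using T(1)[OF p(1)] by (auto simp: Y_def)
  then show ?thesis by blast
qed

section \<open>The logistic profile\<close>

lemma abs_diff_le_of_DERIV:
  fixes f f' :: "real \<Rightarrow> real"
  assumes "\<And>x. (f has_real_derivative f' x) (at x)" "\<And>x. \<bar>f' x\<bar> \<le> c"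
  shows "\<bar>f u - f v\<bar> \<le> c * \<bar>u - v\<bar>"
  using field_differentiable_bound[of UNIV f f' c u v] assms by auto

lemma sech_square_le: "1 - tanh (x::real) ^ 2 \<le> 4 * exp (- 2 * \<bar>x\<bar>)"
proof -
  have "exp \<bar>x\<bar> \<le> 2 * cosh x"
    unfolding cosh_field_def by (cases "x \<ge> 0") auto
  then have "(exp \<bar>x\<bar>)\<^sup>2 \<le> (2 * cosh x)\<^sup>2" by (intro power_mono) auto
  then have "exp (2 * \<bar>x\<bar>) \<le> 4 * (cosh x)\<^sup>2"
    by (simp add: power_mult_distrib exp_double)
  moreover have "1 - tanh x ^ 2 = 1 / cosh x ^ 2"
    by (simp add: tanh_def power_divide diff_divide_distrib[symmetric] sinh_square_eq divide_simps)
  ultimately have "1 - tanh x ^ 2 \<le> 4 / exp (2 * \<bar>x\<bar>)"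
    by (simp only:) (simp add: divide_simps)
  then show ?thesis
    by (simp add: exp_minus divide_inverse)
qed

text \<open>The slope of \<open>tanh (x/2)\<close> beyond distance \<open>m\<close> from 0 is at
  most \<open>2 * exp (-m)\<close>, and \<open>m * exp (-m) \<le> 1\<close>. A gap between the
  arguments that grows linearly in \<open>m\<close> therefore costs a constant only.\<close>

lemma abs_tanh_half_diff_le:
  fixes a b m c :: real
  assumes "m \<ge> 0" and ab: "m \<le> a \<and> m \<le> b \<or> a \<le> - m \<and> b \<le> - m" and c: "\<bar>a - b\<bar> \<le> c * m" "c \<ge> 0"
  shows "\<bar>tanh (a/2) - tanh (b/2)\<bar> \<le> 2 * c"
proof -
  have "\<bar>tanh (a/2) - tanh (b/2)\<bar> \<le> 2 * exp (-m) * \<bar>a - b\<bar>"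
  proof -
    \<comment> \<open>A convex set containing both points on which
      \<open>\<bar>x\<bar> \<ge> m\<close>: the mean value inequality never meets the steep part of
      \<open>tanh\<close>.\<close>
    define S where "S = (if m \<le> a \<and> m \<le> b then {m..} else {..-m})"
    have S: "convex S" "a \<in> S" "b \<in> S" using ab by (auto simp: S_def)
    have d: "((\<lambda>x. tanh (x/2)) has_field_derivative (1 - tanh (x/2) ^ 2) / 2) (at x within S)" for x
        :: real
      by (auto intro!: derivative_eq_intros)
    have "norm ((1 - tanh (x/2) ^ 2) / 2) \<le> 2 * exp (-m)" if "x \<in> S" for x
    proof -
      have "\<bar>x\<bar> \<ge> m" using that assms(1) by (auto simp: S_def split: if_splits)
      then have "4 * exp (-\<bar>x\<bar>) \<le> 4 * exp (-m)" by simp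
      moreover have "1 - tanh (x/2) ^ 2 \<ge> 0"
        using tanh_real_bounds[of "x/2"] by (simp add: abs_square_le_1 abs_le_iff)
      moreover have "1 - tanh (x/2) ^ 2 \<le> 4 * exp (-\<bar>x\<bar>)" using sech_square_le[of "x/2"] by simp
      ultimately have "1 - tanh (x/2) ^ 2 \<le> 4 * exp (-m)" "1 - tanh (x/2) ^ 2 \<ge> 0"
        by (blast intro: order_trans)+
      then show ?thesis by simp
    qed
    from field_differentiable_bound[OF S(1) d this S(2,3)] show ?thesis
      by (simp add: real_norm_def)
  qed
  also have "\<dots> \<le> 2 * exp (-m) * (c * m)"
    using c by (intro mult_left_mono) auto
  also have "m * exp (-m) \<le> 1"
  proof -
    have "m \<le> exp m" using exp_ge_add_one_self[of m] by linarith
    then show ?thesis by (simp add: exp_minus field_simps)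
  qed
  then have "c * (m * exp (-m)) \<le> c * 1" by (rule mult_left_mono) (use c in auto)
  then have "2 * exp (-m) * (c * m) \<le> 2 * c" by (simp add: algebra_simps)
  finally show ?thesis .
qed

section \<open>The phase L, the profile and their logarithms\<close>

definition primitive :: "(real \<Rightarrow> real) \<Rightarrow> real \<Rightarrow> real" where
  "primitive r u = (LBINT v=0..u. r v)"

lemma DERIV_primitive:
  assumes "continuous_on UNIV r"
  shows "(primitive r has_real_derivative r u) (at u)"
proof -
  define N where "N = \<bar>u\<bar> + 1"
  have "((\<lambda>u. LBINT v=(0::real)..u. r v) has_vector_derivative r u) (at u within {-N..N})"
    by (rule interval_integral_FTC2) (auto simp: N_def intro: continuous_on_subset[OF assms])
  then have "((\<lambda>u. LBINT v=(0::real)..u. r v) has_vector_derivative r u) (at u within {-N<..<N})"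
    by (rule has_vector_derivative_within_subset) auto
  then have "((\<lambda>u. LBINT v=(0::real)..u. r v) has_vector_derivative r u) (at u)"
    by (subst (asm) has_vector_derivative_within_open) (auto simp: N_def)
  then show ?thesis
    by (simp add: primitive_def[abs_def] has_real_derivative_iff_has_vector_derivative zero_ereal_def)
qed

lemma primitive_0 [simp]: "primitive r 0 = 0"
  by (simp add: primitive_def zero_ereal_def[symmetric])

definition phase :: "real \<Rightarrow> (real \<Rightarrow> real) \<Rightarrow> real \<Rightarrow> real" where
  "phase \<epsilon> r u = \<epsilon> * (u + primitive r u)"

text \<open>The logarithm of G (1 - G), since \<sigma>(L) (1 - \<sigma>(L)) = 1/(2
  cosh(L/2))^2.\<close>

definition log_logistic :: "real \<Rightarrow> (real \<Rightarrow> real) \<Rightarrow> real \<Rightarrow> real" where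
  "log_logistic \<epsilon> r u = - 2 * ln (2 * cosh (phase \<epsilon> r u / 2))"

definition log_logistic' :: "real \<Rightarrow> (real \<Rightarrow> real) \<Rightarrow> real \<Rightarrow> real" where
  "log_logistic' \<epsilon> r u = - tanh (phase \<epsilon> r u / 2) * (\<epsilon> * (1 + r u))"

text \<open>The logarithm of G'/\<epsilon>, since G' = L' G (1 - G) = \<epsilon> (1 + r) G (1 -
  G).\<close>

definition log_profile :: "real \<Rightarrow> (real \<Rightarrow> real) \<Rightarrow> real \<Rightarrow> real" where
  "log_profile \<epsilon> r u = log_logistic \<epsilon> r u + ln (1 + r u)"

definition log_profile' :: "real \<Rightarrow> (real \<Rightarrow> real) \<Rightarrow> (real \<Rightarrow> real) \<Rightarrow> real \<Rightarrow> real" where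
  "log_profile' \<epsilon> r s u = log_logistic' \<epsilon> r u + s u / (1 + r u)"

lemma phase_0 [simp]: "phase \<epsilon> r 0 = 0"
  by (simp add: phase_def)

lemma log_logistic_0 [simp]: "log_logistic \<epsilon> r 0 = - 2 * ln 2"
  by (simp add: log_logistic_def)

lemma log_logistic_le_phase: "log_logistic \<epsilon> r u \<le> - \<bar>phase \<epsilon> r u\<bar>"
  and log_logistic_ge_phase: "log_logistic \<epsilon> r u \<ge> - \<bar>phase \<epsilon> r u\<bar> - 2 * ln 2"
proof -
  define x where "x = phase \<epsilon> r u"
  have "exp (\<bar>x\<bar> / 2) \<le> 2 * cosh (x / 2)" "2 * cosh (x / 2) \<le> 2 * exp (\<bar>x\<bar> / 2)"
    unfolding cosh_field_def by (cases "x \<ge> 0"; simp)+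
  then have "ln (exp (\<bar>x\<bar> / 2)) \<le> ln (2 * cosh (x / 2))"
    "ln (2 * cosh (x / 2)) \<le> ln (2 * exp (\<bar>x\<bar> / 2))"
    by (subst ln_le_cancel_iff; simp)+
  then show "log_logistic \<epsilon> r u \<le> - \<bar>phase \<epsilon> r u\<bar>" "log_logistic \<epsilon> r u \<ge> - \<bar>phase \<epsilon> r u\<bar> - 2 * ln 2"
    by (simp_all add: log_logistic_def x_def ln_mult)
qed

context
  fixes \<epsilon> :: real and r s :: "real \<Rightarrow> real"
  assumes eps: "\<epsilon> > 0" and rs: "C1_small r s"
begin

lemma one_plus_bounds: "1/2 \<le> 1 + r u" "1 + r u \<le> 3/2" "0 < 1 + r u"
proof -
  have "\<bar>r u\<bar> \<le> 1/2" using rs by (auto simp: C1_small_def)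
  then show "1/2 \<le> 1 + r u" "1 + r u \<le> 3/2" "0 < 1 + r u" by linarith+
qed

lemma DERIV_phase: "(phase \<epsilon> r has_real_derivative \<epsilon> * (1 + r u)) (at u)"
  unfolding phase_def[abs_def]
  by (auto intro!: derivative_eq_intros DERIV_primitive C1_small_continuous[OF rs])

text \<open>The phase vanishes at 0 and has slope at least \<open>\<epsilon> / 2\<close> because
  \<open>1 + r u \<ge> 1/2\<close>. The decay rate \<open>\<epsilon> / 2\<close> used for all
  candidates \<open>r\<close> comes from here.\<close>

lemma phase_bounds:
  shows "u \<ge> 0 \<Longrightarrow> phase \<epsilon> r u \<ge> \<epsilon> * u / 2" and "u \<le> 0 \<Longrightarrow> phase \<epsilon> r u \<le> \<epsilon> * u / 2"
proof -
  have d: "((\<lambda>u. phase \<epsilon> r u - \<epsilon> * u / 2) has_real_derivative \<epsilon> * (1/2 + r u)) (at u)" for u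
    by (auto intro!: derivative_eq_intros DERIV_phase simp: algebra_simps)
  have p: "\<epsilon> * (1/2 + r u) \<ge> 0" for u
    using eps one_plus_bounds(1)[of u] by (intro mult_nonneg_nonneg) auto
  have mono: "phase \<epsilon> r u - \<epsilon> * u / 2 \<le> phase \<epsilon> r v - \<epsilon> * v / 2" if "u \<le> v" for u v
    by (rule DERIV_nonneg_imp_nondecreasing[OF that]) (use d p in blast)
  show "u \<ge> 0 \<Longrightarrow> phase \<epsilon> r u \<ge> \<epsilon> * u / 2" "u \<le> 0 \<Longrightarrow> phase \<epsilon> r u \<le> \<epsilon> * u / 2"
    using mono[of 0 u] mono[of u 0] by auto
qed

lemma log_logistic_le: "log_logistic \<epsilon> r u \<le> - \<epsilon> * \<bar>u\<bar> / 2"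
  using log_logistic_le_phase[of \<epsilon> r u] phase_bounds[of u] by (cases "u \<ge> 0") auto

lemma DERIV_log_logistic: "(log_logistic \<epsilon> r has_real_derivative log_logistic' \<epsilon> r u) (at u)"
proof -
  have pos: "0 < cosh (phase \<epsilon> r u / 2)" by simp
  show ?thesis
    unfolding log_logistic_def[abs_def] log_logistic'_def
    using pos
    by (auto intro!: derivative_eq_intros DERIV_phase simp: tanh_def field_simps)
qed

lemma abs_log_logistic'_le: "\<bar>log_logistic' \<epsilon> r u\<bar> \<le> 3/2 * \<epsilon>"
proof -
  have "\<bar>tanh (phase \<epsilon> r u / 2)\<bar> \<le> 1" using tanh_real_bounds[of "phase \<epsilon> r u / 2"] by auto
  then have "\<bar>tanh (phase \<epsilon> r u / 2)\<bar> * (\<epsilon> * \<bar>1 + r u\<bar>) \<le> 1 * (\<epsilon> * (3/2))"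
    using one_plus_bounds[of u] eps by (intro mult_mono mult_left_mono) auto
  then show ?thesis using eps by (simp add: log_logistic'_def abs_mult)
qed

lemma log_logistic_lipschitz: "\<bar>log_logistic \<epsilon> r u - log_logistic \<epsilon> r v\<bar> \<le> 3/2 * \<epsilon> * \<bar>u - v\<bar>"
  by (rule abs_diff_le_of_DERIV[OF DERIV_log_logistic abs_log_logistic'_le])

lemma DERIV_log_profile: "(log_profile \<epsilon> r has_real_derivative log_profile' \<epsilon> r s u) (at u)"
proof -
  have "(r has_real_derivative s u) (at u)" using rs by (auto simp: C1_small_def)
  then show ?thesis
    unfolding log_profile_def[abs_def] log_profile'_def using one_plus_bounds[of u]
    by (auto intro!: derivative_eq_intros DERIV_log_logistic simp: divide_simps)
qed

lemma abs_log_profile'_le: "\<bar>log_profile' \<epsilon> r s u\<bar> \<le> 1 + 3/2 * \<epsilon>"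
proof -
  have "\<bar>s u\<bar> \<le> 1/2" using rs by (auto simp: C1_small_def)
  then have "\<bar>s u / (1 + r u)\<bar> \<le> 1" using one_plus_bounds[of u] by (simp add: divide_simps)
  then show ?thesis unfolding log_profile'_def using abs_log_logistic'_le[of u] by linarith
qed

lemma exp_log_profile: "exp (log_profile \<epsilon> r u) = (1 + r u) * exp (log_logistic \<epsilon> r u)"
  using one_plus_bounds(3)[of u] by (simp add: log_profile_def exp_add)

lemma continuous_on_log_profile: "continuous_on UNIV (log_profile \<epsilon> r)"
  and continuous_on_log_logistic: "continuous_on UNIV (log_logistic \<epsilon> r)"
  and continuous_on_phase: "continuous_on UNIV (phase \<epsilon> r)"
  using DERIV_log_profile DERIV_log_logistic DERIV_phase
  by (meson DERIV_isCont continuous_at_imp_continuous_on)+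

lemma continuous_on_log_logistic': "continuous_on UNIV (log_logistic' \<epsilon> r)"
  unfolding log_logistic'_def[abs_def]
  by (intro continuous_intros continuous_on_phase C1_small_continuous[OF rs]) auto

lemma continuous_on_log_profile': "continuous_on UNIV (log_profile' \<epsilon> r s)"
  unfolding log_profile'_def[abs_def] using rs one_plus_bounds(3)
  by (intro continuous_intros continuous_on_log_logistic' C1_small_continuous[OF rs])
    (auto simp: C1_small_def less_imp_neq[symmetric])

end

section \<open>Comparison of two candidates\<close>

context
  fixes \<epsilon> \<eta> :: real and r1 s1 r2 s2 :: "real \<Rightarrow> real"
  assumes eps: "\<epsilon> > 0" and rs1: "C1_small r1 s1" and rs2: "C1_small r2 s2"
    and eta: "\<And>v. \<bar>r1 v - r2 v\<bar> \<le> \<eta>"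
begin

lemma eta_nonneg: "\<eta> \<ge> 0"
  using eta[of 0] by linarith

lemma phase_diff_le: "\<bar>phase \<epsilon> r1 u - phase \<epsilon> r2 u\<bar> \<le> \<epsilon> * \<eta> * \<bar>u\<bar>"
proof -
  have d: "((\<lambda>u. phase \<epsilon> r1 u - phase \<epsilon> r2 u) has_real_derivative \<epsilon> * (r1 u - r2 u)) (at u)" for u
    using DERIV_diff[OF DERIV_phase[OF eps rs1] DERIV_phase[OF eps rs2], of u]
    by (simp add: algebra_simps)
  have "\<bar>\<epsilon> * (r1 u - r2 u)\<bar> \<le> \<epsilon> * \<eta>" for u
    using eta[of u] eps by (simp add: abs_mult)
  from abs_diff_le_of_DERIV[OF d this, of u 0] show ?thesis by simp
qed

text \<open>
  The phases of \<open>r1\<close> and \<open>r2\<close> drift apart linearly in \<open>u\<close>, but both are at least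
  \<open>\<epsilon> * \<bar>u\<bar> / 2\<close> in size, where \<open>tanh\<close> is exponentially flat. Hence the bound is uniform in \<open>u\<close>.
\<close>

lemma log_logistic'_diff_le: "\<bar>log_logistic' \<epsilon> r1 u - log_logistic' \<epsilon> r2 u\<bar> \<le> 7 * \<epsilon> * \<eta>"
proof -
  let ?a = "phase \<epsilon> r1 u" and ?b = "phase \<epsilon> r2 u"
  have "\<bar>tanh (?a / 2) - tanh (?b / 2)\<bar> \<le> 2 * (2 * \<eta>)"
  proof (rule abs_tanh_half_diff_le[where m = "\<epsilon> * \<bar>u\<bar> / 2"])
    show "\<epsilon> * \<bar>u\<bar> / 2 \<le> ?a \<and> \<epsilon> * \<bar>u\<bar> / 2 \<le> ?b \<or> ?a \<le> - (\<epsilon> * \<bar>u\<bar> / 2) \<and> ?b \<le> - (\<epsilon> * \<bar>u\<bar> / 2)"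
      using phase_bounds[OF eps rs1, of u] phase_bounds[OF eps rs2, of u]
      by (cases "u \<ge> 0") auto
    show "\<bar>?a - ?b\<bar> \<le> 2 * \<eta> * (\<epsilon> * \<bar>u\<bar> / 2)" using phase_diff_le[of u] by (simp add: algebra_simps)
  qed (use eps eta_nonneg in auto)
  then have 1: "\<bar>tanh (?a / 2) - tanh (?b / 2)\<bar> * \<bar>1 + r1 u\<bar> \<le> 4 * \<eta> * (3/2)"
    using one_plus_bounds[OF eps rs1, of u] eta_nonneg by (intro mult_mono) auto
  have "\<bar>tanh (?b / 2)\<bar> \<le> 1" using tanh_real_bounds[of "?b / 2"] by auto
  then have 2: "\<bar>tanh (?b / 2)\<bar> * \<bar>r1 u - r2 u\<bar> \<le> 1 * \<eta>"
    using eta[of u] by (intro mult_mono) auto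
  have "log_logistic' \<epsilon> r1 u - log_logistic' \<epsilon> r2 u =
     - \<epsilon> * ((tanh (?a / 2) - tanh (?b / 2)) * (1 + r1 u) + tanh (?b / 2) * (r1 u - r2 u))"
    by (simp add: log_logistic'_def algebra_simps)
  then have "\<bar>log_logistic' \<epsilon> r1 u - log_logistic' \<epsilon> r2 u\<bar> =
      \<epsilon> * \<bar>(tanh (?a / 2) - tanh (?b / 2)) * (1 + r1 u) + tanh (?b / 2) * (r1 u - r2 u)\<bar>"
    using eps by (simp add: abs_mult)
  also have "\<dots> \<le> \<epsilon> * (7 * \<eta>)"
    using 1 2 eps by (intro mult_left_mono order_trans[OF abs_triangle_ineq]) (auto simp: abs_mult)
  finally show ?thesis by simp
qed

text \<open>The right-hand side contains \<open>u - v\<close> and not \<open>u\<close>: when the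
  values at two neighbouring points are divided by each other, the linear drift between the two
  phases cancels.\<close>

lemma log_logistic_diff_lipschitz:
  "\<bar>(log_logistic \<epsilon> r1 u - log_logistic \<epsilon> r2 u) - (log_logistic \<epsilon> r1 v - log_logistic \<epsilon> r2 v)\<bar>
      \<le> 7 * \<epsilon> * \<eta> * \<bar>u - v\<bar>"
  by (rule abs_diff_le_of_DERIV[OF DERIV_diff[OF DERIV_log_logistic[OF eps rs1]
      DERIV_log_logistic[OF eps rs2]] log_logistic'_diff_le])

lemma log_logistic_diff_le: "\<bar>log_logistic \<epsilon> r1 u - log_logistic \<epsilon> r2 u\<bar> \<le> 7 * \<epsilon> * \<eta> * \<bar>u\<bar>"
  using log_logistic_diff_lipschitz[of u 0] by simp

lemma ln_diff_le: "\<bar>ln (1 + r1 u) - ln (1 + r2 u)\<bar> \<le> 2 * \<eta>"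
proof -
  have "norm (ln (1 + r1 u) - ln (1 + r2 u)) \<le> 2 * norm ((1 + r1 u) - (1 + r2 u))"
  proof (rule field_differentiable_bound[where S = "{1/2..}" and f' = "\<lambda>x. 1/x"])
    show "(ln has_field_derivative 1 / x) (at x within {1/2..})" if "x \<in> {1/2..}" for x :: real
      using that by (auto intro!: derivative_eq_intros simp: divide_simps)
    show "norm (1 / x) \<le> 2" if "x \<in> {1/2..}" for x :: real
      using that by (auto simp: divide_simps)
  qed (use one_plus_bounds[OF eps rs1, of u] one_plus_bounds[OF eps rs2, of u] in auto)
  then show ?thesis using eta[of u] by simp
qed

text \<open>7 comes from the logistic part and 4 from the quotient \<open>s / (1 + r)\<close>. The
  latter carries no factor \<open>\<epsilon>\<close>, so this bound is not small by itself;
  smallness enters through the prefactor of \<open>\<Psi>'\<close>.\<close>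

lemma log_profile'_diff_le:
  assumes "\<And>v. \<bar>s1 v - s2 v\<bar> \<le> \<eta>" "\<epsilon> \<le> 1"
  shows "\<bar>log_profile' \<epsilon> r1 s1 u - log_profile' \<epsilon> r2 s2 u\<bar> \<le> 11 * \<eta>"
proof -
  have b: "1/2 \<le> 1 + r1 u" "1/2 \<le> 1 + r2 u"
    using one_plus_bounds[OF eps rs1, of u] one_plus_bounds[OF eps rs2, of u] by auto
  have s2: "\<bar>s2 u\<bar> \<le> 1/2" using rs2 by (auto simp: C1_small_def)
  have i: "\<bar>1 / (1 + r1 u)\<bar> \<le> 2" "\<bar>1 / (1 + r2 u)\<bar> \<le> 2" using b by (auto simp: divide_simps)
  have quotient: "x / p - y / q = (1 / p) * (x - y) + ((1 / p) * (1 / q)) * (y * (q - p))"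
    if "p \<noteq> 0" "q \<noteq> 0" for p q x y :: real
    using that by (simp add: field_simps)
  have "s1 u / (1 + r1 u) - s2 u / (1 + r2 u) =
     (1 / (1 + r1 u)) * (s1 u - s2 u) + ((1 / (1 + r1 u)) * (1 / (1 + r2 u))) * (s2 u * (r2 u - r1 u))"
  proof -
    have "1 + r1 u \<noteq> 0" "1 + r2 u \<noteq> 0" using b by linarith+
    from quotient[OF this, of "s1 u" "s2 u"] show ?thesis by (simp only: add_diff_cancel_left)
  qed
  also have "\<bar>\<dots>\<bar> \<le> 2 * \<eta> + (2 * 2) * (1/2 * \<eta>)"
    unfolding abs_mult using i s2 assms(1)[of u] eta[of u] eta_nonneg
    by (intro order_trans[OF abs_triangle_ineq] add_mono; unfold abs_mult; intro mult_mono)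
      (auto simp: abs_minus_commute)
  finally have "\<bar>s1 u / (1 + r1 u) - s2 u / (1 + r2 u)\<bar> \<le> 4 * \<eta>" by simp
  moreover have "7 * \<epsilon> * \<eta> \<le> 7 * \<eta>" using assms(2) eta_nonneg eps
    by (simp add: mult_left_le_one_le)
  ultimately show ?thesis using log_logistic'_diff_le[of u] unfolding log_profile'_def by linarith
qed

end

section \<open>The perturbation operator\<close>

lemma isCont_integral_dominated:
  fixes f :: "real \<Rightarrow> 'w \<Rightarrow> real"
  assumes cont: "\<And>\<omega>. isCont (\<lambda>x. f x \<omega>) u"
    and meas: "\<And>x. f x \<in> borel_measurable M"
    and dom: "integrable M B" "\<And>x \<omega>. \<bar>x - u\<bar> < 1 \<Longrightarrow> \<bar>f x \<omega>\<bar> \<le> B \<omega>"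
  shows "isCont (\<lambda>x. \<integral>\<omega>. f x \<omega> \<partial>M) u"
  unfolding continuous_within tendsto_at_iff_sequentially
proof (intro allI impI)
  fix X :: "nat \<Rightarrow> real" assume "X \<longlonglongrightarrow> u"
  then obtain N where N: "\<And>n. n \<ge> N \<Longrightarrow> \<bar>X n - u\<bar> < 1"
    using LIMSEQ_D[of X u 1] by auto
  \<comment> \<open>\<open>B\<close> dominates only within distance 1 of \<open>u\<close>, so
    finitely many terms of the sequence are dropped.\<close>
  have X: "(\<lambda>n. X (n + N)) \<longlonglongrightarrow> u" by (rule LIMSEQ_ignore_initial_segment) fact
  have "(\<lambda>n. \<integral>\<omega>. f (X (n + N)) \<omega> \<partial>M) \<longlonglongrightarrow> (\<integral>\<omega>. f u \<omega> \<partial>M)"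
  proof (rule integral_dominated_convergence[where w = B])
    show "AE \<omega> in M. (\<lambda>n. f (X (n + N)) \<omega>) \<longlonglongrightarrow> f u \<omega>"
      by (intro AE_I2 isCont_tendsto_compose[OF cont] X)
  qed (use meas dom N in auto)
  then show "((\<lambda>x. \<integral>\<omega>. f x \<omega> \<partial>M) \<circ> X) \<longlonglongrightarrow> (\<integral>\<omega>. f u \<omega> \<partial>M)"
    unfolding o_def by (rule LIMSEQ_offset)
qed

text \<open>By the mean value inequality on the unit ball around \<open>u\<close>, the bound
  \<open>B\<close> on the derivative also bounds the difference quotients, and dominated convergence
  applies to them.\<close>

lemma DERIV_integral_dominated:
  fixes f f' :: "real \<Rightarrow> 'w \<Rightarrow> real"
  assumes deriv: "\<And>x \<omega>. ((\<lambda>x. f x \<omega>) has_real_derivative f' x \<omega>) (at x)"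
    and int: "\<And>x. integrable M (f x)"
    and meas: "f' u \<in> borel_measurable M"
    and dom: "integrable M B" "\<And>x \<omega>. \<bar>x - u\<bar> < 1 \<Longrightarrow> \<bar>f' x \<omega>\<bar> \<le> B \<omega>"
  shows "((\<lambda>x. \<integral>\<omega>. f x \<omega> \<partial>M) has_real_derivative (\<integral>\<omega>. f' u \<omega> \<partial>M)) (at u)"
  unfolding DERIV_def tendsto_at_iff_sequentially
proof (intro allI impI)
  fix X :: "nat \<Rightarrow> real" assume X0: "\<forall>n. X n \<in> UNIV - {0}" and "X \<longlonglongrightarrow> 0"
  then obtain N where N: "\<And>n. n \<ge> N \<Longrightarrow> \<bar>X n\<bar> < 1"
    using LIMSEQ_D[of X 0 1] by auto
  have X: "(\<lambda>n. X (n + N)) \<longlonglongrightarrow> 0" by (rule LIMSEQ_ignore_initial_segment) fact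
  have "(\<lambda>n. \<integral>\<omega>. (f (u + X (n + N)) \<omega> - f u \<omega>) / X (n + N) \<partial>M) \<longlonglongrightarrow> (\<integral>\<omega>. f' u \<omega> \<partial>M)"
  proof (rule integral_dominated_convergence[where w = B])
    show "AE \<omega> in M. (\<lambda>n. (f (u + X (n + N)) \<omega> - f u \<omega>) / X (n + N)) \<longlonglongrightarrow> f' u \<omega>"
    proof (rule AE_I2)
      fix \<omega>
      have "(\<lambda>h. (f (u + h) \<omega> - f u \<omega>) / h) \<midarrow>0\<rightarrow> f' u \<omega>"
        using deriv[of \<omega> u] by (simp add: DERIV_def)
      from this[unfolded tendsto_at_iff_sequentially, rule_format, of "\<lambda>n. X (n + N)"]
      show "(\<lambda>n. (f (u + X (n + N)) \<omega> - f u \<omega>) / X (n + N)) \<longlonglongrightarrow> f' u \<omega>"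
        using X X0 by (simp add: o_def)
    qed
    show "AE \<omega> in M. norm ((f (u + X (n + N)) \<omega> - f u \<omega>) / X (n + N)) \<le> B \<omega>" for n
    proof (rule AE_I2)
      fix \<omega>
      let ?h = "X (n + N)"
      have h: "\<bar>?h\<bar> < 1" "?h \<noteq> 0" using N X0 by auto
      have "norm (f (u + ?h) \<omega> - f u \<omega>) \<le> B \<omega> * norm ((u + ?h) - u)"
        by (rule field_differentiable_bound[where S = "ball u 1" and f' = "\<lambda>x. f' x \<omega>"])
          (use h deriv dom in \<open>auto simp: dist_real_def abs_minus_commute
            intro: has_field_derivative_at_within\<close>)
      then show "norm ((f (u + ?h) \<omega> - f u \<omega>) / ?h) \<le> B \<omega>"
        using h by (simp add: divide_simps)
    qed
  qed (use int meas dom in auto)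
  then have "(\<lambda>n. ((\<integral>\<omega>. f (u + X (n + N)) \<omega> \<partial>M) - (\<integral>\<omega>. f u \<omega> \<partial>M)) / X (n + N)) \<longlonglongrightarrow> (\<integral>\<omega>. f' u \<omega> \<partial>M)"
    by (simp add: int)
  then show "((\<lambda>h. ((\<integral>\<omega>. f (u + h) \<omega> \<partial>M) - (\<integral>\<omega>. f u \<omega> \<partial>M)) / h) \<circ> X) \<longlonglongrightarrow> (\<integral>\<omega>. f' u \<omega> \<partial>M)"
    unfolding o_def by (rule LIMSEQ_offset)
qed

section \<open>The integrand of the operator and its dependence on r\<close>

text \<open>With p = ln(y/x) and q = ln(z/x), the exponential of this is \<epsilon>^(-2) G'(u + p)
  G'(u + q) divided by G (1 - G) at u.\<close>

definition log_ratio :: "real \<Rightarrow> (real \<Rightarrow> real) \<Rightarrow> real \<Rightarrow> real \<Rightarrow> real \<Rightarrow> real" where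
  "log_ratio \<epsilon> r u p q = log_profile \<epsilon> r (u + p) + log_profile \<epsilon> r (u + q) - log_logistic \<epsilon> r u"

definition log_ratio' :: "real \<Rightarrow> (real \<Rightarrow> real) \<Rightarrow> (real \<Rightarrow> real) \<Rightarrow> real \<Rightarrow> real \<Rightarrow> real \<Rightarrow> real" where
  "log_ratio' \<epsilon> r s u p q = log_profile' \<epsilon> r s (u + p) + log_profile' \<epsilon> r s (u + q)
      - log_logistic' \<epsilon> r u"

lemma exp_log_ratio: 
  assumes "\<epsilon> > 0" "C1_small r s"
  shows "exp (log_ratio \<epsilon> r u p q) =
     (1 + r (u + p)) * (1 + r (u + q)) * exp (log_logistic \<epsilon> r (u + p) - log_logistic \<epsilon> r u)
         * exp (log_logistic \<epsilon> r (u + q))"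
  using exp_log_profile[OF assms] by (simp add: log_ratio_def exp_add exp_diff)

text \<open>The denominator at \<open>u\<close> is paired with the factor at \<open>u + p\<close>:
  their quotient grows at most like \<open>exp (3/2 * \<epsilon> * \<bar>p\<bar>)\<close> by the
  Lipschitz bound. The factor at \<open>u + q\<close> is then free to supply decay.\<close>

lemma exp_log_ratio_le:
  assumes "\<epsilon> > 0" "C1_small r s"
  shows "exp (log_ratio \<epsilon> r u p q) \<le> 9/4 * exp (3/2 * \<epsilon> * \<bar>p\<bar>) * exp (- \<epsilon> * \<bar>u + q\<bar> / 2)"
proof -
  have "exp (log_ratio \<epsilon> r u p q) \<le> (3/2) * (3/2) * exp (3/2 * \<epsilon> * \<bar>p\<bar>) * exp (- \<epsilon> * \<bar>u + q\<bar> / 2)"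
    unfolding exp_log_ratio[OF assms]
    using one_plus_bounds[OF assms, of "u + p"] one_plus_bounds[OF assms, of "u + q"]
      abs_le_D1[OF log_logistic_lipschitz[OF assms, of "u + p" u]] log_logistic_le[OF assms, of "u + q"]
    by (intro mult_mono) auto
  then show ?thesis by simp
qed

lemma abs_exp_diff_le:
  fixes x y :: real
  assumes "exp x \<le> b" "exp y \<le> b"
  shows "\<bar>exp x - exp y\<bar> \<le> b * \<bar>x - y\<bar>"
  using field_differentiable_bound[of "{..ln b}" exp exp b x y] assms
    order_less_le_trans[OF exp_gt_zero assms(1)]
  by (simp add: ln_ge_iff DERIV_exp has_field_derivative_at_within)

text \<open>The linear factor arises when two exponentials are compared. It is paid for by raising
  the exponent in \<open>p\<close> from 3/2 to 5/2 times \<open>\<epsilon>\<close>, still below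
  \<open>a\<close>, and by giving up half of the decay rate in \<open>v\<close>, using 1 + x \<le> 4
  exp(x/4).\<close>

lemma weight_absorb:
  fixes \<epsilon> a p v :: real
  assumes "\<epsilon> > 0" "3 * \<epsilon> \<le> a"
  shows "exp (3/2 * \<epsilon> * \<bar>p\<bar>) * exp (- \<epsilon> * \<bar>v\<bar> / 2) * (1 + \<epsilon> * \<bar>p\<bar> + \<epsilon> * \<bar>v\<bar>)
     \<le> 4 * exp (a * \<bar>p\<bar>) * exp (- \<epsilon> * \<bar>v\<bar> / 4)"
proof -
  have 1: "1 + \<epsilon> * \<bar>p\<bar> \<le> exp (\<epsilon> * \<bar>p\<bar>)" by (rule exp_ge_add_one_self)
  have 2: "1 + \<epsilon> * \<bar>v\<bar> \<le> 4 * exp (\<epsilon> * \<bar>v\<bar> / 4)"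
    using exp_ge_add_one_self[of "\<epsilon> * \<bar>v\<bar> / 4"] by linarith
  have "1 + \<epsilon> * \<bar>p\<bar> + \<epsilon> * \<bar>v\<bar> \<le> (1 + \<epsilon> * \<bar>p\<bar>) * (1 + \<epsilon> * \<bar>v\<bar>)"
    using assms by (simp add: algebra_simps)
  also have "\<dots> \<le> exp (\<epsilon> * \<bar>p\<bar>) * (4 * exp (\<epsilon> * \<bar>v\<bar> / 4))"
    by (rule mult_mono[OF 1 2]) (use assms in auto)
  finally have "exp (3/2 * \<epsilon> * \<bar>p\<bar>) * exp (- \<epsilon> * \<bar>v\<bar> / 2) * (1 + \<epsilon> * \<bar>p\<bar> + \<epsilon> * \<bar>v\<bar>)
     \<le> exp (3/2 * \<epsilon> * \<bar>p\<bar>) * exp (- \<epsilon> * \<bar>v\<bar> / 2) * (exp (\<epsilon> * \<bar>p\<bar>) * (4 * exp (\<epsilon> * \<bar>v\<bar> / 4)))"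
    by (intro mult_left_mono) auto
  also have "\<dots> = 4 * exp (5/2 * \<epsilon> * \<bar>p\<bar>) * exp (- \<epsilon> * \<bar>v\<bar> / 4)"
    by (simp add: exp_add[symmetric] algebra_simps)
  also have "\<dots> \<le> 4 * exp (a * \<bar>p\<bar>) * exp (- \<epsilon> * \<bar>v\<bar> / 4)"
    using assms mult_right_mono[of "5/2 * \<epsilon>" a "\<bar>p\<bar>"]
    by (intro mult_right_mono mult_left_mono) auto
  finally show ?thesis .
qed

lemma exp_log_ratio_le_weight:
  assumes "\<epsilon> > 0" "C1_small r s" "3 * \<epsilon> \<le> a"
  shows "exp (log_ratio \<epsilon> r u p q) \<le> 9/4 * (exp (a * \<bar>p\<bar>) * exp (- \<epsilon> * \<bar>u + q\<bar> / 4))"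
proof -
  have "exp (3/2 * \<epsilon> * \<bar>p\<bar>) * exp (- \<epsilon> * \<bar>u + q\<bar> / 2) \<le> exp (a * \<bar>p\<bar>) * exp (- \<epsilon> * \<bar>u + q\<bar> / 4)"
    using assms(1) mult_right_mono[of "3/2 * \<epsilon>" a "\<bar>p\<bar>"] assms(3)
    by (intro mult_mono) auto
  then show ?thesis using exp_log_ratio_le[OF assms(1,2), of u p q] by simp
qed

lemma abs_log_ratio'_le:
  assumes "\<epsilon> > 0" "C1_small r s" "\<epsilon> \<le> 1"
  shows "\<bar>log_ratio' \<epsilon> r s u p q\<bar> \<le> 7"
  using abs_log_profile'_le[OF assms(1,2), of "u + p"] abs_log_profile'_le[OF assms(1,2), of "u + q"]
    abs_log_logistic'_le[OF assms(1,2), of u] assms(3)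
  unfolding log_ratio'_def by linarith

context
  fixes \<epsilon> \<eta> a :: real and r1 s1 r2 s2 :: "real \<Rightarrow> real"
  assumes eps: "\<epsilon> > 0" "\<epsilon> \<le> 1" "3 * \<epsilon> \<le> a" and rs1: "C1_small r1 s1" and rs2: "C1_small r2 s2"
    and eta: "\<And>v. \<bar>r1 v - r2 v\<bar> \<le> \<eta>"
begin

text \<open>The values of \<open>log_logistic\<close> at \<open>u + p\<close> and \<open>u\<close>
  are grouped, so that their drift leaves only \<open>\<epsilon> * \<bar>p\<bar>\<close>. The
  unpaired value at \<open>u + q\<close> costs \<open>\<epsilon> * \<bar>u + q\<bar>\<close>, which
  the decay in the same variable can absorb.\<close>

lemma log_ratio_diff_le: "\<bar>log_ratio \<epsilon> r1 u p q - log_ratio \<epsilon> r2 u p q\<bar>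
    \<le> 7 * \<eta> * (1 + \<epsilon> * \<bar>p\<bar> + \<epsilon> * \<bar>u + q\<bar>)"
proof -
  have "log_ratio \<epsilon> r1 u p q - log_ratio \<epsilon> r2 u p q =
     (ln (1 + r1 (u + p)) - ln (1 + r2 (u + p))) + (ln (1 + r1 (u + q)) - ln (1 + r2 (u + q)))
     + ((log_logistic \<epsilon> r1 (u + p) - log_logistic \<epsilon> r2 (u + p))
         - (log_logistic \<epsilon> r1 u - log_logistic \<epsilon> r2 u))
         + (log_logistic \<epsilon> r1 (u + q) - log_logistic \<epsilon> r2 (u + q))"
    by (simp add: log_ratio_def log_profile_def)
  also have "\<bar>\<dots>\<bar> \<le> 2 * \<eta> + 2 * \<eta> + 7 * \<epsilon> * \<eta> * \<bar>(u + p) - u\<bar> + 7 * \<epsilon> * \<eta> * \<bar>u + q\<bar>"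
    using ln_diff_le[OF eps(1) rs1 rs2 eta, of "u + p"] ln_diff_le[OF eps(1) rs1 rs2 eta, of "u + q"]
      log_logistic_diff_lipschitz[OF eps(1) rs1 rs2 eta, of "u + p" u]
          log_logistic_diff_le[OF eps(1) rs1 rs2 eta, of "u + q"]
    by linarith
  also have "\<dots> \<le> 7 * \<eta> * (1 + \<epsilon> * \<bar>p\<bar> + \<epsilon> * \<bar>u + q\<bar>)"
    using eta_nonneg[OF eps(1) rs1 rs2 eta] by (simp add: algebra_simps)
  finally show ?thesis .
qed

lemma exp_log_ratio_diff_le:
  "\<bar>exp (log_ratio \<epsilon> r1 u p q) - exp (log_ratio \<epsilon> r2 u p q)\<bar>
      \<le> 63 * \<eta> * (exp (a * \<bar>p\<bar>) * exp (- \<epsilon> * \<bar>u + q\<bar> / 4))"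
proof -
  let ?b = "9/4 * exp (3/2 * \<epsilon> * \<bar>p\<bar>) * exp (- \<epsilon> * \<bar>u + q\<bar> / 2)"
  have "\<bar>exp (log_ratio \<epsilon> r1 u p q) - exp (log_ratio \<epsilon> r2 u p q)\<bar>
      \<le> ?b * \<bar>log_ratio \<epsilon> r1 u p q - log_ratio \<epsilon> r2 u p q\<bar>"
    by (intro abs_exp_diff_le exp_log_ratio_le[OF eps(1) rs1] exp_log_ratio_le[OF eps(1) rs2])
  also have "\<dots> \<le> ?b * (7 * \<eta> * (1 + \<epsilon> * \<bar>p\<bar> + \<epsilon> * \<bar>u + q\<bar>))"
    by (intro mult_left_mono log_ratio_diff_le) auto
  also have "\<dots> = 63/4 * \<eta> * (exp (3/2 * \<epsilon> * \<bar>p\<bar>) * exp (- \<epsilon> * \<bar>u + q\<bar> / 2)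
      * (1 + \<epsilon> * \<bar>p\<bar> + \<epsilon> * \<bar>u + q\<bar>))"
    by (simp add: algebra_simps)
  also have "\<dots> \<le> 63/4 * \<eta> * (4 * exp (a * \<bar>p\<bar>) * exp (- \<epsilon> * \<bar>u + q\<bar> / 4))"
    using eta_nonneg[OF eps(1) rs1 rs2 eta] by (intro mult_left_mono weight_absorb[OF eps(1,3)]) auto
  finally show ?thesis by (simp add: algebra_simps)
qed

lemma exp_log_ratio_log_ratio'_diff_le:
  assumes "\<And>v. \<bar>s1 v - s2 v\<bar> \<le> \<eta>"
  shows "\<bar>exp (log_ratio \<epsilon> r1 u p q) * log_ratio' \<epsilon> r1 s1 u p q
      - exp (log_ratio \<epsilon> r2 u p q) * log_ratio' \<epsilon> r2 s2 u p q\<bar>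
    \<le> 507 * \<eta> * (exp (a * \<bar>p\<bar>) * exp (- \<epsilon> * \<bar>u + q\<bar> / 4))"
proof -
  let ?w = "exp (a * \<bar>p\<bar>) * exp (- \<epsilon> * \<bar>u + q\<bar> / 4)"
  have eta0: "\<eta> \<ge> 0" using eta_nonneg[OF eps(1) rs1 rs2 eta] .
  have w: "?w \<ge> 0" by simp
  have dW: "\<bar>log_profile' \<epsilon> r1 s1 v - log_profile' \<epsilon> r2 s2 v\<bar> \<le> 11 * \<eta>" for v
    by (rule log_profile'_diff_le[OF eps(1) rs1 rs2 eta assms eps(2)])
  have "7 * \<epsilon> * \<eta> \<le> 7 * \<eta>" using eps eta0 by (simp add: mult_left_le_one_le)
  then have "\<bar>log_logistic' \<epsilon> r1 u - log_logistic' \<epsilon> r2 u\<bar> \<le> 7 * \<eta>"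
    using log_logistic'_diff_le[OF eps(1) rs1 rs2 eta, of u] by linarith
  then have d: "\<bar>log_ratio' \<epsilon> r1 s1 u p q - log_ratio' \<epsilon> r2 s2 u p q\<bar> \<le> 29 * \<eta>"
    using dW[of "u + p"] dW[of "u + q"] unfolding log_ratio'_def by linarith
  have "exp (log_ratio \<epsilon> r1 u p q) * log_ratio' \<epsilon> r1 s1 u p q
      - exp (log_ratio \<epsilon> r2 u p q) * log_ratio' \<epsilon> r2 s2 u p q
     = (exp (log_ratio \<epsilon> r1 u p q) - exp (log_ratio \<epsilon> r2 u p q)) * log_ratio' \<epsilon> r1 s1 u p q
       + exp (log_ratio \<epsilon> r2 u p q) * (log_ratio' \<epsilon> r1 s1 u p q - log_ratio' \<epsilon> r2 s2 u p q)"
    by (simp add: algebra_simps)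
  \<comment> \<open>Here 29 = 11 + 11 + 7, and 63 * 7 + 9/4 * 29 = 506.25 explains the constant
    507.\<close>
  also have "\<bar>\<dots>\<bar> \<le> (63 * \<eta> * ?w) * 7 + (9/4 * ?w) * (29 * \<eta>)"
    using exp_log_ratio_diff_le[of u p q] abs_log_ratio'_le[OF eps(1) rs1 eps(2), of u p q]
      exp_log_ratio_le_weight[OF eps(1) rs2 eps(3), of u p q] d eta0
    by (intro order_trans[OF abs_triangle_ineq] add_mono; unfold abs_mult; intro mult_mono) auto
  also have "\<dots> \<le> 507 * \<eta> * ?w"
    using mult_nonneg_nonneg[OF eta0 w] by (simp add: algebra_simps)
  finally show ?thesis .
qed

end

text \<open>
  \<open>P\<close> and \<open>Q\<close> stand for the logarithms of \<open>y/x\<close> and \<open>z/x\<close>. The weights need not be integrable: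
  the singularity at \<open>Q \<rightarrow> -\<infinity>\<close> costs the factor \<open>1/\<epsilon>\<close>.
\<close>

locale coagulation_weights =
  fixes M :: "'w measure" and d P Q :: "'w \<Rightarrow> real" and a C :: real
  assumes meas [measurable]: "d \<in> borel_measurable M" "P \<in> borel_measurable M" "Q \<in> borel_measurable M"
    and weight: "\<And>\<epsilon> u. \<lbrakk>0 < \<epsilon>; \<epsilon> \<le> 1\<rbrakk> \<Longrightarrow>
      (\<integral>\<^sup>+\<omega>. ennreal (\<bar>d \<omega>\<bar> * (exp (a * \<bar>P \<omega>\<bar>) * exp (- \<epsilon> * \<bar>u + Q \<omega>\<bar> / 4))) \<partial>M) \<le> ennreal (C / \<epsilon>)"
    and C_pos: "C > 0"
begin

text \<open>One factor \<open>\<epsilon>\<close> stems from each of the two densities G' =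
  \<open>\<epsilon> * exp (log_profile \<epsilon> r u)\<close> in the bilinear form.\<close>

definition \<Psi> :: "real \<Rightarrow> (real \<Rightarrow> real) \<Rightarrow> real \<Rightarrow> real" where
  "\<Psi> \<epsilon> r u = \<epsilon>\<^sup>2 * (\<integral>\<omega>. d \<omega> * exp (log_ratio \<epsilon> r u (P \<omega>) (Q \<omega>)) \<partial>M)"

definition \<Psi>' :: "real \<Rightarrow> (real \<Rightarrow> real) \<Rightarrow> (real \<Rightarrow> real) \<Rightarrow> real \<Rightarrow> real" where
  "\<Psi>' \<epsilon> r s u = \<epsilon>\<^sup>2 * (\<integral>\<omega>. d \<omega> * (exp (log_ratio \<epsilon> r u (P \<omega>) (Q \<omega>))
      * log_ratio' \<epsilon> r s u (P \<omega>) (Q \<omega>)) \<partial>M)"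

lemma weighted_integral:
  assumes eps: "0 < \<epsilon>" "\<epsilon> \<le> 1" and [measurable]: "f \<in> borel_measurable M" and "c \<ge> 0"
    and le: "\<And>\<omega>. \<bar>f \<omega>\<bar> \<le> c * (exp (a * \<bar>P \<omega>\<bar>) * exp (- \<epsilon> * \<bar>u + Q \<omega>\<bar> / 4))"
  shows "integrable M (\<lambda>\<omega>. d \<omega> * f \<omega>)" "\<bar>\<integral>\<omega>. d \<omega> * f \<omega> \<partial>M\<bar> \<le> c * C / \<epsilon>"
proof -
  have "(\<integral>\<^sup>+\<omega>. ennreal (norm (d \<omega> * f \<omega>)) \<partial>M)
     \<le> (\<integral>\<^sup>+\<omega>. ennreal c * ennreal (\<bar>d \<omega>\<bar> * (exp (a * \<bar>P \<omega>\<bar>) * exp (- \<epsilon> * \<bar>u + Q \<omega>\<bar> / 4))) \<partial>M)"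
  proof (rule nn_integral_mono)
    fix \<omega>
    have "\<bar>d \<omega>\<bar> * \<bar>f \<omega>\<bar> \<le> \<bar>d \<omega>\<bar> * (c * (exp (a * \<bar>P \<omega>\<bar>) * exp (- \<epsilon> * \<bar>u + Q \<omega>\<bar> / 4)))"
      by (intro mult_left_mono le) auto
    then show "ennreal (norm (d \<omega> * f \<omega>))
      \<le> ennreal c * ennreal (\<bar>d \<omega>\<bar> * (exp (a * \<bar>P \<omega>\<bar>) * exp (- \<epsilon> * \<bar>u + Q \<omega>\<bar> / 4)))"
      using \<open>c \<ge> 0\<close> by (simp add: ennreal_mult[symmetric] abs_mult ennreal_leI algebra_simps)
  qed
  also have "\<dots> = ennreal c * (\<integral>\<^sup>+\<omega>. ennreal (\<bar>d \<omega>\<bar> * (exp (a * \<bar>P \<omega>\<bar>) * exp (- \<epsilon> * \<bar>u + Q \<omega>\<bar> / 4))) \<partial>M)"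
    by (rule nn_integral_cmult) measurable
  also have "\<dots> \<le> ennreal c * ennreal (C / \<epsilon>)"
    by (intro mult_left_mono weight eps) simp
  also have "\<dots> = ennreal (c * C / \<epsilon>)"
    using \<open>c \<ge> 0\<close> eps C_pos by (simp add: ennreal_mult[symmetric])
  finally have *: "(\<integral>\<^sup>+\<omega>. ennreal (norm (d \<omega> * f \<omega>)) \<partial>M) \<le> ennreal (c * C / \<epsilon>)" .
  show i: "integrable M (\<lambda>\<omega>. d \<omega> * f \<omega>)"
  proof (rule integrableI_bounded)
    show "(\<integral>\<^sup>+\<omega>. ennreal (norm (d \<omega> * f \<omega>)) \<partial>M) < \<infinity>"
      using * by (rule order_le_less_trans) simp
  qed measurable
  have "ennreal (norm (\<integral>\<omega>. d \<omega> * f \<omega> \<partial>M)) \<le> ennreal (c * C / \<epsilon>)"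
    using integral_norm_bound_ennreal[OF i] * by (rule order_trans)
  then show "\<bar>\<integral>\<omega>. d \<omega> * f \<omega> \<partial>M\<bar> \<le> c * C / \<epsilon>"
    using \<open>c \<ge> 0\<close> eps C_pos by (simp add: ennreal_le_iff)
qed

context
  fixes \<epsilon> :: real
  assumes eps: "0 < \<epsilon>" "\<epsilon> \<le> 1" "3 * \<epsilon> \<le> a"
begin

lemma measurable_exp_log_ratio [measurable]:
  assumes "C1_small r s"
  shows "(\<lambda>\<omega>. exp (log_ratio \<epsilon> r u (P \<omega>) (Q \<omega>))) \<in> borel_measurable M"
proof -
  have [measurable]: "log_profile \<epsilon> r \<in> borel_measurable borel"
    by (rule borel_measurable_continuous_onI[OF continuous_on_log_profile[OF eps(1) assms]])
  show ?thesis unfolding log_ratio_def by measurable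
qed

lemma measurable_log_ratio' [measurable]:
  assumes "C1_small r s"
  shows "(\<lambda>\<omega>. log_ratio' \<epsilon> r s u (P \<omega>) (Q \<omega>)) \<in> borel_measurable M"
proof -
  have [measurable]: "log_profile' \<epsilon> r s \<in> borel_measurable borel"
    by (rule borel_measurable_continuous_onI[OF continuous_on_log_profile'[OF eps(1) assms]])
  show ?thesis unfolding log_ratio'_def by measurable
qed

lemma integrable_exp_log_ratio:
  assumes "C1_small r s"
  shows "integrable M (\<lambda>\<omega>. d \<omega> * exp (log_ratio \<epsilon> r u (P \<omega>) (Q \<omega>)))"
  by (rule weighted_integral(1)[OF eps(1,2) measurable_exp_log_ratio[OF assms], where c
      = "9/4" and u = u])
    (use exp_log_ratio_le_weight[OF eps(1) assms eps(3)] in auto)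

lemma abs_exp_log_ratio_log_ratio'_le:
  assumes "C1_small r s"
  shows "\<bar>exp (log_ratio \<epsilon> r u p q) * log_ratio' \<epsilon> r s u p q\<bar>
      \<le> 63/4 * (exp (a * \<bar>p\<bar>) * exp (- \<epsilon> * \<bar>u + q\<bar> / 4))"
proof -
  have "\<bar>exp (log_ratio \<epsilon> r u p q)\<bar> * \<bar>log_ratio' \<epsilon> r s u p q\<bar>
      \<le> (9/4 * (exp (a * \<bar>p\<bar>) * exp (- \<epsilon> * \<bar>u + q\<bar> / 4))) * 7"
    using exp_log_ratio_le_weight[OF eps(1) assms eps(3), of u p q]
        abs_log_ratio'_le[OF eps(1) assms eps(2), of u p q]
    by (intro mult_mono) auto
  then show ?thesis by (simp add: abs_mult)
qed

lemma integrable_exp_log_ratio_log_ratio':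
  assumes "C1_small r s"
  shows "integrable M (\<lambda>\<omega>. d \<omega> * (exp (log_ratio \<epsilon> r u (P \<omega>) (Q \<omega>)) * log_ratio' \<epsilon> r s u (P \<omega>) (Q \<omega>)))"
  by (rule weighted_integral(1)[OF eps(1,2), where c = "63/4" and u = u])
    (use abs_exp_log_ratio_log_ratio'_le[OF assms] measurable_exp_log_ratio[OF assms]
        measurable_log_ratio'[OF assms] in auto)

lemma DERIV_log_ratio:
  assumes "C1_small r s"
  shows "((\<lambda>u. log_ratio \<epsilon> r u p q) has_real_derivative log_ratio' \<epsilon> r s u p q) (at u)"
  unfolding log_ratio_def log_ratio'_def
  by (auto intro!: derivative_eq_intros DERIV_chain2[OF DERIV_log_profile[OF eps(1) assms]]
      DERIV_log_logistic[OF eps(1) assms])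

text \<open>Domination for differentiating under the integral: moving the base point by less than 1
  changes the weight by a factor of at most \<open>exp 1 \<le> 3\<close>, and 63/4 * 3 \<le>
  48.\<close>

lemma local_weight_bound:
  assumes "C1_small r s" "\<bar>x - u\<bar> < 1"
  shows "\<bar>d \<omega> * (exp (log_ratio \<epsilon> r x (P \<omega>) (Q \<omega>)) * log_ratio' \<epsilon> r s x (P \<omega>) (Q \<omega>))\<bar>
     \<le> \<bar>d \<omega> * (48 * (exp (a * \<bar>P \<omega>\<bar>) * exp (- \<epsilon> * \<bar>u + Q \<omega>\<bar> / 4)))\<bar>"
proof -
  have "\<bar>u + Q \<omega>\<bar> \<le> \<bar>x + Q \<omega>\<bar> + 1" using assms(2) by linarith
  then have "\<epsilon> * \<bar>u + Q \<omega>\<bar> \<le> \<epsilon> * (\<bar>x + Q \<omega>\<bar> + 1)" using eps by (intro mult_left_mono) auto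
  then have "- \<epsilon> * \<bar>x + Q \<omega>\<bar> / 4 \<le> 1 + - \<epsilon> * \<bar>u + Q \<omega>\<bar> / 4"
    using eps by (simp add: algebra_simps)
  then have "exp (- \<epsilon> * \<bar>x + Q \<omega>\<bar> / 4) \<le> exp 1 * exp (- \<epsilon> * \<bar>u + Q \<omega>\<bar> / 4)"
    by (simp add: exp_add[symmetric])
  also have "\<dots> \<le> 3 * exp (- \<epsilon> * \<bar>u + Q \<omega>\<bar> / 4)" using exp_le by (intro mult_right_mono) auto
  finally have "63/4 * (exp (a * \<bar>P \<omega>\<bar>) * exp (- \<epsilon> * \<bar>x + Q \<omega>\<bar> / 4))
      \<le> 63/4 * (exp (a * \<bar>P \<omega>\<bar>) * (3 * exp (- \<epsilon> * \<bar>u + Q \<omega>\<bar> / 4)))"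
    by (intro mult_left_mono) auto
  then have "\<bar>exp (log_ratio \<epsilon> r x (P \<omega>) (Q \<omega>)) * log_ratio' \<epsilon> r s x (P \<omega>) (Q \<omega>)\<bar>
      \<le> 48 * (exp (a * \<bar>P \<omega>\<bar>) * exp (- \<epsilon> * \<bar>u + Q \<omega>\<bar> / 4))"
    using abs_exp_log_ratio_log_ratio'_le[OF assms(1), of x "P \<omega>" "Q \<omega>"]
      mult_pos_pos[OF exp_gt_zero[of "a * \<bar>P \<omega>\<bar>"] exp_gt_zero[of "- \<epsilon> * \<bar>u + Q \<omega>\<bar> / 4"]]
    by linarith
  then show ?thesis unfolding abs_mult[of "d \<omega>"] by (intro mult_left_mono) auto
qed

lemma integrable_local_weight:
  "integrable M (\<lambda>\<omega>. \<bar>d \<omega> * (48 * (exp (a * \<bar>P \<omega>\<bar>) * exp (- \<epsilon> * \<bar>u + Q \<omega>\<bar> / 4)))\<bar>)"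
  by (intro integrable_abs weighted_integral(1)[OF eps(1,2), where c = 48 and u = u]) auto

lemma DERIV_\<Psi>:
  assumes "C1_small r s"
  shows "(\<Psi> \<epsilon> r has_real_derivative \<Psi>' \<epsilon> r s u) (at u)"
  unfolding \<Psi>_def[abs_def] \<Psi>'_def
  by (intro DERIV_cmult DERIV_integral_dominated[OF _ integrable_exp_log_ratio[OF assms] _
      integrable_local_weight[of u]
        local_weight_bound[OF assms]])
    (auto intro!: derivative_eq_intros DERIV_log_ratio[OF assms]
        borel_measurable_integrable[OF integrable_exp_log_ratio_log_ratio'[OF assms]])

lemma continuous_on_\<Psi>':
  assumes "C1_small r s"
  shows "continuous_on UNIV (\<Psi>' \<epsilon> r s)"
proof -
  have c: "isCont (log_profile \<epsilon> r) v" "isCont (log_profile' \<epsilon> r s) v" "isCont (log_logistic \<epsilon> r) v"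
      "isCont (log_logistic' \<epsilon> r) v" for v
    using continuous_on_log_profile[OF eps(1) assms] continuous_on_log_profile'[OF eps(1) assms]
      continuous_on_log_logistic[OF eps(1) assms] continuous_on_log_logistic'[OF eps(1) assms]
    by (auto simp: continuous_on_eq_continuous_at)
  have "isCont (\<lambda>u. d \<omega> * (exp (log_ratio \<epsilon> r u (P \<omega>) (Q \<omega>)) * log_ratio' \<epsilon> r s u (P \<omega>) (Q \<omega>))) u"
      for u \<omega>
    unfolding log_ratio_def log_ratio'_def
    by (intro continuous_intros isCont_o2[OF _ c(1)] isCont_o2[OF _ c(2)] c)
  then have "isCont (\<lambda>x. \<integral>\<omega>. d \<omega> * (exp (log_ratio \<epsilon> r x (P \<omega>) (Q \<omega>))
      * log_ratio' \<epsilon> r s x (P \<omega>) (Q \<omega>)) \<partial>M) u" for u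
    by (rule isCont_integral_dominated[OF _ borel_measurable_integrable[OF
        integrable_exp_log_ratio_log_ratio'[OF assms]]
        integrable_local_weight[of u] local_weight_bound[OF assms]])
  then have "isCont (\<Psi>' \<epsilon> r s) u" for u
    unfolding \<Psi>'_def[abs_def] by (intro isCont_mult continuous_const)
  then show ?thesis by (simp add: continuous_at_imp_continuous_on)
qed

text \<open>The balance behind the contraction: of the prefactor \<open>\<epsilon>\<^sup>2\<close>,
  one power compensates the \<open>1 / \<epsilon>\<close> of the weights and the other one is the
  gain.\<close>

lemma abs_eps_square_le:
  assumes "\<bar>x\<bar> \<le> c * C / \<epsilon>"
  shows "\<bar>\<epsilon>\<^sup>2 * x\<bar> \<le> c * (\<epsilon> * C)"
proof -
  have "\<epsilon>\<^sup>2 * \<bar>x\<bar> \<le> \<epsilon>\<^sup>2 * (c * C / \<epsilon>)" by (intro mult_left_mono assms) auto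
  then show ?thesis using eps by (simp add: abs_mult power2_eq_square field_simps)
qed

lemma \<Psi>_bounds:
  assumes "C1_small r s"
  shows "\<bar>\<Psi> \<epsilon> r u\<bar> \<le> 9/4 * (\<epsilon> * C)" "\<bar>\<Psi>' \<epsilon> r s u\<bar> \<le> 63/4 * (\<epsilon> * C)"
proof -
  note [measurable] = measurable_exp_log_ratio[OF assms] measurable_log_ratio'[OF assms]
  have "\<bar>\<integral>\<omega>. d \<omega> * exp (log_ratio \<epsilon> r u (P \<omega>) (Q \<omega>)) \<partial>M\<bar> \<le> 9/4 * C / \<epsilon>"
    by (rule weighted_integral(2)[OF eps(1,2), where u = u])
      (use exp_log_ratio_le_weight[OF eps(1) assms eps(3)] in auto)
  from abs_eps_square_le[OF this] show "\<bar>\<Psi> \<epsilon> r u\<bar> \<le> 9/4 * (\<epsilon> * C)"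
    by (simp add: \<Psi>_def)
  have "\<bar>\<integral>\<omega>. d \<omega> * (exp (log_ratio \<epsilon> r u (P \<omega>) (Q \<omega>)) * log_ratio' \<epsilon> r s u (P \<omega>) (Q \<omega>)) \<partial>M\<bar>
      \<le> 63/4 * C / \<epsilon>"
    by (rule weighted_integral(2)[OF eps(1,2), where u = u])
      (use abs_exp_log_ratio_log_ratio'_le[OF assms] in auto)
  from abs_eps_square_le[OF this] show "\<bar>\<Psi>' \<epsilon> r s u\<bar> \<le> 63/4 * (\<epsilon> * C)"
    by (simp add: \<Psi>'_def)
qed

lemma \<Psi>_diff_bounds:
  assumes rs: "C1_small r1 s1" "C1_small r2 s2"
    and eta: "\<And>v. \<bar>r1 v - r2 v\<bar> \<le> \<eta>" "\<And>v. \<bar>s1 v - s2 v\<bar> \<le> \<eta>"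
  shows "\<bar>\<Psi> \<epsilon> r1 u - \<Psi> \<epsilon> r2 u\<bar> \<le> 63 * \<eta> * (\<epsilon> * C)"
    "\<bar>\<Psi>' \<epsilon> r1 s1 u - \<Psi>' \<epsilon> r2 s2 u\<bar> \<le> 507 * \<eta> * (\<epsilon> * C)"
proof -
  have eta0: "\<eta> \<ge> 0" using eta(1)[of 0] by linarith
  note [measurable] = measurable_exp_log_ratio[OF rs(1)] measurable_exp_log_ratio[OF rs(2)]
    measurable_log_ratio'[OF rs(1)] measurable_log_ratio'[OF rs(2)]
  have "\<bar>\<integral>\<omega>. d \<omega> * (exp (log_ratio \<epsilon> r1 u (P \<omega>) (Q \<omega>)) - exp (log_ratio \<epsilon> r2 u (P \<omega>) (Q \<omega>))) \<partial>M\<bar>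
      \<le> 63 * \<eta> * C / \<epsilon>"
    by (rule weighted_integral(2)[OF eps(1,2), where u = u])
      (use exp_log_ratio_diff_le[OF eps rs eta(1)] eta0 in auto)
  from abs_eps_square_le[OF this] show "\<bar>\<Psi> \<epsilon> r1 u - \<Psi> \<epsilon> r2 u\<bar> \<le> 63 * \<eta> * (\<epsilon> * C)"
    using integrable_exp_log_ratio[OF rs(1)] integrable_exp_log_ratio[OF rs(2)]
    by (simp add: \<Psi>_def right_diff_distrib)
  have "\<bar>\<integral>\<omega>. d \<omega> * (exp (log_ratio \<epsilon> r1 u (P \<omega>) (Q \<omega>)) * log_ratio' \<epsilon> r1 s1 u (P \<omega>) (Q \<omega>)
        - exp (log_ratio \<epsilon> r2 u (P \<omega>) (Q \<omega>)) * log_ratio' \<epsilon> r2 s2 u (P \<omega>) (Q \<omega>)) \<partial>M\<bar> \<le> 507 * \<eta> * C / \<epsilon>"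
    by (rule weighted_integral(2)[OF eps(1,2), where u = u])
      (use exp_log_ratio_log_ratio'_diff_le[OF eps rs eta] eta0 in auto)
  from abs_eps_square_le[OF this] show "\<bar>\<Psi>' \<epsilon> r1 s1 u - \<Psi>' \<epsilon> r2 s2 u\<bar> \<le> 507 * \<eta> * (\<epsilon> * C)"
    using integrable_exp_log_ratio_log_ratio'[OF rs(1)] integrable_exp_log_ratio_log_ratio'[OF rs(2)]
    by (simp add: \<Psi>'_def right_diff_distrib)
qed

text \<open>2028 = 4 * 507, so the larger of the two Lipschitz constants is at most 1/4. The same
  threshold keeps the images well within the bound 1/2.\<close>

theorem fixed_point:
  assumes small: "\<epsilon> * C \<le> 1 / 2028"
  shows "\<exists>r s. C1_small r s \<and> \<Psi> \<epsilon> r = r"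
proof (rule C1_contraction[where \<Psi>' = "\<Psi>' \<epsilon>"])
  fix r s assume rs: "C1_small r s"
  show "C1_small (\<Psi> \<epsilon> r) (\<Psi>' \<epsilon> r s)"
    unfolding C1_small_def
  proof (intro conjI allI)
    show "\<bar>\<Psi> \<epsilon> r u\<bar> \<le> 1/2" "\<bar>\<Psi>' \<epsilon> r s u\<bar> \<le> 1/2" for u
      using \<Psi>_bounds[OF rs, of u] small by linarith+
  qed (use DERIV_\<Psi>[OF rs] continuous_on_\<Psi>'[OF rs] in auto)
next
  fix r1 s1 r2 s2 :: "real \<Rightarrow> real" and \<eta> u :: real
  assume rs: "C1_small r1 s1" "C1_small r2 s2"
    and eta: "\<And>v. \<bar>r1 v - r2 v\<bar> \<le> \<eta>" "\<And>v. \<bar>s1 v - s2 v\<bar> \<le> \<eta>"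
  have "\<eta> \<ge> 0" using eta(1)[of 0] by linarith
  then have "\<eta> * (\<epsilon> * C) \<le> \<eta> * (1 / 2028)" "\<eta> * (\<epsilon> * C) \<ge> 0"
    using small eps C_pos by (intro mult_left_mono mult_nonneg_nonneg; simp)+
  then show "\<bar>\<Psi> \<epsilon> r1 u - \<Psi> \<epsilon> r2 u\<bar> \<le> \<eta> / 4 \<and> \<bar>\<Psi>' \<epsilon> r1 s1 u - \<Psi>' \<epsilon> r2 s2 u\<bar> \<le> \<eta> / 4"
    using \<Psi>_diff_bounds[OF rs eta, of u] by linarith
qed

end

end

section \<open>Asymptotics of the fixed point\<close>

text \<open>Adding \<open>C / c * exp (- c * v)\<close> to \<open>f\<close> gives a nonincreasing
  function, subtracting it a nondecreasing one. Comparing the values at 0 and \<open>u\<close>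
  bounds the increment from both sides.\<close>

lemma bounded_of_exp_decaying_DERIV:
  fixes f h :: "real \<Rightarrow> real"
  assumes d: "\<And>v. v \<ge> 0 \<Longrightarrow> (f has_real_derivative h v) (at v)"
    and h: "\<And>v. v \<ge> 0 \<Longrightarrow> \<bar>h v\<bar> \<le> C * exp (- c * v)" and c: "c > 0" and u: "u \<ge> 0"
  shows "\<bar>f u - f 0\<bar> \<le> C / c"
proof -
  have C: "C \<ge> 0" using h[of 0] by simp
  have e: "((\<lambda>v. C / c * exp (- c * v)) has_real_derivative - (C * exp (- c * v))) (at v)" for v
    using c by (auto intro!: derivative_eq_intros simp: field_simps)
  have "f u + C / c * exp (- c * u) \<le> f 0 + C / c * exp (- c * 0)"
  proof (rule DERIV_nonpos_imp_nonincreasing[OF u])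
    fix x assume "0 \<le> x" "x \<le> u"
    then show "\<exists>y. ((\<lambda>v. f v + C / c * exp (- c * v)) has_real_derivative y) (at x) \<and> y \<le> 0"
      using DERIV_add[OF d e, of x] h[of x]
      by (intro exI[of _ "h x + - (C * exp (- c * x))"] conjI) auto
  qed
  moreover have "f 0 - C / c * exp (- c * 0) \<le> f u - C / c * exp (- c * u)"
  proof (rule DERIV_nonneg_imp_nondecreasing[OF u])
    fix x assume "0 \<le> x" "x \<le> u"
    then show "\<exists>y. ((\<lambda>v. f v - C / c * exp (- c * v)) has_real_derivative y) (at x) \<and> 0 \<le> y"
      using DERIV_diff[OF d e, of x] h[of x]
      by (intro exI[of _ "h x - - (C * exp (- c * x))"] conjI) auto
  qed
  moreover have "C / c * exp (- c * u) \<ge> 0" using C c by simp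
  ultimately show ?thesis by auto
qed

lemma integral_norm_le:
  fixes f g :: "'w \<Rightarrow> real"
  assumes "integrable M f" "integrable M g" "\<And>\<omega>. norm (f \<omega>) \<le> g \<omega>"
  shows "norm (\<integral>\<omega>. f \<omega> \<partial>M) \<le> (\<integral>\<omega>. g \<omega> \<partial>M)"
  by (rule order_trans[OF integral_norm_bound integral_mono[OF integrable_norm[OF assms(1)] assms(2,3)]])

text \<open>The function G of the overview, with \<sigma>(x) = (1 + tanh(x/2))/2.\<close>

definition logistic :: "real \<Rightarrow> (real \<Rightarrow> real) \<Rightarrow> real \<Rightarrow> real" where
  "logistic \<epsilon> r u = (1 + tanh (phase \<epsilon> r u / 2)) / 2"

lemma exp_log_logistic: "exp (log_logistic \<epsilon> r u) = logistic \<epsilon> r u * (1 - logistic \<epsilon> r u)"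
proof -
  have "exp (log_logistic \<epsilon> r u) = inverse ((2 * cosh (phase \<epsilon> r u / 2)) ^ 2)"
    by (simp add: log_logistic_def exp_minus exp_double)
  also have "\<dots> = (1 - tanh (phase \<epsilon> r u / 2) ^ 2) / 4"
    by (simp add: tanh_def power_divide sinh_square_eq power_mult_distrib divide_simps)
  also have "\<dots> = logistic \<epsilon> r u * (1 - logistic \<epsilon> r u)"
    by (simp add: logistic_def field_simps power2_eq_square)
  finally show ?thesis .
qed

lemma one_minus_logistic_le: "1 - logistic \<epsilon> r u \<le> exp (- phase \<epsilon> r u)"
proof -
  define y where "y = exp (- phase \<epsilon> r u)"
  have "y > 0" by (simp add: y_def)
  have "tanh (phase \<epsilon> r u / 2) = (1 - y) / (1 + y)"
    by (simp add: tanh_real_altdef y_def)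
  then have "1 - logistic \<epsilon> r u = y / (1 + y)" using \<open>y > 0\<close> by (simp add: logistic_def field_simps)
  also have "\<dots> \<le> y" using \<open>y > 0\<close> by (simp add: field_simps)
  finally show ?thesis by (simp add: y_def)
qed

lemma logistic_bounds: "0 < logistic \<epsilon> r u" "logistic \<epsilon> r u < 1"
  using tanh_real_bounds[of "phase \<epsilon> r u / 2"] by (auto simp: logistic_def)

context
  fixes \<epsilon> :: real and r s :: "real \<Rightarrow> real"
  assumes eps: "\<epsilon> > 0" and rs: "C1_small r s"
begin

lemma DERIV_logistic: "(logistic \<epsilon> r has_real_derivative \<epsilon> * exp (log_profile \<epsilon> r u)) (at u)"
proof -
  have "(logistic \<epsilon> r has_real_derivative (1 - tanh (phase \<epsilon> r u / 2) ^ 2) * (\<epsilon> * (1 + r u) / 2)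
      / 2) (at u)"
    unfolding logistic_def[abs_def] by (auto intro!: derivative_eq_intros DERIV_phase[OF eps rs])
  moreover have "1 - tanh (phase \<epsilon> r u / 2) ^ 2 = 4 * exp (log_logistic \<epsilon> r u)"
    unfolding exp_log_logistic by (simp add: logistic_def field_simps power2_eq_square)
  ultimately show ?thesis by (simp add: exp_log_profile[OF eps rs] mult_ac)
qed

lemma filterlim_phase_at_top: "filterlim (phase \<epsilon> r) at_top at_top"
proof (rule filterlim_at_top_mono)
  show "filterlim (\<lambda>u. \<epsilon> / 2 * u) at_top at_top"
    using eps by (intro filterlim_tendsto_pos_mult_at_top[OF tendsto_const] filterlim_ident) auto
  show "\<forall>\<^sub>F u in at_top. \<epsilon> / 2 * u \<le> phase \<epsilon> r u"
    using eventually_ge_at_top[of 0] by eventually_elim (use phase_bounds(1)[OF eps rs] in auto)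
qed

lemma filterlim_phase_at_bot: "filterlim (phase \<epsilon> r) at_bot at_bot"
proof (rule filterlim_at_bot_mono)
  show "filterlim (\<lambda>u. \<epsilon> / 2 * u) at_bot at_bot"
    using eps by (intro filterlim_tendsto_pos_mult_at_bot[OF tendsto_const] filterlim_ident) auto
  show "\<forall>\<^sub>F u in at_bot. phase \<epsilon> r u \<le> \<epsilon> / 2 * u"
    using eventually_le_at_bot[of 0] by eventually_elim (use phase_bounds(2)[OF eps rs] in auto)
qed

lemma logistic_at_top: "(logistic \<epsilon> r \<longlongrightarrow> 1) at_top"
proof -
  have "filterlim (\<lambda>u. 1/2 * phase \<epsilon> r u) at_top at_top"
    by (intro filterlim_tendsto_pos_mult_at_top[OF tendsto_const] filterlim_phase_at_top) auto
  then have "((\<lambda>u. tanh (1/2 * phase \<epsilon> r u)) \<longlongrightarrow> 1) at_top"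
    by (rule filterlim_compose[OF tanh_real_at_top])
  then have "((\<lambda>u. (1 + tanh (1/2 * phase \<epsilon> r u)) / 2) \<longlongrightarrow> (1 + 1) / 2) at_top"
    by (intro tendsto_intros) auto
  then show ?thesis by (simp add: logistic_def[abs_def])
qed

lemma logistic_at_bot: "(logistic \<epsilon> r \<longlongrightarrow> 0) at_bot"
proof -
  have "filterlim (\<lambda>u. 1/2 * phase \<epsilon> r u) at_bot at_bot"
    by (intro filterlim_tendsto_pos_mult_at_bot[OF tendsto_const] filterlim_phase_at_bot) auto
  then have "((\<lambda>u. tanh (1/2 * phase \<epsilon> r u)) \<longlongrightarrow> -1) at_bot"
    by (rule filterlim_compose[OF tanh_real_at_bot])
  then have "((\<lambda>u. (1 + tanh (1/2 * phase \<epsilon> r u)) / 2) \<longlongrightarrow> (1 + -1) / 2) at_bot"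
    by (intro tendsto_intros) auto
  then show ?thesis by (simp add: logistic_def[abs_def])
qed

lemma exp_log_profile_le: "exp (log_profile \<epsilon> r u) \<le> 3/2 * exp (- \<epsilon> * \<bar>u\<bar> / 2)"
  unfolding exp_log_profile[OF eps rs] using one_plus_bounds[OF eps rs, of u]
      log_logistic_le[OF eps rs, of u]
  by (intro mult_mono) auto

text \<open>Decay of \<open>r\<close> bounds its primitive on the left half-line, hence the phase is
  \<open>\<epsilon> * u\<close> up to a constant. It is nonpositive there, so
  \<open>log_logistic\<close>, which is minus its modulus up to \<open>2 * ln 2\<close>, inherits
  the slope \<open>\<epsilon>\<close>.\<close>

lemma exp_log_profile_left:
  assumes r: "\<And>u. u \<le> 0 \<Longrightarrow> \<bar>r u\<bar> \<le> B * exp (c * u)" and c: "c > 0"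
  shows "\<exists>m>0. \<forall>u\<le>0. exp (\<epsilon> * u) / m \<le> exp (log_profile \<epsilon> r u) \<and> exp (log_profile \<epsilon> r u)
      \<le> m * exp (\<epsilon> * u)"
proof -
  \<comment> \<open>The summand 4 covers the error \<open>2 * ln 2\<close> of
    \<open>log_logistic\<close> and the bound 1 for \<open>ln (1 + r u)\<close>.\<close>
  define D where "D = \<epsilon> * (B / c) + 4"
  have "\<bar>log_profile \<epsilon> r u - \<epsilon> * u\<bar> \<le> D" if u: "u \<le> 0" for u
  proof -
    have "\<bar>primitive r (- (-u)) - primitive r (- 0)\<bar> \<le> B / c"
    \<comment> \<open>Reflection turns decay at minus infinity into decay on the right
      half-line.\<close>
    proof (rule bounded_of_exp_decaying_DERIV[where f = "\<lambda>v. primitive r (- v)" and h = "\<lambda>v. - r (- v)"])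
      show "((\<lambda>v. primitive r (- v)) has_real_derivative - r (- v)) (at v)" for v
        using DERIV_chain2[OF DERIV_primitive[OF C1_small_continuous[OF rs]]
            DERIV_minus[OF DERIV_ident], of v]
        by simp
      show "\<bar>- r (- v)\<bar> \<le> B * exp (- c * v)" if "v \<ge> 0" for v
        using r[of "-v"] that by simp
    qed (use u c in auto)
    then have "\<epsilon> * \<bar>primitive r u\<bar> \<le> \<epsilon> * (B / c)" using eps by (intro mult_left_mono) auto
    then have p: "\<bar>phase \<epsilon> r u - \<epsilon> * u\<bar> \<le> \<epsilon> * (B / c)"
      using eps by (simp add: phase_def algebra_simps abs_mult)
    have "phase \<epsilon> r u \<le> 0" using phase_bounds(2)[OF eps rs u] mult_nonneg_nonpos[of \<epsilon> u] eps u
        by linarith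
    moreover have "\<bar>ln (1 + r u)\<bar> \<le> 1"
    proof -
      have "ln (1/2) \<le> ln (1 + r u)" "ln (1 + r u) \<le> r u"
        using one_plus_bounds[OF eps rs, of u] ln_add_one_self_le_self2[of "r u"] by (auto simp: )
      then show ?thesis using ln_2_less_1 one_plus_bounds(2)[OF eps rs, of u] by (simp add: ln_div)
    qed
    ultimately show ?thesis
      using p log_logistic_le_phase[of \<epsilon> r u] log_logistic_ge_phase[of \<epsilon> r u] ln_2_less_1
          unfolding log_profile_def D_def by linarith
  qed
  then have "exp (\<epsilon> * u) / exp D \<le> exp (log_profile \<epsilon> r u) \<and> exp (log_profile \<epsilon> r u)
      \<le> exp D * exp (\<epsilon> * u)" if "u \<le> 0" for u
    unfolding exp_diff[symmetric] exp_add[symmetric] exp_le_cancel_iff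
    using that by (smt (verit))
  then show ?thesis by (intro exI[of _ "exp D"]) auto
qed

text \<open>Now \<open>r\<close> tends to \<open>\<rho>\<close> instead of 0, which changes the
  slope of the phase to \<open>\<epsilon> * (1 + \<rho>)\<close>; the phase is nonnegative, so the
  profile decays with this rate.\<close>

lemma exp_log_profile_right:
  assumes r: "\<And>u. u \<ge> 0 \<Longrightarrow> \<bar>r u - \<rho>\<bar> \<le> B * exp (- c * u)" and c: "c > 0"
  shows "\<exists>m>0. \<forall>u\<ge>0. exp (- (\<epsilon> * (1 + \<rho>) * u)) / m \<le> exp (log_profile \<epsilon> r u)
    \<and> exp (log_profile \<epsilon> r u) \<le> m * exp (- (\<epsilon> * (1 + \<rho>) * u))"
proof -
  define D where "D = \<epsilon> * (B / c) + 4"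
  have "\<bar>log_profile \<epsilon> r u + \<epsilon> * (1 + \<rho>) * u\<bar> \<le> D" if u: "u \<ge> 0" for u
  proof -
    have "\<bar>(primitive r u - \<rho> * u) - (primitive r 0 - \<rho> * 0)\<bar> \<le> B / c"
      by (rule bounded_of_exp_decaying_DERIV[where f = "\<lambda>v. primitive r v - \<rho> * v" and h
          = "\<lambda>v. r v - \<rho>"])
        (use u c r in \<open>auto intro!: derivative_eq_intros DERIV_primitive[OF C1_small_continuous[OF rs]]\<close>)
    then have "\<epsilon> * \<bar>primitive r u - \<rho> * u\<bar> \<le> \<epsilon> * (B / c)" using eps by (intro mult_left_mono) auto
    moreover have "phase \<epsilon> r u - \<epsilon> * (1 + \<rho>) * u = \<epsilon> * (primitive r u - \<rho> * u)"
      by (simp add: phase_def algebra_simps)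
    ultimately have p: "\<bar>phase \<epsilon> r u - \<epsilon> * (1 + \<rho>) * u\<bar> \<le> \<epsilon> * (B / c)"
      using eps by (simp add: abs_mult)
    have "phase \<epsilon> r u \<ge> 0" using phase_bounds(1)[OF eps rs u] mult_nonneg_nonneg[of \<epsilon> u] eps u
        by linarith
    moreover have "\<bar>ln (1 + r u)\<bar> \<le> 1"
    proof -
      have "ln (1/2) \<le> ln (1 + r u)" "ln (1 + r u) \<le> r u"
        using one_plus_bounds[OF eps rs, of u] ln_add_one_self_le_self2[of "r u"] by (auto simp: )
      then show ?thesis using ln_2_less_1 one_plus_bounds(2)[OF eps rs, of u] by (simp add: ln_div)
    qed
    ultimately show ?thesis
      using p log_logistic_le_phase[of \<epsilon> r u] log_logistic_ge_phase[of \<epsilon> r u] ln_2_less_1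
          unfolding log_profile_def D_def by linarith
  qed
  then have "exp (- (\<epsilon> * (1 + \<rho>) * u)) / exp D \<le> exp (log_profile \<epsilon> r u)
      \<and> exp (log_profile \<epsilon> r u) \<le> exp D * exp (- (\<epsilon> * (1 + \<rho>) * u))" if "u \<ge> 0" for u
    unfolding exp_diff[symmetric] exp_add[symmetric] exp_le_cancel_iff
    using that by (smt (verit))
  then show ?thesis by (intro exI[of _ "exp D"]) auto
qed

end

text \<open>
  \<open>d0\<close> is the non-integrable part of the weights, coming from \<open>y\<close> close to \<open>x\<close> and small \<open>z\<close>;
  \<open>d1\<close> decays in all directions.
\<close>

locale split_weights = coagulation_weights M d P Q a C
  for M :: "'w measure" and d P Q :: "'w \<Rightarrow> real" and a C :: real +
  fixes d0 d1 :: "'w \<Rightarrow> real"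
  assumes split: "\<And>\<omega>. d \<omega> = d0 \<omega> + d1 \<omega>"
    and d0_meas [measurable]: "d0 \<in> borel_measurable M" and d1_meas [measurable]: "d1
        \<in> borel_measurable M"
    and d0_nonneg: "\<And>\<omega>. d0 \<omega> \<ge> 0"
    and d0_support: "\<And>\<omega>. d0 \<omega> \<noteq> 0 \<Longrightarrow> Q \<omega> \<le> 0"
    and d0_weight: "\<And>\<epsilon> u. \<lbrakk>0 < \<epsilon>; \<epsilon> \<le> 1\<rbrakk> \<Longrightarrow>
      integrable M (\<lambda>\<omega>. d0 \<omega> * (exp (a * \<bar>P \<omega>\<bar>) * exp (- \<epsilon> * \<bar>u + Q \<omega>\<bar> / 4)))"
    and d0_moment: "integrable M (\<lambda>\<omega>. d0 \<omega> * (\<bar>P \<omega>\<bar> * exp (a * \<bar>P \<omega>\<bar>) * exp (a * \<bar>Q \<omega>\<bar>)))"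
    and d0_marginal: "\<And>F f u. \<lbrakk>\<And>v. (F has_real_derivative f v) (at v); continuous_on UNIV f;
      \<And>v. f v \<ge> 0; (F \<longlongrightarrow> 0) at_bot\<rbrakk> \<Longrightarrow> (\<integral>\<omega>. d0 \<omega> * f (u + Q \<omega>) \<partial>M) = F u"
    and d1_moment: "integrable M (\<lambda>\<omega>. \<bar>d1 \<omega>\<bar> * (exp (a * \<bar>P \<omega>\<bar>) * exp (a * \<bar>Q \<omega>\<bar>)))"
begin

section \<open>Behaviour of the fixed point at both ends\<close>

context
  fixes \<epsilon> :: real and r s :: "real \<Rightarrow> real"
  assumes eps: "0 < \<epsilon>" "\<epsilon> < 1" "3 * \<epsilon> \<le> a" and rs: "C1_small r s" and fixed: "\<Psi> \<epsilon> r = r"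
begin

lemma eps_le: "\<epsilon> \<le> 1" using eps by simp

lemma measurable_exp_log_ratio' [measurable]: "(\<lambda>\<omega>. exp (log_ratio \<epsilon> r u (P \<omega>) (Q \<omega>)))
    \<in> borel_measurable M"
  by (rule measurable_exp_log_ratio[OF eps(1) eps_le eps(3) rs])

text \<open>Trades decay in \<open>u + q\<close> for decay in \<open>u\<close>. The price
  \<open>exp (a * \<bar>q\<bar>)\<close> is affordable wherever the weight has a finite exponential
  moment in \<open>Q\<close>.\<close>

lemma shifted_weight_le: "exp (- \<epsilon> * \<bar>u + q\<bar> / 2) \<le> exp (- \<epsilon> * \<bar>u\<bar> / 2) * exp (a * \<bar>q\<bar>)"
proof -
  have "\<epsilon> * \<bar>u\<bar> \<le> \<epsilon> * (\<bar>u + q\<bar> + \<bar>q\<bar>)" using eps by (intro mult_left_mono) auto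
  moreover have "\<epsilon> * \<bar>q\<bar> \<le> 2 * a * \<bar>q\<bar>" unfolding add_diff_cancel_left' using eps
      by (intro mult_right_mono) auto
  ultimately show ?thesis by (simp add: exp_add[symmetric] algebra_simps)
qed

lemma exp_P_le: "exp (3/2 * \<epsilon> * \<bar>p\<bar>) \<le> exp (a * \<bar>p\<bar>)"
  using mult_right_mono[of "3/2 * \<epsilon>" a "\<bar>p\<bar>"] eps by auto

lemma d1_part:
  "integrable M (\<lambda>\<omega>. d1 \<omega> * exp (log_ratio \<epsilon> r u (P \<omega>) (Q \<omega>)))"
  "\<bar>\<integral>\<omega>. d1 \<omega> * exp (log_ratio \<epsilon> r u (P \<omega>) (Q \<omega>)) \<partial>M\<bar>
     \<le> 9/4 * exp (- \<epsilon> * \<bar>u\<bar> / 2) * (\<integral>\<omega>. \<bar>d1 \<omega>\<bar> * (exp (a * \<bar>P \<omega>\<bar>) * exp (a * \<bar>Q \<omega>\<bar>)) \<partial>M)"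
proof -
  let ?g = "\<lambda>\<omega>. 9/4 * exp (- \<epsilon> * \<bar>u\<bar> / 2) * (\<bar>d1 \<omega>\<bar> * (exp (a * \<bar>P \<omega>\<bar>) * exp (a * \<bar>Q \<omega>\<bar>)))"
  have g: "integrable M ?g" by (intro integrable_mult_right d1_moment)
  have le: "norm (d1 \<omega> * exp (log_ratio \<epsilon> r u (P \<omega>) (Q \<omega>))) \<le> ?g \<omega>" for \<omega>
  proof -
    have "exp (log_ratio \<epsilon> r u (P \<omega>) (Q \<omega>)) \<le> 9/4 * exp (a * \<bar>P \<omega>\<bar>)
        * (exp (- \<epsilon> * \<bar>u\<bar> / 2) * exp (a * \<bar>Q \<omega>\<bar>))"
      by (rule order_trans[OF exp_log_ratio_le[OF eps(1) rs]], rule mult_mono)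
        (use shifted_weight_le exp_P_le in auto)
    then have "\<bar>d1 \<omega>\<bar> * exp (log_ratio \<epsilon> r u (P \<omega>) (Q \<omega>))
      \<le> \<bar>d1 \<omega>\<bar> * (9/4 * exp (a * \<bar>P \<omega>\<bar>) * (exp (- \<epsilon> * \<bar>u\<bar> / 2) * exp (a * \<bar>Q \<omega>\<bar>)))"
      by (intro mult_left_mono) auto
    then show ?thesis by (simp add: abs_mult mult_ac)
  qed
  show i: "integrable M (\<lambda>\<omega>. d1 \<omega> * exp (log_ratio \<epsilon> r u (P \<omega>) (Q \<omega>)))"
    by (rule Bochner_Integration.integrable_bound[OF g])
        (use le in \<open>auto intro: order_trans[OF _ abs_ge_self]\<close>)
  have "norm (\<integral>\<omega>. d1 \<omega> * exp (log_ratio \<epsilon> r u (P \<omega>) (Q \<omega>)) \<partial>M) \<le> (\<integral>\<omega>. ?g \<omega> \<partial>M)"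
    by (rule integral_norm_le[OF i g le])
  then show "\<bar>\<integral>\<omega>. d1 \<omega> * exp (log_ratio \<epsilon> r u (P \<omega>) (Q \<omega>)) \<partial>M\<bar>
     \<le> 9/4 * exp (- \<epsilon> * \<bar>u\<bar> / 2) * (\<integral>\<omega>. \<bar>d1 \<omega>\<bar> * (exp (a * \<bar>P \<omega>\<bar>) * exp (a * \<bar>Q \<omega>\<bar>)) \<partial>M)"
    by simp
qed

lemma d0_integrable: "integrable M (\<lambda>\<omega>. d0 \<omega> * exp (log_ratio \<epsilon> r u (P \<omega>) (Q \<omega>)))"
proof (rule Bochner_Integration.integrable_bound[OF
    integrable_mult_right[OF d0_weight[OF eps(1) eps_le, of u], of "9/4"]])
  show "AE \<omega> in M. norm (d0 \<omega> * exp (log_ratio \<epsilon> r u (P \<omega>) (Q \<omega>)))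
      \<le> norm (9/4 * (d0 \<omega> * (exp (a * \<bar>P \<omega>\<bar>) * exp (- \<epsilon> * \<bar>u + Q \<omega>\<bar> / 4))))"
  proof (rule AE_I2)
    fix \<omega>
    have "d0 \<omega> * exp (log_ratio \<epsilon> r u (P \<omega>) (Q \<omega>))
        \<le> d0 \<omega> * (9/4 * (exp (a * \<bar>P \<omega>\<bar>) * exp (- \<epsilon> * \<bar>u + Q \<omega>\<bar> / 4)))"
      by (intro mult_left_mono exp_log_ratio_le_weight[OF eps(1) rs eps(3)] d0_nonneg)
    then show "norm (d0 \<omega> * exp (log_ratio \<epsilon> r u (P \<omega>) (Q \<omega>)))
      \<le> norm (9/4 * (d0 \<omega> * (exp (a * \<bar>P \<omega>\<bar>) * exp (- \<epsilon> * \<bar>u + Q \<omega>\<bar> / 4))))"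
      using d0_nonneg[of \<omega>] by (simp add: abs_mult)
  qed
qed measurable

lemma fixed_eq:
  "r u = \<epsilon>\<^sup>2 * (\<integral>\<omega>. d0 \<omega> * exp (log_ratio \<epsilon> r u (P \<omega>) (Q \<omega>)) \<partial>M)
      + \<epsilon>\<^sup>2 * (\<integral>\<omega>. d1 \<omega> * exp (log_ratio \<epsilon> r u (P \<omega>) (Q \<omega>)) \<partial>M)"
proof -
  have "r u = \<epsilon>\<^sup>2 * (\<integral>\<omega>. d \<omega> * exp (log_ratio \<epsilon> r u (P \<omega>) (Q \<omega>)) \<partial>M)"
    using fun_cong[OF fixed, of u] by (simp add: \<Psi>_def)
  then show ?thesis
    using d0_integrable[of u] d1_part(1)[of u] by (simp add: split distrib_right distrib_left)
qed

lemma abs_eps2_le: "\<bar>x\<bar> \<le> y \<Longrightarrow> \<bar>\<epsilon>\<^sup>2 * x\<bar> \<le> y"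
proof -
  assume "\<bar>x\<bar> \<le> y"
  then have "\<epsilon>\<^sup>2 * \<bar>x\<bar> \<le> 1 * y" using eps by (intro mult_mono) (auto simp: power_le_one)
  then show ?thesis by (simp add: abs_mult)
qed

text \<open>For \<open>u \<le> 0\<close> and on the support of \<open>d0\<close>, where
  \<open>Q \<le> 0\<close>, the moduli add: \<open>\<bar>u + Q \<omega>\<bar> = \<bar>u\<bar> +
  \<bar>Q \<omega>\<bar>\<close>. Hence the decay in \<open>u\<close> factors out, and what is left
  in \<open>Q\<close> still makes \<open>d0\<close> integrable.\<close>

lemma decay_left: "\<exists>B. \<forall>u\<le>0. \<bar>r u\<bar> \<le> B * exp (\<epsilon> / 2 * u)"
proof -
  define D0 where "D0 = (\<integral>\<omega>. d0 \<omega> * (exp (a * \<bar>P \<omega>\<bar>) * exp (- \<epsilon> * \<bar>0 + Q \<omega>\<bar> / 4)) \<partial>M)"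
  define D1 where "D1 = (\<integral>\<omega>. \<bar>d1 \<omega>\<bar> * (exp (a * \<bar>P \<omega>\<bar>) * exp (a * \<bar>Q \<omega>\<bar>)) \<partial>M)"
  have "\<bar>r u\<bar> \<le> (9/4 * D0 + 9/4 * D1) * exp (\<epsilon> / 2 * u)" if u: "u \<le> 0" for u
  proof -
    let ?g = "\<lambda>\<omega>. 9/4 * exp (\<epsilon> / 2 * u) * (d0 \<omega> * (exp (a * \<bar>P \<omega>\<bar>) * exp (- \<epsilon> * \<bar>0 + Q \<omega>\<bar> / 4)))"
    have g: "integrable M ?g" by (intro integrable_mult_right d0_weight eps eps_le)
    have le: "norm (d0 \<omega> * exp (log_ratio \<epsilon> r u (P \<omega>) (Q \<omega>))) \<le> ?g \<omega>" for \<omega>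
    proof (cases "d0 \<omega> = 0")
      case False
      have q: "Q \<omega> \<le> 0" by (rule d0_support[OF False])
      have "\<epsilon> * Q \<omega> \<le> 0" using eps q by (simp add: mult_nonneg_nonpos)
      then have "exp (- \<epsilon> * \<bar>u + Q \<omega>\<bar> / 2) \<le> exp (\<epsilon> / 2 * u) * exp (- \<epsilon> * \<bar>0 + Q \<omega>\<bar> / 4)"
        using u q by (simp add: exp_add[symmetric] algebra_simps)
      then have "exp (log_ratio \<epsilon> r u (P \<omega>) (Q \<omega>))
          \<le> 9/4 * exp (a * \<bar>P \<omega>\<bar>) * (exp (\<epsilon> / 2 * u) * exp (- \<epsilon> * \<bar>0 + Q \<omega>\<bar> / 4))"
        by (intro order_trans[OF exp_log_ratio_le[OF eps(1) rs]] mult_mono)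
          (use exp_P_le in auto)
      then have "d0 \<omega> * exp (log_ratio \<epsilon> r u (P \<omega>) (Q \<omega>))
          \<le> d0 \<omega> * (9/4 * exp (a * \<bar>P \<omega>\<bar>) * (exp (\<epsilon> / 2 * u) * exp (- \<epsilon> * \<bar>0 + Q \<omega>\<bar> / 4)))"
        by (intro mult_left_mono d0_nonneg)
      then show ?thesis using d0_nonneg[of \<omega>] by (simp add: abs_mult mult_ac)
    qed simp
    have "norm (\<integral>\<omega>. d0 \<omega> * exp (log_ratio \<epsilon> r u (P \<omega>) (Q \<omega>)) \<partial>M) \<le> (\<integral>\<omega>. ?g \<omega> \<partial>M)"
      by (rule integral_norm_le[OF d0_integrable g le])
    then have "\<bar>\<integral>\<omega>. d0 \<omega> * exp (log_ratio \<epsilon> r u (P \<omega>) (Q \<omega>)) \<partial>M\<bar> \<le> 9/4 * exp (\<epsilon> / 2 * u) * D0"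
      by (simp add: D0_def)
    moreover have "\<bar>\<integral>\<omega>. d1 \<omega> * exp (log_ratio \<epsilon> r u (P \<omega>) (Q \<omega>)) \<partial>M\<bar> \<le> 9/4 * exp (\<epsilon> / 2 * u) * D1"
      using d1_part(2)[of u] u by (simp add: D1_def)
    ultimately have "\<bar>r u\<bar> \<le> 9/4 * exp (\<epsilon> / 2 * u) * D0 + 9/4 * exp (\<epsilon> / 2 * u) * D1"
      by (subst fixed_eq) (intro order_trans[OF abs_triangle_ineq] add_mono abs_eps2_le)
    then show ?thesis by (simp add: algebra_simps)
  qed
  then show ?thesis by blast
qed

text \<open>Set p = 0 in the factor paired with the denominator; it becomes exactly
  \<open>1 + r u\<close>. What remains is the marginal of \<open>d0\<close> in \<open>Q\<close>
  applied to G', which integrates to G(u). The error is proportional to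
  \<open>\<bar>P \<omega>\<bar>\<close>, and this makes the weight \<open>d0\<close> integrable even
  against \<open>exp (a * \<bar>Q \<omega>\<bar>)\<close>.\<close>

lemma d0_main_part:
  assumes "u \<ge> 0"
  shows "\<bar>\<epsilon>\<^sup>2 * (\<integral>\<omega>. d0 \<omega> * exp (log_ratio \<epsilon> r u (P \<omega>) (Q \<omega>)) \<partial>M) - \<epsilon> * (1 + r u) * logistic \<epsilon> r u\<bar>
    \<le> 6 * exp (- \<epsilon> / 2 * u) * (\<integral>\<omega>. d0 \<omega> * (\<bar>P \<omega>\<bar> * exp (a * \<bar>P \<omega>\<bar>) * exp (a * \<bar>Q \<omega>\<bar>)) \<partial>M)"
proof -
  have [measurable]: "log_profile \<epsilon> r \<in> borel_measurable borel"
    by (rule borel_measurable_continuous_onI[OF continuous_on_log_profile[OF eps(1) rs]])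
  have expA: "exp (log_ratio \<epsilon> r u p q) = exp (log_profile \<epsilon> r (u + q))
      * exp (log_profile \<epsilon> r (u + p) - log_logistic \<epsilon> r u)" for p q
    by (simp add: log_ratio_def exp_add[symmetric])
  have W0: "exp (log_profile \<epsilon> r u - log_logistic \<epsilon> r u) = 1 + r u"
    by (simp add: exp_diff exp_log_profile[OF eps(1) rs])
  have marg: "(\<integral>\<omega>. d0 \<omega> * (\<epsilon> * exp (log_profile \<epsilon> r (u + Q \<omega>))) \<partial>M) = logistic \<epsilon> r u"
    by (rule d0_marginal)
      (use eps in \<open>auto intro!: DERIV_logistic[OF eps(1) rs] logistic_at_bot[OF eps(1) rs]
          continuous_intros continuous_on_log_profile[OF eps(1) rs]\<close>)
  have iW: "integrable M (\<lambda>\<omega>. d0 \<omega> * exp (log_profile \<epsilon> r (u + Q \<omega>)))"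
  \<comment> \<open>The Bochner integral of a non-integrable function is 0, whereas
    \<open>marg\<close> gives the strictly positive value
    \<open>logistic \<epsilon> r u\<close>.\<close>
  proof (rule ccontr)
    assume "\<not> ?thesis"
    then have "\<not> integrable M (\<lambda>\<omega>. d0 \<omega> * (\<epsilon> * exp (log_profile \<epsilon> r (u + Q \<omega>))))"
      using eps by (simp add: mult.left_commute[of _ \<epsilon>])
    then show False using marg logistic_bounds(1)[of \<epsilon> r u] by (simp add: not_integrable_integral_eq)
  qed
  let ?f = "\<lambda>\<omega>. d0 \<omega> * exp (log_ratio \<epsilon> r u (P \<omega>) (Q \<omega>))
      - (1 + r u) * (d0 \<omega> * exp (log_profile \<epsilon> r (u + Q \<omega>)))"
  let ?g = "\<lambda>\<omega>. 6 * exp (- \<epsilon> / 2 * u) * (d0 \<omega> * (\<bar>P \<omega>\<bar> * exp (a * \<bar>P \<omega>\<bar>) * exp (a * \<bar>Q \<omega>\<bar>)))"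
  have f: "integrable M ?f" by (intro Bochner_Integration.integrable_diff integrable_mult_right
      d0_integrable iW)
  have g: "integrable M ?g" by (intro integrable_mult_right d0_moment)
  have le: "norm (?f \<omega>) \<le> ?g \<omega>" for \<omega>
  proof -
    let ?p = "P \<omega>" and ?q = "Q \<omega>"
    have "exp (log_profile \<epsilon> r (u + ?p) - log_logistic \<epsilon> r u)
        = (1 + r (u + ?p)) * exp (log_logistic \<epsilon> r (u + ?p) - log_logistic \<epsilon> r u)"
      by (simp add: exp_diff exp_log_profile[OF eps(1) rs])
    also have "\<dots> \<le> 3/2 * exp (a * \<bar>?p\<bar>)"
    proof (rule mult_mono)
      have "log_logistic \<epsilon> r (u + ?p) - log_logistic \<epsilon> r u \<le> 3/2 * \<epsilon> * \<bar>?p\<bar>"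
        using abs_le_D1[OF log_logistic_lipschitz[OF eps(1) rs, of "u + ?p" u]] by simp
      then show "exp (log_logistic \<epsilon> r (u + ?p) - log_logistic \<epsilon> r u) \<le> exp (a * \<bar>?p\<bar>)"
        by (intro order_trans[OF _ exp_P_le]) simp
    qed (use one_plus_bounds[OF eps(1) rs, of "u + ?p"] in auto)
    finally have 1: "exp (log_profile \<epsilon> r (u + ?p) - log_logistic \<epsilon> r u) \<le> 3/2 * exp (a * \<bar>?p\<bar>)" .
    have "a \<ge> 0" using eps by linarith
    then have "1 \<le> exp (a * \<bar>?p\<bar>)" by simp
    then have 2: "exp (log_profile \<epsilon> r u - log_logistic \<epsilon> r u) \<le> 3/2 * exp (a * \<bar>?p\<bar>)"
      using one_plus_bounds(2)[OF eps(1) rs, of u] unfolding W0 by linarith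
    \<comment> \<open>Here the bound on the derivative of \<open>r\<close> enters: the profile,
      including its factor \<open>1 + r\<close>, varies only by a multiple of
      \<open>\<bar>p\<bar>\<close>.\<close>
    have "\<bar>log_profile \<epsilon> r (u + ?p) - log_profile \<epsilon> r u\<bar> \<le> (1 + 3/2 * \<epsilon>) * \<bar>(u + ?p) - u\<bar>"
      by (rule abs_diff_le_of_DERIV[OF DERIV_log_profile[OF eps(1) rs]
          abs_log_profile'_le[OF eps(1) rs]])
    also have "\<dots> \<le> 5/2 * \<bar>?p\<bar>" unfolding add_diff_cancel_left' using eps by (intro mult_right_mono) auto
    finally have "\<bar>(log_profile \<epsilon> r (u + ?p) - log_logistic \<epsilon> r u)
        - (log_profile \<epsilon> r u - log_logistic \<epsilon> r u)\<bar> \<le> 5/2 * \<bar>?p\<bar>" by simp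
    then have 3: "3/2 * exp (a * \<bar>?p\<bar>) * \<bar>(log_profile \<epsilon> r (u + ?p) - log_logistic \<epsilon> r u)
        - (log_profile \<epsilon> r u - log_logistic \<epsilon> r u)\<bar>
        \<le> 3/2 * exp (a * \<bar>?p\<bar>) * (5/2 * \<bar>?p\<bar>)"
      by (intro mult_left_mono) auto
    have 4: "\<bar>exp (log_profile \<epsilon> r (u + ?p) - log_logistic \<epsilon> r u)
        - exp (log_profile \<epsilon> r u - log_logistic \<epsilon> r u)\<bar> \<le> 4 * \<bar>?p\<bar> * exp (a * \<bar>?p\<bar>)"
    proof -
      have "3/2 * exp (a * \<bar>?p\<bar>) * (5/2 * \<bar>?p\<bar>) = 15/4 * (\<bar>?p\<bar> * exp (a * \<bar>?p\<bar>))"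
        "\<bar>?p\<bar> * exp (a * \<bar>?p\<bar>) \<ge> 0" by simp_all
      then show ?thesis using order_trans[OF abs_exp_diff_le[OF 1 2] 3] by linarith
    qed
    have 5: "exp (log_profile \<epsilon> r (u + ?q)) \<le> 3/2 * (exp (- \<epsilon> * \<bar>u\<bar> / 2) * exp (a * \<bar>?q\<bar>))"
      using exp_log_profile_le[OF eps(1) rs, of "u + ?q"] shifted_weight_le[of u ?q] by linarith
    have "norm (?f \<omega>) = d0 \<omega> * (exp (log_profile \<epsilon> r (u + ?q)) *
        \<bar>exp (log_profile \<epsilon> r (u + ?p) - log_logistic \<epsilon> r u)
            - exp (log_profile \<epsilon> r u - log_logistic \<epsilon> r u)\<bar>)"
    proof -
      have "?f \<omega> = d0 \<omega> * (exp (log_profile \<epsilon> r (u + ?q)) *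
          (exp (log_profile \<epsilon> r (u + ?p) - log_logistic \<epsilon> r u)
              - exp (log_profile \<epsilon> r u - log_logistic \<epsilon> r u)))"
        unfolding expA W0 by (simp add: algebra_simps)
      then show ?thesis using d0_nonneg[of \<omega>] by (simp add: abs_mult)
    qed
    also have "\<dots> \<le> d0 \<omega> * ((3/2 * (exp (- \<epsilon> * \<bar>u\<bar> / 2) * exp (a * \<bar>?q\<bar>))) * (4 * \<bar>?p\<bar> * exp (a * \<bar>?p\<bar>)))"
      by (intro mult_left_mono mult_mono 4 5 d0_nonneg) auto
    also have "\<dots> = ?g \<omega>" using assms by (simp add: mult_ac)
    finally show ?thesis .
  qed
  have "norm (\<integral>\<omega>. ?f \<omega> \<partial>M) \<le> (\<integral>\<omega>. ?g \<omega> \<partial>M)"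
    by (rule integral_norm_le[OF f g le])
  then have "\<bar>\<epsilon>\<^sup>2 * (\<integral>\<omega>. ?f \<omega> \<partial>M)\<bar> \<le> (\<integral>\<omega>. ?g \<omega> \<partial>M)"
    by (intro abs_eps2_le) simp
  moreover have "\<epsilon>\<^sup>2 * (\<integral>\<omega>. ?f \<omega> \<partial>M) =
      \<epsilon>\<^sup>2 * (\<integral>\<omega>. d0 \<omega> * exp (log_ratio \<epsilon> r u (P \<omega>) (Q \<omega>)) \<partial>M) - \<epsilon> * (1 + r u) * logistic \<epsilon> r u"
  proof -
    have "\<epsilon> * (\<integral>\<omega>. d0 \<omega> * exp (log_profile \<epsilon> r (u + Q \<omega>)) \<partial>M) = logistic \<epsilon> r u"
      using marg by (simp add: mult.left_commute[of _ \<epsilon>])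
    moreover have "(\<integral>\<omega>. ?f \<omega> \<partial>M) = (\<integral>\<omega>. d0 \<omega> * exp (log_ratio \<epsilon> r u (P \<omega>) (Q \<omega>)) \<partial>M)
        - (1 + r u) * (\<integral>\<omega>. d0 \<omega> * exp (log_profile \<epsilon> r (u + Q \<omega>)) \<partial>M)"
      by (subst Bochner_Integration.integral_diff[OF d0_integrable integrable_mult_right[OF iW]]) simp
    ultimately show ?thesis by (simp add: right_diff_distrib power2_eq_square mult_ac)
  qed
  ultimately show ?thesis by simp
qed

lemma decay_right: "\<exists>B. \<forall>u\<ge>0. \<bar>r u - \<epsilon> / (1 - \<epsilon>)\<bar> \<le> B * exp (- (\<epsilon> / 2) * u)"
proof -
  define D0 where "D0 = (\<integral>\<omega>. d0 \<omega> * (\<bar>P \<omega>\<bar> * exp (a * \<bar>P \<omega>\<bar>) * exp (a * \<bar>Q \<omega>\<bar>)) \<partial>M)"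
  define D1 where "D1 = (\<integral>\<omega>. \<bar>d1 \<omega>\<bar> * (exp (a * \<bar>P \<omega>\<bar>) * exp (a * \<bar>Q \<omega>\<bar>)) \<partial>M)"
  have "\<bar>r u - \<epsilon> / (1 - \<epsilon>)\<bar> \<le> ((6 * D0 + 9/4 * D1 + 3/2) / (1 - \<epsilon>)) * exp (- (\<epsilon> / 2) * u)"
      if u: "u \<ge> 0" for u
  proof -
    let ?e = "exp (- (\<epsilon> / 2) * u)"
    define X where "X = \<epsilon>\<^sup>2 * (\<integral>\<omega>. d0 \<omega> * exp (log_ratio \<epsilon> r u (P \<omega>) (Q \<omega>)) \<partial>M)"
    define Y where "Y = \<epsilon>\<^sup>2 * (\<integral>\<omega>. d1 \<omega> * exp (log_ratio \<epsilon> r u (P \<omega>) (Q \<omega>)) \<partial>M)"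
    have r: "r u = X + Y" unfolding X_def Y_def by (rule fixed_eq)
    have X: "\<bar>X - \<epsilon> * (1 + r u) * logistic \<epsilon> r u\<bar> \<le> 6 * ?e * D0"
      using d0_main_part[OF u] by (simp add: X_def D0_def)
    have Y: "\<bar>Y\<bar> \<le> 9/4 * ?e * D1"
      unfolding Y_def using d1_part(2)[of u] u by (intro abs_eps2_le) (simp add: D1_def)
    have "1 - logistic \<epsilon> r u \<le> ?e"
      using one_minus_logistic_le[of \<epsilon> r u] phase_bounds(1)[OF eps(1) rs u]
      by (smt (verit) exp_le_cancel_iff mult_minus_left times_divide_eq_left)
    then have Z: "\<bar>\<epsilon> * (1 + r u) * (1 - logistic \<epsilon> r u)\<bar> \<le> (1 * (3/2)) * ?e"
      unfolding abs_mult using eps one_plus_bounds[OF eps(1) rs, of u] logistic_bounds(2)[of \<epsilon> r u]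
      by (intro mult_mono) auto
    \<comment> \<open>The limit solves r = \<epsilon> (1 + r). Since the left-hand side is
      \<open>r u - \<epsilon> * (1 + r u)\<close>, it splits into the three errors estimated above:
      the localisation of \<open>d0\<close>, the part from \<open>d1\<close>, and the distance of G
      from 1.\<close>
    have "(r u - \<epsilon> / (1 - \<epsilon>)) * (1 - \<epsilon>) = (X - \<epsilon> * (1 + r u) * logistic \<epsilon> r u) + Y
        - \<epsilon> * (1 + r u) * (1 - logistic \<epsilon> r u)"
      using eps r by (simp add: field_simps)
    then have "\<bar>(r u - \<epsilon> / (1 - \<epsilon>)) * (1 - \<epsilon>)\<bar> \<le> 6 * ?e * D0 + 9/4 * ?e * D1 + (1 * (3/2)) * ?e"
      using X Y Z by linarith
    then have "\<bar>r u - \<epsilon> / (1 - \<epsilon>)\<bar> * (1 - \<epsilon>) \<le> (6 * D0 + 9/4 * D1 + 3/2) * ?e"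
      unfolding abs_mult distrib_right using eps by (simp add: mult_ac)
    moreover have "x \<le> n / y * e" if "x * y \<le> n * e" "y > 0" for x y n e :: real
      using that by (simp add: field_simps)
    ultimately show ?thesis using eps by (metis diff_gt_0_iff_gt)
  qed
  then show ?thesis by blast
qed

theorem profile_asymptotics:
  "\<exists>m>0. \<forall>u\<le>0. exp (\<epsilon> * u) / m \<le> exp (log_profile \<epsilon> r u) \<and> exp (log_profile \<epsilon> r u) \<le> m * exp (\<epsilon> * u)"
  "\<exists>m>0. \<forall>u\<ge>0. exp (- (\<epsilon> / (1 - \<epsilon>) * u)) / m \<le> exp (log_profile \<epsilon> r u)
    \<and> exp (log_profile \<epsilon> r u) \<le> m * exp (- (\<epsilon> / (1 - \<epsilon>) * u))"
proof -
  obtain B where B: "\<And>u. u \<le> 0 \<Longrightarrow> \<bar>r u\<bar> \<le> B * exp (\<epsilon> / 2 * u)" using decay_left by blast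
  show "\<exists>m>0. \<forall>u\<le>0. exp (\<epsilon> * u) / m \<le> exp (log_profile \<epsilon> r u) \<and> exp (log_profile \<epsilon> r u)
      \<le> m * exp (\<epsilon> * u)"
    by (rule exp_log_profile_left[OF eps(1) rs B]) (use eps in auto)
  obtain B' where B': "\<And>u. u \<ge> 0 \<Longrightarrow> \<bar>r u - \<epsilon> / (1 - \<epsilon>)\<bar> \<le> B' * exp (- (\<epsilon> / 2) * u)"
    using decay_right by blast
  \<comment> \<open>The slope \<open>\<epsilon> * (1 + \<rho>)\<close> at infinity coincides with
    the limit \<rho> = \<epsilon>/(1 - \<epsilon>) of \<open>r\<close> itself.\<close>
  have "\<epsilon> * (1 + \<epsilon> / (1 - \<epsilon>)) = \<epsilon> / (1 - \<epsilon>)" using eps by (simp add: field_simps)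
  with exp_log_profile_right[OF eps(1) rs B']
  show "\<exists>m>0. \<forall>u\<ge>0. exp (- (\<epsilon> / (1 - \<epsilon>) * u)) / m \<le> exp (log_profile \<epsilon> r u)
    \<and> exp (log_profile \<epsilon> r u) \<le> m * exp (- (\<epsilon> / (1 - \<epsilon>) * u))"
    using eps by simp
qed

end

end

section \<open>Integrals over the triangle and the strip\<close>

lemma nn_integral_FTC_einterval:
  fixes F f :: "real \<Rightarrow> real" and a b :: ereal
  assumes ab: "a < b"
    and F: "\<And>x. x \<in> einterval a b \<Longrightarrow> (F has_real_derivative f x) (at x)"
    and f: "continuous_on (einterval a b) f" "\<And>x. x \<in> einterval a b \<Longrightarrow> 0 \<le> f x"
    and lim: "((F \<circ> real_of_ereal) \<longlongrightarrow> l) (at_right a)"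
    and lim': "((F \<circ> real_of_ereal) \<longlongrightarrow> l') (at_left b)"
  shows "(\<integral>\<^sup>+x\<in>einterval a b. ennreal (f x) \<partial>lborel) = ennreal (l' - l)"
proof -
  have c: "isCont f x" if "a < ereal x" "ereal x < b" for x
    using f(1) that by (auto simp: continuous_on_eq_continuous_at einterval_iff)
  have nn: "AE x in lborel. a < ereal x \<longrightarrow> ereal x < b \<longrightarrow> 0 \<le> f x"
    using f(2) by (auto simp: einterval_iff)
  have F': "\<And>x. a < ereal x \<Longrightarrow> ereal x < b \<Longrightarrow> DERIV F x :> f x"
    using F by (auto simp: einterval_iff)
  have i: "set_integrable lborel (einterval a b) f" and v: "(LBINT x=a..b. f x) = l' - l"
    using interval_integral_FTC_nonneg[OF ab F' c nn lim lim'] by auto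
  have "(\<integral>\<^sup>+x\<in>einterval a b. ennreal (f x) \<partial>lborel)
      = (\<integral>\<^sup>+x. ennreal (indicator (einterval a b) x *\<^sub>R f x) \<partial>lborel)"
    by (intro nn_integral_cong) (auto simp: indicator_def)
  also have "\<dots> = ennreal (\<integral>x. indicator (einterval a b) x *\<^sub>R f x \<partial>lborel)"
    using i f(2) unfolding set_integrable_def
    by (intro nn_integral_eq_integral) (auto simp: indicator_def)
  also have "\<dots> = ennreal (l' - l)"
    using v ab by (simp add: interval_lebesgue_integral_def set_lebesgue_integral_def less_imp_le)
  finally show ?thesis .
qed

lemma nn_integral_FTC_greaterThanLessThan:
  fixes F f :: "real \<Rightarrow> real" and a b :: real
  assumes "a < b"
    and "\<And>x. a < x \<Longrightarrow> x < b \<Longrightarrow> (F has_real_derivative f x) (at x)"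
    and "continuous_on {a<..<b} f" "\<And>x. a < x \<Longrightarrow> x < b \<Longrightarrow> 0 \<le> f x"
    and "(F \<longlongrightarrow> l) (at_right a)" "(F \<longlongrightarrow> l') (at_left b)"
  shows "(\<integral>\<^sup>+x\<in>{a<..<b}. ennreal (f x) \<partial>lborel) = ennreal (l' - l)"
  using nn_integral_FTC_einterval[of "ereal a" "ereal b" F f l l'] assms
  by (simp add: ereal_tendsto_simps)

lemma nn_integral_FTC_greaterThan:
  fixes F f :: "real \<Rightarrow> real" and a :: real
  assumes "\<And>x. a < x \<Longrightarrow> (F has_real_derivative f x) (at x)"
    and "continuous_on {a<..} f" "\<And>x. a < x \<Longrightarrow> 0 \<le> f x"
    and "(F \<longlongrightarrow> l) (at_right a)" "(F \<longlongrightarrow> l') at_top"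
  shows "(\<integral>\<^sup>+x\<in>{a<..}. ennreal (f x) \<partial>lborel) = ennreal (l' - l)"
proof -
  have e: "einterval (ereal a) \<infinity> = {a<..}" by (auto simp: einterval_iff)
  show ?thesis
    using nn_integral_FTC_einterval[of "ereal a" \<infinity> F f l l'] assms
    by (simp add: ereal_tendsto_simps e)
qed

lemma nn_integral_powr_Ioo:
  assumes "c > (0::real)"
  shows "(\<integral>\<^sup>+s\<in>{0<..<1}. ennreal (s powr (c - 1)) \<partial>lborel) = ennreal (1 / c)"
proof -
  have "(\<integral>\<^sup>+s\<in>{0<..<1}. ennreal (s powr (c - 1)) \<partial>lborel) = ennreal (1 powr c / c - 0 powr c / c)"
  proof (rule nn_integral_FTC_greaterThanLessThan[where F = "\<lambda>s. s powr c / c"])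
    show "((\<lambda>s. s powr c / c) has_real_derivative x powr (c - 1)) (at x)" if "0 < x" for x
      using that assms by (auto intro!: derivative_eq_intros simp: powr_diff field_simps)
    show "((\<lambda>s. s powr c / c) \<longlongrightarrow> 0 powr c / c) (at_right 0)"
      using assms
      by (intro tendsto_divide tendsto_const tendsto_powr' tendsto_ident_at)
          (auto simp: eventually_at_filter)
    show "((\<lambda>s. s powr c / c) \<longlongrightarrow> 1 powr c / c) (at_left 1)"
      using assms by (intro tendsto_intros) auto
  qed (auto intro!: continuous_intros)
  then show ?thesis using assms by simp
qed

lemma nn_integral_powr_atLeast:
  assumes "c > (0::real)"
  shows "(\<integral>\<^sup>+t\<in>{1..}. ennreal (t powr (- c - 1)) \<partial>lborel) = ennreal (1 / c)"
proof -
  have "(\<integral>\<^sup>+t\<in>{1..}. ennreal (t powr (- c - 1)) \<partial>lborel) = ennreal (0 - (- (1 powr - c) / c))"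
  proof (rule nn_integral_FTC_atLeast[where F = "\<lambda>t. - (t powr - c) / c"])
    show "((\<lambda>t. - (t powr - c) / c) has_real_derivative x powr (- c - 1)) (at x)" if "1 \<le> x" for x
      using that assms by (auto intro!: derivative_eq_intros simp: powr_diff field_simps)
    have "((\<lambda>t::real. t powr - c) \<longlongrightarrow> 0) at_top"
      using assms by (intro tendsto_neg_powr filterlim_ident) simp
    then show "((\<lambda>t. - (t powr - c) / c) \<longlongrightarrow> 0) at_top"
      using tendsto_divide[OF tendsto_minus tendsto_const[of c], of "\<lambda>t. t powr - c" 0 at_top] assms
          by simp
  qed auto
  then show ?thesis using assms by simp
qed

lemma sech_square_ge: "exp (- 2 * \<bar>x\<bar>) \<le> 1 - tanh (x::real) ^ 2"
proof -
  have "cosh x \<le> exp \<bar>x\<bar>"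
    unfolding cosh_field_def by (cases "x \<ge> 0") auto
  then have "cosh x ^ 2 \<le> exp \<bar>x\<bar> ^ 2" by (intro power_mono) auto
  then have "inverse (exp \<bar>x\<bar> ^ 2) \<le> inverse (cosh x ^ 2)"
    by (intro le_imp_inverse_le) auto
  moreover have "1 - tanh x ^ 2 = inverse (cosh x ^ 2)"
    by (simp add: tanh_def power_divide sinh_square_eq divide_simps)
  ultimately show ?thesis by (simp add: exp_minus exp_double)
qed

text \<open>The weight lies below the square of sech at half the argument, whose integral against
  dt/t has the primitive \<open>2 / c * tanh (c / 2 * (u + ln t))\<close>. Its total variation is at
  most \<open>4 / c\<close> whatever \<open>u\<close> is; this is where the
  \<open>1 / \<epsilon>\<close> of the weights comes from.\<close>

lemma nn_integral_log_weight_le: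
  assumes c: "c > (0::real)"
  shows "(\<integral>\<^sup>+t\<in>{0<..<1}. ennreal (exp (- c * \<bar>u + ln t\<bar>) / t) \<partial>lborel) \<le> ennreal (4 / c)"
proof -
  define F where "F = (\<lambda>t. 2 / c * tanh (c / 2 * (u + ln t)))"
  define f where "f = (\<lambda>t. (1 - tanh (c / 2 * (u + ln t)) ^ 2) / t)"
  have d: "(F has_real_derivative f x) (at x)" if "0 < x" for x
  proof -
    have "((\<lambda>t. tanh (c / 2 * (u + ln t))) has_real_derivative
        (1 - tanh (c / 2 * (u + ln x)) ^ 2) * (c / 2 * (1 / x))) (at x)"
      by (rule has_field_derivative_tanh) (use that in \<open>auto intro!: derivative_eq_intros\<close>)
    moreover have "2 / c * ((1 - tanh (c / 2 * (u + ln x)) ^ 2) * (c / 2 * (1 / x))) = f x"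
    proof -
      have "2 / c * (T * (c / 2 * (1 / x))) = T / x" for T
        using c by (simp add: field_simps)
      then show ?thesis by (simp only: f_def)
    qed
    ultimately show ?thesis unfolding F_def using DERIV_cmult[of _ _ x UNIV "2 / c"] by metis
  qed
  have le: "exp (- c * \<bar>u + ln t\<bar>) / t \<le> f t" if "0 < t" for t
    using sech_square_ge[of "c / 2 * (u + ln t)"] that c
    unfolding f_def by (intro divide_right_mono) (auto simp: abs_mult)
  have "(\<integral>\<^sup>+t\<in>{0<..<1}. ennreal (exp (- c * \<bar>u + ln t\<bar>) / t) \<partial>lborel)
      \<le> (\<integral>\<^sup>+t\<in>{0<..<1}. ennreal (f t) \<partial>lborel)"
    using le by (intro nn_integral_mono) (simp add: ennreal_leI split: split_indicator)
  also have "\<dots> = ennreal (F 1 - (- 2 / c))"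
  proof (rule nn_integral_FTC_greaterThanLessThan[where F = F])
    show "0 \<le> f x" if "0 < x" for x
      by (rule order_trans[OF _ le[OF that]]) (use that in simp)
    have "filterlim (\<lambda>t. c / 2 * (u + ln t)) at_bot (at_right 0)"
    proof (rule filterlim_tendsto_pos_mult_at_bot[OF tendsto_const])
      show "filterlim (\<lambda>t. u + ln t) at_bot (at_right 0)"
        using filterlim_tendsto_add_at_bot_iff[OF tendsto_const] ln_at_0 by blast
    qed (use c in simp)
    then have "((\<lambda>t. 2 / c * tanh (c / 2 * (u + ln t))) \<longlongrightarrow> 2 / c * (-1)) (at_right 0)"
      by (intro tendsto_mult tendsto_const filterlim_compose[OF tanh_real_at_bot])
    then show "(F \<longlongrightarrow> - 2 / c) (at_right 0)" by (simp add: F_def)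
    show "(F \<longlongrightarrow> F 1) (at_left 1)"
      by (rule tendsto_mono[OF at_le[OF subset_UNIV]])
          (use DERIV_isCont[OF d, of 1] in \<open>simp add: isCont_def\<close>)
    show "continuous_on {0<..<1} f"
      unfolding f_def by (intro continuous_intros) auto
  qed (use d in auto)
  also have "\<dots> \<le> ennreal (4 / c)"
  proof (rule ennreal_leI)
    have "F 1 \<le> 2 / c * 1"
      unfolding F_def using c less_imp_le[OF tanh_real_lt_1] by (intro mult_left_mono) auto
    then show "F 1 - - 2 / c \<le> 4 / c" by simp
  qed
  finally show ?thesis .
qed

section \<open>The two regions in the scaled variables\<close>

text \<open>In the coordinates (s, t) = (y/x, z/x) this is the part z < x of the domain of the
  equation; \<open>strip\<close> is the part z \<ge> x.\<close>

definition triangle :: "(real \<times> real) set" where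
  "triangle = {p. 0 < snd p \<and> snd p < 1 \<and> 1 - snd p < fst p \<and> fst p < 1}"

definition strip :: "(real \<times> real) set" where
  "strip = {p. 0 < fst p \<and> fst p < 1 \<and> 1 \<le> snd p}"

lemma triangle_sets [measurable]: "triangle \<in> sets (lborel \<Otimes>\<^sub>M lborel)"
proof -
  have "{p \<in> space (lborel \<Otimes>\<^sub>M lborel). 0 < snd p \<and> snd p < 1 \<and> 1 - snd p < fst p \<and> fst p < (1::real)}
      \<in> sets (lborel \<Otimes>\<^sub>M lborel)"
    by measurable
  then show ?thesis by (simp add: triangle_def space_pair_measure)
qed

lemma strip_sets [measurable]: "strip \<in> sets (lborel \<Otimes>\<^sub>M lborel)"
proof -
  have "{p \<in> space (lborel \<Otimes>\<^sub>M lborel). (0::real) < fst p \<and> fst p < 1 \<and> (1::real) \<le> snd p}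
      \<in> sets (lborel \<Otimes>\<^sub>M lborel)"
    by measurable
  then show ?thesis by (simp add: strip_def space_pair_measure)
qed

text \<open>The section at height \<open>t\<close> is the interval from \<open>1 - t\<close> to 1.
  Its length \<open>t\<close> weakens the singularity 1/t^2 to the logarithmic 1/t.\<close>

lemma nn_integral_triangle_snd:
  fixes f :: "real \<Rightarrow> ennreal"
  assumes [measurable]: "f \<in> borel_measurable borel"
  shows "(\<integral>\<^sup>+p\<in>triangle. f (snd p) \<partial>(lborel \<Otimes>\<^sub>M lborel)) = (\<integral>\<^sup>+t\<in>{0<..<1}. ennreal t * f t \<partial>lborel)"
proof -
  have "(\<integral>\<^sup>+p\<in>triangle. f (snd p) \<partial>(lborel \<Otimes>\<^sub>M lborel))
      = (\<integral>\<^sup>+t. \<integral>\<^sup>+s. f t * indicator triangle (s, t) \<partial>lborel \<partial>lborel)"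
    by (subst lborel_pair.nn_integral_snd[symmetric]) simp_all
  also have "\<dots> = (\<integral>\<^sup>+t. \<integral>\<^sup>+s. (f t * indicator {0<..<1} t) * indicator {1 - t<..<1} s \<partial>lborel \<partial>lborel)"
    by (intro nn_integral_cong) (auto simp: triangle_def indicator_def)
  also have "\<dots> = (\<integral>\<^sup>+t\<in>{0<..<1}. ennreal t * f t \<partial>lborel)"
    by (intro nn_integral_cong) (subst nn_integral_cmult_indicator, simp, simp add: mult_ac split:
        split_indicator)
  finally show ?thesis .
qed

lemma nn_integral_triangle_fst:
  fixes f :: "real \<Rightarrow> ennreal"
  assumes [measurable]: "f \<in> borel_measurable borel"
  shows "(\<integral>\<^sup>+p\<in>triangle. f (fst p) \<partial>(lborel \<Otimes>\<^sub>M lborel)) = (\<integral>\<^sup>+s\<in>{0<..<1}. ennreal s * f s \<partial>lborel)"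
proof -
  have "(\<integral>\<^sup>+p\<in>triangle. f (fst p) \<partial>(lborel \<Otimes>\<^sub>M lborel))
      = (\<integral>\<^sup>+s. \<integral>\<^sup>+t. f s * indicator triangle (s, t) \<partial>lborel \<partial>lborel)"
    by (subst lborel.nn_integral_fst[symmetric]) simp_all
  also have "\<dots> = (\<integral>\<^sup>+s. \<integral>\<^sup>+t. (f s * indicator {0<..<1} s) * indicator {1 - s<..<1} t \<partial>lborel \<partial>lborel)"
    by (intro nn_integral_cong) (auto simp: triangle_def indicator_def)
  also have "\<dots> = (\<integral>\<^sup>+s\<in>{0<..<1}. ennreal s * f s \<partial>lborel)"
    by (intro nn_integral_cong) (subst nn_integral_cmult_indicator, simp, simp add: mult_ac split:
        split_indicator)
  finally show ?thesis .
qed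

lemma nn_integral_strip:
  fixes f h :: "real \<Rightarrow> ennreal"
  assumes [measurable]: "f \<in> borel_measurable borel" "h \<in> borel_measurable borel"
  shows "(\<integral>\<^sup>+p\<in>strip. f (fst p) * h (snd p) \<partial>(lborel \<Otimes>\<^sub>M lborel))
     = (\<integral>\<^sup>+s\<in>{0<..<1}. f s \<partial>lborel) * (\<integral>\<^sup>+t\<in>{1..}. h t \<partial>lborel)"
proof -
  have "(\<integral>\<^sup>+p\<in>strip. f (fst p) * h (snd p) \<partial>(lborel \<Otimes>\<^sub>M lborel))
      = (\<integral>\<^sup>+s. \<integral>\<^sup>+t. f s * h t * indicator strip (s, t) \<partial>lborel \<partial>lborel)"
    by (subst lborel.nn_integral_fst[symmetric]) simp_all
  also have "\<dots> = (\<integral>\<^sup>+s. \<integral>\<^sup>+t. (f s * indicator {0<..<1} s) * (h t * indicator {1..} t) \<partial>lborel \<partial>lborel)"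
    by (intro nn_integral_cong) (auto simp: strip_def indicator_def)
  also have "\<dots> = (\<integral>\<^sup>+s\<in>{0<..<1}. f s \<partial>lborel) * (\<integral>\<^sup>+t\<in>{1..}. h t \<partial>lborel)"
    by (subst nn_integral_cmult, measurable) (rule nn_integral_multc, measurable)
  finally show ?thesis .
qed

lemma nn_integral_triangle_powr_fst:
  assumes "a < (1::real)"
  shows "(\<integral>\<^sup>+p\<in>triangle. ennreal (fst p powr (- 1 - a)) \<partial>(lborel \<Otimes>\<^sub>M lborel)) = ennreal (1 / (1 - a))"
proof -
  have "ennreal s * ennreal (s powr (- 1 - a)) = ennreal (s powr ((1 - a) - 1))" if "0 < s" for s
    using that by (simp add: ennreal_mult[symmetric] powr_diff powr_minus field_simps)
  note * = this
  have "(\<integral>\<^sup>+p\<in>triangle. ennreal (fst p powr (- 1 - a)) \<partial>(lborel \<Otimes>\<^sub>M lborel))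
      = (\<integral>\<^sup>+s\<in>{0<..<1}. ennreal s * ennreal (s powr (- 1 - a)) \<partial>lborel)"
    by (rule nn_integral_triangle_fst) measurable
  also have "\<dots> = (\<integral>\<^sup>+s\<in>{0<..<1}. ennreal (s powr ((1 - a) - 1)) \<partial>lborel)"
    using * by (intro nn_integral_cong) (auto simp: indicator_def)
  finally show ?thesis using assms by (simp only: nn_integral_powr_Ioo diff_gt_0_iff_gt)
qed

lemma nn_integral_triangle_powr_snd:
  assumes "c > (0::real)"
  shows "(\<integral>\<^sup>+p\<in>triangle. ennreal (snd p powr (c - 2)) \<partial>(lborel \<Otimes>\<^sub>M lborel)) = ennreal (1 / c)"
proof -
  have *: "ennreal s * ennreal (s powr (c - 2)) = ennreal (s powr (c - 1))" if "0 < s" for s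
    using that by (simp add: ennreal_mult[symmetric] powr_diff powr_minus power2_eq_square field_simps)
  have "(\<integral>\<^sup>+p\<in>triangle. ennreal (snd p powr (c - 2)) \<partial>(lborel \<Otimes>\<^sub>M lborel))
      = (\<integral>\<^sup>+s\<in>{0<..<1}. ennreal s * ennreal (s powr (c - 2)) \<partial>lborel)"
    by (rule nn_integral_triangle_snd) measurable
  also have "\<dots> = (\<integral>\<^sup>+s\<in>{0<..<1}. ennreal (s powr (c - 1)) \<partial>lborel)"
    using * by (intro nn_integral_cong) (auto simp: indicator_def)
  finally show ?thesis using assms by (simp only: nn_integral_powr_Ioo)
qed

section \<open>The weights of a kernel\<close>

abbreviation lborel2 :: "(real \<times> real) measure" where
  "lborel2 \<equiv> lborel \<Otimes>\<^sub>M lborel"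

lemma powr_minus_le_2:
  fixes x a :: real
  assumes "1/2 \<le> x" "0 \<le> a" "a \<le> 1"
  shows "x powr - a \<le> 2"
proof -
  have "x powr - a = (1 / x) powr a" using assms by (simp add: powr_minus_divide powr_divide)
  also have "\<dots> \<le> 2 powr a" using assms by (intro powr_mono2) (auto simp: field_simps)
  also have "\<dots> \<le> 2 powr 1" using assms by (intro powr_mono) auto
  finally show ?thesis by simp
qed

lemma exp_abs_ln_less_1: "0 < (s::real) \<Longrightarrow> s < 1 \<Longrightarrow> exp (a * \<bar>ln s\<bar>) = s powr - a"
  and exp_abs_ln_ge_1: "1 \<le> (t::real) \<Longrightarrow> exp (a * \<bar>ln t\<bar>) = t powr a"
  by (use ln_less_zero[of s] in \<open>simp add: powr_def abs_of_neg\<close>, use ln_ge_zero[of t] in \<open>simp add: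
      powr_def\<close>)

lemma ennreal_lincomb:
  "\<lbrakk>0 \<le> c; 0 \<le> x; 0 \<le> c'; 0 \<le> y\<rbrakk> \<Longrightarrow> ennreal (c * x + c' * y)
      = ennreal c * ennreal x + ennreal c' * ennreal y"
  by (simp add: ennreal_mult)

lemma nn_integral_lincomb:
  assumes [measurable]: "f \<in> borel_measurable M" "g \<in> borel_measurable M"
  shows "(\<integral>\<^sup>+p. c * f p + c' * g p \<partial>M) = c * (\<integral>\<^sup>+p. f p \<partial>M) + c' * (\<integral>\<^sup>+p. g p \<partial>M)"
proof -
  have "(\<integral>\<^sup>+p. c * f p + c' * g p \<partial>M) = (\<integral>\<^sup>+p. c * f p \<partial>M) + (\<integral>\<^sup>+p. c' * g p \<partial>M)"
    by (rule nn_integral_add) measurable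
  then show ?thesis by (simp only: nn_integral_cmult[OF assms(1)] nn_integral_cmult[OF assms(2)])
qed

text \<open>Normal form of an admissible kernel: the exponent is cut off at 1, which only enlarges
  the bound on the unit interval, and \<open>Km\<close> is a bound on the compact unit square, for
  the part of the triangle where the expansion at small ratios is not exploited.\<close>

locale near_additive_kernel =
  fixes K :: "real \<Rightarrow> real \<Rightarrow> real" and K0 \<beta> Km :: real
  assumes K_continuous: "continuous_on ({0..} \<times> {0..}) (\<lambda>(x, y). K x y)"
    and K_sym: "\<And>x y. \<lbrakk>0 \<le> x; 0 \<le> y\<rbrakk> \<Longrightarrow> K x y = K y x"
    and K_nonneg: "\<And>x y. \<lbrakk>0 \<le> x; 0 \<le> y\<rbrakk> \<Longrightarrow> 0 \<le> K x y"
    and K_homogeneous: "\<And>x y a. \<lbrakk>0 < x; 0 < y; 0 < a\<rbrakk> \<Longrightarrow> K (a * x) (a * y) = a * K x y"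
    and K_near_1: "\<And>x. \<lbrakk>0 \<le> x; x \<le> 1\<rbrakk> \<Longrightarrow> \<bar>K x 1 - 1\<bar> \<le> K0 * x powr \<beta>"
    and K_bound: "\<And>x y. \<lbrakk>0 \<le> x; x \<le> 1; 0 \<le> y; y \<le> 1\<rbrakk> \<Longrightarrow> K x y \<le> Km"
    and K0_pos: "0 < K0" and beta: "0 < \<beta>" "\<beta> \<le> 1"
begin

text \<open>The weights cost powers s^(-a) and t^(-a). Integrability of the remainder needs a <
  \<beta>, to leave a positive exponent \<beta> - a, and a < 1, for s^(-1-a) on the
  triangle.\<close>

definition a :: real where "a = \<beta> / 4"

text \<open>The full weight K(s,t)/(s t^2) on the triangle with K(s,t) replaced by s, its leading
  order for t much smaller than s.\<close>

definition d0 :: "real \<times> real \<Rightarrow> real" where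
  "d0 p = indicator triangle p / (snd p)\<^sup>2"

text \<open>
  With \<open>y = s x\<close> and \<open>z = t x\<close> the weight of the full equation is \<open>K(s,t)/(s t\<^sup>2)\<close> on
  \<open>0 < s < 1, t > 1 - s\<close>, which is the union of the strip and the triangle. The logistic term
  corresponds to \<open>1/(s t)\<close> on the strip, and \<open>d0 + d1\<close> is what remains.
\<close>

definition d1 :: "real \<times> real \<Rightarrow> real" where
  "d1 p = indicator strip p * ((K (fst p) (snd p) / snd p - 1) / (fst p * snd p))
        + indicator triangle p * ((K (fst p) (snd p) / fst p - 1) / (snd p)\<^sup>2)"

lemma a_bounds: "0 < a" "a \<le> 1/4" "0 < \<beta> - a" "a < \<beta>"
  using beta by (auto simp: a_def)

lemma Km_nonneg: "0 \<le> Km"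
  using K_bound[of 0 0] K_nonneg[of 0 0] by simp

lemma K_near_max:
  assumes "0 < s" "s \<le> t"
  shows "\<bar>K s t / t - 1\<bar> \<le> K0 * (s / t) powr \<beta>"
proof -
  have "K s t = t * K (s / t) 1" using K_homogeneous[of "s / t" 1 t] assms by simp
  then show ?thesis using K_near_1[of "s / t"] assms by simp
qed

lemma K_near_max':
  assumes "0 < t" "t \<le> s"
  shows "\<bar>K s t / s - 1\<bar> \<le> K0 * (t / s) powr \<beta>"
  using K_near_max[OF assms] K_sym[of s t] assms by simp

text \<open>Nothing is known about \<open>K\<close> outside the closed quadrant, so measurability is
  available only after cutting off there.\<close>

lemma K_measurable: "(\<lambda>p. indicator ({0..} \<times> {0..}) p *\<^sub>R K (fst p) (snd p)) \<in> borel_measurable lborel2"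
proof -
  have "(\<lambda>p. indicator ({0..} \<times> {0..}) p *\<^sub>R K (fst p) (snd p)) \<in> borel_measurable borel"
    using K_continuous by (intro borel_measurable_continuous_on_indicator)
        (auto simp: case_prod_beta' borel_closed closed_Times)
  moreover have "sets lborel2 = sets (borel :: (real \<times> real) measure)"
    by (simp only: borel_prod[symmetric] sets_pair_measure_cong[OF sets_lborel sets_lborel])
  ultimately show ?thesis using measurable_cong_sets[OF _ refl] by metis
qed

lemma d0_measurable [measurable]: "d0 \<in> borel_measurable lborel2"
  unfolding d0_def[abs_def] by measurable

lemma d1_measurable [measurable]: "d1 \<in> borel_measurable lborel2"
proof -
  note [measurable] = K_measurable
  let ?K = "\<lambda>p. indicator ({0..} \<times> {0..}) p *\<^sub>R K (fst p) (snd p)"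
  have "d1 = (\<lambda>p. indicator strip p * ((?K p / snd p - 1) / (fst p * snd p))
        + indicator triangle p * ((?K p / fst p - 1) / (snd p)\<^sup>2))"
    by (auto simp: fun_eq_iff d1_def strip_def triangle_def indicator_def)
  also have "\<dots> \<in> borel_measurable lborel2" by measurable
  finally show ?thesis .
qed

lemma d0_nonneg: "0 \<le> d0 p"
  by (simp add: d0_def)

section \<open>Pointwise bounds for the weights\<close>

context
  fixes s t :: real
  assumes st: "(s, t) \<in> triangle"
begin

lemma st_bounds: "0 < t" "t < 1" "0 < s" "s < 1" "1 - t < s"
  using st by (auto simp: triangle_def)

text \<open>On the triangle s + t > 1, so at most one of the two coordinates is small. All bounds
  below split at \<open>t = 1/2\<close>: on one side only powers of \<open>t\<close> are singular,
  on the other only powers of \<open>s\<close>.\<close>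

lemma powr_cases:
  "t \<le> 1/2 \<Longrightarrow> s powr - a \<le> 2" "t > 1/2 \<Longrightarrow> t powr - a \<le> 2"
  using powr_minus_le_2[of s a] powr_minus_le_2[of t a] st_bounds a_bounds by auto

lemma inverse_square_le: "t > 1/2 \<Longrightarrow> 1 / t\<^sup>2 \<le> 4"
proof -
  assume "t > 1/2"
  then have "(1/2)\<^sup>2 \<le> t\<^sup>2" by (intro power_mono) auto
  then show ?thesis using st_bounds by (simp add: field_simps power2_eq_square)
qed

lemma s_powr: "s powr (- 1 - a) = s powr - a / s" "s powr - a \<le> s powr (- 1 - a)"
proof -
  show "s powr (- 1 - a) = s powr - a / s"
    using st_bounds by (simp add: powr_diff powr_minus field_simps)
  show "s powr - a \<le> s powr (- 1 - a)"
    using st_bounds by (intro powr_mono') auto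
qed

lemma t_powr: "t powr (c - 2) = t powr c / t\<^sup>2"
  using st_bounds by (simp add: powr_diff)

text \<open>\<open>e\<close> stands for the decay factor in \<open>u + ln t\<close>. It is kept
  where \<open>t\<close> is small, since 1/t^2 alone is not integrable over the triangle, and
  dropped where \<open>t > 1/2\<close>.\<close>

lemma d0_weight_pointwise:
  assumes "0 \<le> e" "e \<le> 1"
  shows "1 / t\<^sup>2 * (s powr - a * e) \<le> 2 * (e / t\<^sup>2) + 4 * s powr (- 1 - a)"
proof (cases "t \<le> 1/2")
  case True
  have "s powr - a * (e / t\<^sup>2) \<le> 2 * (e / t\<^sup>2)"
    using powr_cases(1)[OF True] assms by (intro mult_right_mono) auto
  then show ?thesis by (simp add: add_increasing2)
next
  case False
  then have "1 / t\<^sup>2 * (s powr - a * e) \<le> 4 * (s powr (- 1 - a) * 1)"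
    using inverse_square_le s_powr(2) assms by (intro mult_mono) auto
  then show ?thesis using assms by (simp add: add_increasing)
qed

text \<open>For small \<open>t\<close> the factor \<open>\<bar>ln s\<bar>\<close> is at most (1 -
  s)/s \<le> 2t, because 1 - s < t and s \<ge> 1/2. The power of \<open>t\<close> gained removes the
  logarithmic divergence.\<close>

lemma d0_moment_pointwise:
  "1 / t\<^sup>2 * (\<bar>ln s\<bar> * s powr - a * t powr - a) \<le> 4 * t powr ((1 - a) - 2) + 8 * s powr (- 1 - a)"
proof (cases "t \<le> 1/2")
  case True
  have "\<bar>ln s\<bar> = ln (1 / s)" using st_bounds by (simp add: ln_div)
  also have "\<dots> \<le> 1 / s - 1" using st_bounds by (intro ln_le_minus_one) auto
  also have "\<dots> \<le> 2 * t"
  proof -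
    have "1 - s \<le> t * 1" using st_bounds by simp
    also have "\<dots> \<le> t * (2 * s)" using st_bounds True by (intro mult_left_mono) auto
    finally show ?thesis using st_bounds by (simp add: field_simps)
  qed
  finally have "\<bar>ln s\<bar> \<le> 2 * t" .
  then have "1 / t\<^sup>2 * (\<bar>ln s\<bar> * s powr - a * t powr - a) \<le> 1 / t\<^sup>2 * ((2 * t) * 2 * t powr - a)"
    using powr_cases(1)[OF True] st_bounds by (intro mult_left_mono mult_right_mono mult_mono) auto
  also have "\<dots> = 4 * t powr ((1 - a) - 2)"
    using st_bounds by (simp add: powr_diff powr_minus power2_eq_square field_simps)
  finally show ?thesis by (simp add: add_increasing2)
next
  case False
  have "\<bar>ln s\<bar> = ln (1 / s)" using st_bounds by (simp add: ln_div)
  also have "\<dots> \<le> 1 / s" using st_bounds ln_le_minus_one[of "1 / s"] by auto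
  finally have l: "\<bar>ln s\<bar> \<le> 1 / s" .
  have "1 / t\<^sup>2 * (\<bar>ln s\<bar> * s powr - a * t powr - a) \<le> 4 * (1 / s * s powr - a * 2)"
    by (intro mult_mono mult_nonneg_nonneg abs_ge_zero powr_ge_zero l)
      (use False inverse_square_le powr_cases(2) st_bounds in auto)
  also have "\<dots> = 8 * s powr (- 1 - a)" by (simp add: s_powr(1))
  finally show ?thesis by (simp add: add_increasing)
qed

text \<open>For small \<open>t\<close> the closeness of \<open>K s t\<close> to \<open>s\<close>
  gains t^\<beta>, more than the weights cost. For \<open>t > 1/2\<close> the crude bound
  \<open>Km\<close> suffices: it leaves 1/s, which the sections of length \<open>s\<close>
  compensate.\<close>

lemma d1_triangle_pointwise:
  "\<bar>(K s t / s - 1) / t\<^sup>2\<bar> * (s powr - a * t powr - a)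
    \<le> 4 * K0 * t powr ((\<beta> - a) - 2) + 8 * (Km + 1) * s powr (- 1 - a)"
proof (cases "t \<le> 1/2")
  case True
  have "\<bar>K s t / s - 1\<bar> \<le> K0 * (t / s) powr \<beta>"
    using True st_bounds by (intro K_near_max') auto
  also have "(t / s) powr \<beta> \<le> 2 * t powr \<beta>"
  proof -
    have "s powr - \<beta> \<le> 2" using powr_minus_le_2[of s \<beta>] st_bounds True beta by auto
    then have "t powr \<beta> * s powr - \<beta> \<le> t powr \<beta> * 2" by (intro mult_left_mono) auto
    moreover have "(t / s) powr \<beta> = t powr \<beta> * s powr - \<beta>"
      using st_bounds by (simp add: powr_divide powr_minus_divide)
    ultimately show ?thesis by simp
  qed
  finally have "\<bar>K s t / s - 1\<bar> \<le> K0 * (2 * t powr \<beta>)" using K0_pos by simp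
  then have "\<bar>(K s t / s - 1) / t\<^sup>2\<bar> * (s powr - a * t powr - a)
      \<le> (K0 * (2 * t powr \<beta>)) / t\<^sup>2 * (2 * t powr - a)"
    unfolding abs_divide using powr_cases(1)[OF True] st_bounds K0_pos
    by (intro mult_mono) (auto intro!: divide_right_mono)
  also have "\<dots> = 4 * K0 * t powr ((\<beta> - a) - 2)"
  proof -
    have "t powr (\<beta> - a) = t powr \<beta> * t powr - a" by (simp add: powr_add[symmetric])
    then show ?thesis unfolding t_powr by simp
  qed
  finally show ?thesis using Km_nonneg by (simp add: add_increasing2)
next
  case False
  have "0 \<le> K s t / s" using K_nonneg[of s t] st_bounds by simp
  moreover have "K s t / s \<le> Km / s" using K_bound[of s t] st_bounds by (intro divide_right_mono) auto
  moreover have "1 \<le> 1 / s" using st_bounds by simp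
  ultimately have k: "\<bar>K s t / s - 1\<bar> \<le> (Km + 1) / s" by (simp add: add_divide_distrib)
  have "\<bar>(K s t / s - 1) / t\<^sup>2\<bar> * (s powr - a * t powr - a)
      = (1 / t\<^sup>2 * \<bar>K s t / s - 1\<bar>) * (s powr - a * t powr - a)" by simp
  also have "\<dots> \<le> (4 * ((Km + 1) / s)) * (s powr - a * 2)"
    using k False inverse_square_le powr_cases(2) Km_nonneg st_bounds by (intro mult_mono) auto
  also have "\<dots> = 8 * (Km + 1) * s powr (- 1 - a)" by (simp add: s_powr(1))
  finally show ?thesis using K0_pos by (simp add: add_increasing)
qed

end

text \<open>The gain (s/t)^\<beta> helps at both ends, s near 0 and t near infinity, and the
  resulting bound is a product, so its integral factorises.\<close>

lemma d1_strip_pointwise: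
  assumes "(s, t) \<in> strip"
  shows "\<bar>(K s t / t - 1) / (s * t)\<bar> * (s powr - a * t powr a)
    \<le> K0 * (s powr ((\<beta> - a) - 1) * t powr (- (\<beta> - a) - 1))"
proof -
  have st: "0 < s" "s < 1" "1 \<le> t" using assms by (auto simp: strip_def)
  have "\<bar>(K s t / t - 1) / (s * t)\<bar> * (s powr - a * t powr a)
      = \<bar>K s t / t - 1\<bar> * (1 / (s * t) * (s powr - a * t powr a))"
    using st by (simp add: abs_mult)
  also have "\<dots> \<le> (K0 * (s / t) powr \<beta>) * (1 / (s * t) * (s powr - a * t powr a))"
    using K_near_max[of s t] st by (intro mult_right_mono) auto
  also have "\<dots> = K0 * (s powr ((\<beta> - a) - 1) * t powr (- (\<beta> - a) - 1))"
    using st by (simp add: powr_divide powr_diff powr_minus powr_add field_simps)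
  finally show ?thesis .
qed

section \<open>Integrated bounds for the weights\<close>

text \<open>Only the region of small \<open>t\<close> feels \<open>\<epsilon>\<close>: integrating
  out \<open>s\<close> leaves dt/t against a weight of rate \<open>\<epsilon> / 4\<close>, which
  contributes 2 * 16/\<epsilon>.\<close>

lemma nn_integral_d0_weight:
  assumes eps: "0 < \<epsilon>" "\<epsilon> \<le> 1"
  shows "(\<integral>\<^sup>+p. ennreal (d0 p * (exp (a * \<bar>ln (fst p)\<bar>) * exp (- \<epsilon> * \<bar>u + ln (snd p)\<bar> / 4))) \<partial>lborel2)
    \<le> ennreal (32 / \<epsilon> + 4 / (1 - a))"
proof -
  let ?e = "\<lambda>t. exp (- (\<epsilon> / 4) * \<bar>u + ln t\<bar>)"
  have "(\<integral>\<^sup>+p. ennreal (d0 p * (exp (a * \<bar>ln (fst p)\<bar>) * exp (- \<epsilon> * \<bar>u + ln (snd p)\<bar> / 4))) \<partial>lborel2)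
      \<le> (\<integral>\<^sup>+p. ennreal 2 * (ennreal (?e (snd p) / (snd p)\<^sup>2) * indicator triangle p)
          + ennreal 4 * (ennreal (fst p powr (- 1 - a)) * indicator triangle p) \<partial>lborel2)"
  proof (rule nn_integral_mono)
    fix p :: "real \<times> real"
    obtain s t where p: "p = (s, t)" by (cases p)
    show "ennreal (d0 p * (exp (a * \<bar>ln (fst p)\<bar>) * exp (- \<epsilon> * \<bar>u + ln (snd p)\<bar> / 4)))
      \<le> ennreal 2 * (ennreal (?e (snd p) / (snd p)\<^sup>2) * indicator triangle p)
          + ennreal 4 * (ennreal (fst p powr (- 1 - a)) * indicator triangle p)"
    proof (cases "(s, t) \<in> triangle")
      case True
      have e: "0 \<le> ?e t" "?e t \<le> 1" using eps by simp_all
      have "d0 p * (exp (a * \<bar>ln (fst p)\<bar>) * exp (- \<epsilon> * \<bar>u + ln (snd p)\<bar> / 4))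
          = 1 / t\<^sup>2 * (s powr - a * ?e t)"
        unfolding p fst_conv snd_conv exp_abs_ln_less_1[OF st_bounds(3,4)[OF True]]
        using True by (simp add: d0_def)
      then have "ennreal (d0 p * (exp (a * \<bar>ln (fst p)\<bar>) * exp (- \<epsilon> * \<bar>u + ln (snd p)\<bar> / 4)))
          \<le> ennreal (2 * (?e t / t\<^sup>2) + 4 * s powr (- 1 - a))"
        using d0_weight_pointwise[OF True e] by (intro ennreal_leI) simp
      also have "\<dots> = ennreal 2 * ennreal (?e t / t\<^sup>2) + ennreal 4 * ennreal (s powr (- 1 - a))"
        by (rule ennreal_lincomb) auto
      finally show ?thesis using True by (simp only: p fst_conv snd_conv indicator_simps mult_1_right)
    qed (simp add: p d0_def)
  qed
  also have "\<dots> = ennreal 2 * (\<integral>\<^sup>+p\<in>triangle. ennreal (?e (snd p) / (snd p)\<^sup>2) \<partial>lborel2)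
      + ennreal 4 * (\<integral>\<^sup>+p\<in>triangle. ennreal (fst p powr (- 1 - a)) \<partial>lborel2)"
    by (rule nn_integral_lincomb) measurable
  also have "(\<integral>\<^sup>+p\<in>triangle. ennreal (?e (snd p) / (snd p)\<^sup>2) \<partial>lborel2)
      = (\<integral>\<^sup>+t\<in>{0<..<1}. ennreal t * ennreal (?e t / t\<^sup>2) \<partial>lborel)"
    by (rule nn_integral_triangle_snd) measurable
  also have "\<dots> = (\<integral>\<^sup>+t\<in>{0<..<1}. ennreal (?e t / t) \<partial>lborel)"
    by (intro nn_integral_cong)
      (auto simp: ennreal_mult[symmetric] power2_eq_square split: split_indicator)
  also have "\<dots> \<le> ennreal (4 / (\<epsilon> / 4))"
    by (rule nn_integral_log_weight_le) (use eps in simp)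
  also have "(\<integral>\<^sup>+p\<in>triangle. ennreal (fst p powr (- 1 - a)) \<partial>lborel2) = ennreal (1 / (1 - a))"
    by (rule nn_integral_triangle_powr_fst) (use a_bounds in simp)
  also have "ennreal 2 * ennreal (4 / (\<epsilon> / 4)) + ennreal 4 * ennreal (1 / (1 - a))
      = ennreal (32 / \<epsilon> + 4 / (1 - a))"
    using eps a_bounds by (subst ennreal_lincomb[symmetric]) auto
  finally show ?thesis by (simp add: add_mono mult_left_mono)
qed

text \<open>The summands come from the strip, from the triangle near t = 0 and from the triangle
  near s = 0.\<close>

definition d1_bound :: real where
  "d1_bound = K0 * (1 / (\<beta> - a) * (1 / (\<beta> - a))) + 4 * K0 * (1 / (\<beta> - a)) + 8 * (Km + 1) * (1 / (1 - a))"

lemma nn_integral_d1_moment: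
  "(\<integral>\<^sup>+p. ennreal (\<bar>d1 p\<bar> * (exp (a * \<bar>ln (fst p)\<bar>) * exp (a * \<bar>ln (snd p)\<bar>))) \<partial>lborel2)
      \<le> ennreal d1_bound"
proof -
  let ?X = "\<lambda>p. ennreal (fst p powr ((\<beta> - a) - 1)) * ennreal (snd p powr (- (\<beta> - a) - 1))
      * indicator strip p"
  let ?Y = "\<lambda>p. ennreal (snd p powr ((\<beta> - a) - 2)) * indicator triangle p"
  let ?Z = "\<lambda>p. ennreal (fst p powr (- 1 - a)) * indicator triangle p"
  have "(\<integral>\<^sup>+p. ennreal (\<bar>d1 p\<bar> * (exp (a * \<bar>ln (fst p)\<bar>) * exp (a * \<bar>ln (snd p)\<bar>))) \<partial>lborel2)
     \<le> (\<integral>\<^sup>+p. ennreal K0 * ?X p + ennreal (4 * K0) * ?Y p + ennreal (8 * (Km + 1)) * ?Z p \<partial>lborel2)"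
  proof (rule nn_integral_mono)
    fix p :: "real \<times> real"
    obtain s t where p: "p = (s, t)" by (cases p)
    consider "(s, t) \<in> triangle" | "(s, t) \<in> strip" "(s, t) \<notin> triangle" | "(s, t) \<notin> strip" "(s, t) \<notin>
        triangle" by blast
    then show "ennreal (\<bar>d1 p\<bar> * (exp (a * \<bar>ln (fst p)\<bar>) * exp (a * \<bar>ln (snd p)\<bar>)))
      \<le> ennreal K0 * ?X p + ennreal (4 * K0) * ?Y p + ennreal (8 * (Km + 1)) * ?Z p"
    proof cases
      case 1
      then have "(s, t) \<notin> strip" by (auto simp: strip_def triangle_def)
      then have "\<bar>d1 p\<bar> * (exp (a * \<bar>ln (fst p)\<bar>) * exp (a * \<bar>ln (snd p)\<bar>))
          = \<bar>(K s t / s - 1) / t\<^sup>2\<bar> * (s powr - a * t powr - a)"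
        unfolding p fst_conv snd_conv exp_abs_ln_less_1[OF st_bounds(3,4)[OF 1]]
            exp_abs_ln_less_1[OF st_bounds(1,2)[OF 1]]
        using 1 by (simp add: d1_def)
      then have "ennreal (\<bar>d1 p\<bar> * (exp (a * \<bar>ln (fst p)\<bar>) * exp (a * \<bar>ln (snd p)\<bar>)))
          \<le> ennreal (4 * K0 * t powr ((\<beta> - a) - 2) + 8 * (Km + 1) * s powr (- 1 - a))"
        using d1_triangle_pointwise[OF 1] by (intro ennreal_leI) simp
      also have "\<dots> = ennreal (4 * K0) * ennreal (t powr ((\<beta> - a) - 2))
          + ennreal (8 * (Km + 1)) * ennreal (s powr (- 1 - a))"
        using K0_pos Km_nonneg by (intro ennreal_lincomb) auto
      finally show ?thesis
        using 1 \<open>(s, t) \<notin> strip\<close> by (simp only: p fst_conv snd_conv indicator_simps mult_1_right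
            mult_zero_right add_0 not_False_eq_True)
    next
      case 2
      then have "0 < s" "s < 1" "1 \<le> t" by (auto simp: strip_def)
      then have "\<bar>d1 p\<bar> * (exp (a * \<bar>ln (fst p)\<bar>) * exp (a * \<bar>ln (snd p)\<bar>))
          = \<bar>(K s t / t - 1) / (s * t)\<bar> * (s powr - a * t powr a)"
        using 2 by (simp only: p fst_conv snd_conv exp_abs_ln_less_1 exp_abs_ln_ge_1) (simp add: d1_def)
      then have "ennreal (\<bar>d1 p\<bar> * (exp (a * \<bar>ln (fst p)\<bar>) * exp (a * \<bar>ln (snd p)\<bar>)))
          \<le> ennreal (K0 * (s powr ((\<beta> - a) - 1) * t powr (- (\<beta> - a) - 1)))"
        using d1_strip_pointwise[OF 2(1)] by (intro ennreal_leI) simp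
      also have "\<dots> = ennreal K0 * (ennreal (s powr ((\<beta> - a) - 1)) * ennreal (t powr (- (\<beta> - a) - 1)))"
        using K0_pos by (simp add: ennreal_mult)
      finally show ?thesis
        using 2 by (simp only: p fst_conv snd_conv indicator_simps mult_1_right mult_zero_right
            add_0_right not_False_eq_True)
    qed (simp add: p d1_def)
  qed
  also have "\<dots> = ennreal K0 * (\<integral>\<^sup>+p. ?X p \<partial>lborel2) + ennreal (4 * K0) * (\<integral>\<^sup>+p. ?Y p \<partial>lborel2)
      + ennreal (8 * (Km + 1)) * (\<integral>\<^sup>+p. ?Z p \<partial>lborel2)"
  proof -
    have "(\<integral>\<^sup>+p. 1 * (ennreal K0 * ?X p + ennreal (4 * K0) * ?Y p)
        + ennreal (8 * (Km + 1)) * ?Z p \<partial>lborel2)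
        = 1 * (\<integral>\<^sup>+p. ennreal K0 * ?X p + ennreal (4 * K0) * ?Y p \<partial>lborel2)
            + ennreal (8 * (Km + 1)) * (\<integral>\<^sup>+p. ?Z p \<partial>lborel2)"
      by (rule nn_integral_lincomb) measurable
    also have "(\<integral>\<^sup>+p. ennreal K0 * ?X p + ennreal (4 * K0) * ?Y p \<partial>lborel2)
        = ennreal K0 * (\<integral>\<^sup>+p. ?X p \<partial>lborel2) + ennreal (4 * K0) * (\<integral>\<^sup>+p. ?Y p \<partial>lborel2)"
      by (rule nn_integral_lincomb) measurable
    finally show ?thesis by (simp only: mult_1_left)
  qed
  also have "(\<integral>\<^sup>+p. ?X p \<partial>lborel2) = ennreal (1 / (\<beta> - a)) * ennreal (1 / (\<beta> - a))"
  proof -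
    have "(\<integral>\<^sup>+p. ?X p \<partial>lborel2) = (\<integral>\<^sup>+s\<in>{0<..<1}. ennreal (s powr ((\<beta> - a) - 1)) \<partial>lborel)
        * (\<integral>\<^sup>+t\<in>{1..}. ennreal (t powr (- (\<beta> - a) - 1)) \<partial>lborel)"
      by (rule nn_integral_strip) measurable
    then show ?thesis
      by (simp only: nn_integral_powr_Ioo[OF a_bounds(3)] nn_integral_powr_atLeast[OF a_bounds(3)])
  qed
  also have "(\<integral>\<^sup>+p. ?Y p \<partial>lborel2) = ennreal (1 / (\<beta> - a))"
    by (rule nn_integral_triangle_powr_snd[OF a_bounds(3)])
  also have "(\<integral>\<^sup>+p. ?Z p \<partial>lborel2) = ennreal (1 / (1 - a))"
    by (rule nn_integral_triangle_powr_fst) (use a_bounds in simp)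
  also have "ennreal K0 * (ennreal (1 / (\<beta> - a)) * ennreal (1 / (\<beta> - a)))
      + ennreal (4 * K0) * ennreal (1 / (\<beta> - a))
      + ennreal (8 * (Km + 1)) * ennreal (1 / (1 - a)) = ennreal d1_bound"
  proof -
    have "0 \<le> 1 / (\<beta> - a)" "0 \<le> 1 / (1 - a)" "0 \<le> 4 * K0" "0 \<le> 8 * (Km + 1)" "0 \<le> K0"
      using a_bounds K0_pos Km_nonneg by auto
    then show ?thesis unfolding d1_bound_def
      by (simp only: ennreal_mult[symmetric] ennreal_plus[symmetric] mult_nonneg_nonneg
          add_nonneg_nonneg)
  qed
  finally show ?thesis .
qed

lemma nn_integral_d0_moment:
  "(\<integral>\<^sup>+p. ennreal (d0 p * (\<bar>ln (fst p)\<bar> * exp (a * \<bar>ln (fst p)\<bar>) * exp (a * \<bar>ln (snd p)\<bar>)))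
      \<partial>lborel2) < \<infinity>"
proof -
  let ?Y = "\<lambda>p. ennreal (snd p powr ((1 - a) - 2)) * indicator triangle p"
  let ?Z = "\<lambda>p. ennreal (fst p powr (- 1 - a)) * indicator triangle p"
  have "(\<integral>\<^sup>+p. ennreal (d0 p * (\<bar>ln (fst p)\<bar> * exp (a * \<bar>ln (fst p)\<bar>) * exp (a * \<bar>ln (snd p)\<bar>)))
      \<partial>lborel2)
     \<le> (\<integral>\<^sup>+p. ennreal 4 * ?Y p + ennreal 8 * ?Z p \<partial>lborel2)"
  proof (rule nn_integral_mono)
    fix p :: "real \<times> real"
    obtain s t where p: "p = (s, t)" by (cases p)
    show "ennreal (d0 p * (\<bar>ln (fst p)\<bar> * exp (a * \<bar>ln (fst p)\<bar>) * exp (a * \<bar>ln (snd p)\<bar>)))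
        \<le> ennreal 4 * ?Y p + ennreal 8 * ?Z p"
    proof (cases "(s, t) \<in> triangle")
      case True
      have "d0 p * (\<bar>ln (fst p)\<bar> * exp (a * \<bar>ln (fst p)\<bar>) * exp (a * \<bar>ln (snd p)\<bar>))
          = 1 / t\<^sup>2 * (\<bar>ln s\<bar> * s powr - a * t powr - a)"
        unfolding p fst_conv snd_conv exp_abs_ln_less_1[OF st_bounds(3,4)[OF True]]
            exp_abs_ln_less_1[OF st_bounds(1,2)[OF True]]
        using True by (simp add: d0_def)
      then have "ennreal (d0 p * (\<bar>ln (fst p)\<bar> * exp (a * \<bar>ln (fst p)\<bar>) * exp (a * \<bar>ln (snd p)\<bar>)))
          \<le> ennreal (4 * t powr ((1 - a) - 2) + 8 * s powr (- 1 - a))"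
        using d0_moment_pointwise[OF True] by (intro ennreal_leI) simp
      also have "\<dots> = ennreal 4 * ennreal (t powr ((1 - a) - 2)) + ennreal 8 * ennreal (s powr (- 1 - a))"
        by (rule ennreal_lincomb) auto
      finally show ?thesis using True by (simp only: p fst_conv snd_conv indicator_simps mult_1_right)
    qed (simp add: p d0_def)
  qed
  also have "\<dots> = ennreal 4 * (\<integral>\<^sup>+p. ?Y p \<partial>lborel2) + ennreal 8 * (\<integral>\<^sup>+p. ?Z p \<partial>lborel2)"
    by (rule nn_integral_lincomb) measurable
  also have "(\<integral>\<^sup>+p. ?Y p \<partial>lborel2) = ennreal (1 / (1 - a))"
    by (rule nn_integral_triangle_powr_snd) (use a_bounds in simp)
  also have "(\<integral>\<^sup>+p. ?Z p \<partial>lborel2) = ennreal (1 / (1 - a))"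
    by (rule nn_integral_triangle_powr_fst) (use a_bounds in simp)
  also have "ennreal 4 * ennreal (1 / (1 - a)) + ennreal 8 * ennreal (1 / (1 - a)) < \<infinity>"
    by (simp add: ennreal_mult[symmetric] ennreal_mult_less_top)
  finally show ?thesis .
qed

text \<open>Integrating \<open>d0\<close> over \<open>s\<close> leaves dt/t, which is Lebesgue
  measure in q = ln t on the negative half-line; so the integral of f(u + q) is the increment of
  \<open>F\<close> from minus infinity to \<open>u\<close>.\<close>

lemma d0_marginal:
  assumes F: "\<And>v. (F has_real_derivative f v) (at v)" and f: "continuous_on UNIV f"
    and nonneg: "\<And>v. f v \<ge> 0" and lim: "(F \<longlongrightarrow> 0) at_bot"
  shows "(\<integral>p. d0 p * f (u + ln (snd p)) \<partial>lborel2) = F u"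
proof -
  have [measurable]: "f \<in> borel_measurable borel" by (rule borel_measurable_continuous_onI[OF f])
  have mono: "F v \<le> F w" if "v \<le> w" for v w
    by (rule DERIV_nonneg_imp_nondecreasing[OF that]) (use F nonneg in blast)
  have "F u \<ge> 0"
    by (rule tendsto_upperbound[OF lim]) (auto intro!:
        eventually_mono[OF eventually_le_at_bot[of u]] mono)
  have "(\<integral>\<^sup>+p. ennreal (d0 p * f (u + ln (snd p))) \<partial>lborel2)
      = (\<integral>\<^sup>+p\<in>triangle. ennreal (f (u + ln (snd p)) / (snd p)\<^sup>2) \<partial>lborel2)"
    by (intro nn_integral_cong) (auto simp: d0_def split: split_indicator)
  also have "\<dots> = (\<integral>\<^sup>+t\<in>{0<..<1}. ennreal t * ennreal (f (u + ln t) / t\<^sup>2) \<partial>lborel)"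
    by (rule nn_integral_triangle_snd) measurable
  also have "\<dots> = (\<integral>\<^sup>+t\<in>{0<..<1}. ennreal (f (u + ln t) / t) \<partial>lborel)"
    using nonneg by (intro nn_integral_cong)
      (auto simp: ennreal_mult[symmetric] power2_eq_square split: split_indicator)
  also have "\<dots> = ennreal (F (u + ln 1) - 0)"
  proof (rule nn_integral_FTC_greaterThanLessThan[where F = "\<lambda>t. F (u + ln t)"])
    have d: "((\<lambda>t. F (u + ln t)) has_real_derivative f (u + ln x) / x) (at x)" if "0 < x" for x
    proof -
      have "((\<lambda>t. u + ln t) has_real_derivative 1 / x) (at x)"
        using that by (auto intro!: derivative_eq_intros)
      from DERIV_chain2[OF F this] show ?thesis by simp
    qed
    then show "((\<lambda>t. F (u + ln t)) has_real_derivative f (u + ln x) / x) (at x)" if "0 < x" for x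
      using that by simp
    show "((\<lambda>t. F (u + ln t)) \<longlongrightarrow> F (u + ln 1)) (at_left 1)"
      by (rule tendsto_mono[OF at_le[OF subset_UNIV]])
          (use DERIV_isCont[OF d, of 1] in \<open>simp add: isCont_def\<close>)
    have "filterlim (\<lambda>t. u + ln t) at_bot (at_right 0)"
      using filterlim_tendsto_add_at_bot_iff[OF tendsto_const] ln_at_0 by blast
    then show "((\<lambda>t. F (u + ln t)) \<longlongrightarrow> 0) (at_right 0)"
      by (rule filterlim_compose[OF lim])
    show "continuous_on {0<..<1} (\<lambda>t. f (u + ln t) / t)"
      by (intro continuous_intros continuous_on_compose2[OF f]) auto
  qed (use nonneg in auto)
  finally have "(\<integral>\<^sup>+p. ennreal (d0 p * f (u + ln (snd p))) \<partial>lborel2) = ennreal (F u)" by simp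
  then show ?thesis
    using \<open>F u \<ge> 0\<close> nonneg d0_nonneg by (subst integral_eq_nn_integral) auto
qed

text \<open>32 is the true coefficient of \<open>1 / \<epsilon>\<close>; the bounded contributions
  may be multiplied by \<open>1 / \<epsilon>\<close> as well, because
  \<open>\<epsilon> \<le> 1\<close>.\<close>

definition C :: real where
  "C = 32 + 4 / (1 - a) + d1_bound"

lemma d1_bound_nonneg: "0 \<le> d1_bound"
  using a_bounds K0_pos Km_nonneg by (simp add: d1_bound_def)

lemma C_pos: "C > 0"
  using a_bounds d1_bound_nonneg by (simp add: C_def add_pos_nonneg)

sublocale split_weights lborel2 "\<lambda>p. d0 p + d1 p" "\<lambda>p. ln (fst p)" "\<lambda>p. ln (snd p)" a C d0 d1
proof unfold_locales
  fix \<epsilon> u :: real assume eps: "0 < \<epsilon>" "\<epsilon> \<le> 1"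
  let ?w0 = "\<lambda>p :: real \<times> real. exp (a * \<bar>ln (fst p)\<bar>) * exp (- \<epsilon> * \<bar>u + ln (snd p)\<bar> / 4)"
  let ?w1 = "\<lambda>p :: real \<times> real. exp (a * \<bar>ln (fst p)\<bar>) * exp (a * \<bar>ln (snd p)\<bar>)"
  have "(\<integral>\<^sup>+p. ennreal (\<bar>d0 p + d1 p\<bar> * ?w0 p) \<partial>lborel2)
      \<le> (\<integral>\<^sup>+p. ennreal (d0 p * ?w0 p) + ennreal (\<bar>d1 p\<bar> * ?w1 p) \<partial>lborel2)"
  proof (rule nn_integral_mono)
    fix p :: "real \<times> real"
    \<comment> \<open>\<open>d1\<close> tolerates the growing weight in \<open>ln t\<close> in place
      of the decaying one, so a single moment, independent of \<open>u\<close> and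
      \<open>\<epsilon>\<close>, controls it.\<close>
    have "exp (- \<epsilon> * \<bar>u + ln (snd p)\<bar> / 4) \<le> 1" using eps by simp
    also have "1 \<le> exp (a * \<bar>ln (snd p)\<bar>)" using a_bounds by simp
    finally have "?w0 p \<le> ?w1 p" by (intro mult_left_mono) auto
    then have "\<bar>d1 p\<bar> * ?w0 p \<le> \<bar>d1 p\<bar> * ?w1 p" by (intro mult_left_mono) auto
    moreover have "\<bar>d0 p + d1 p\<bar> * ?w0 p \<le> (d0 p + \<bar>d1 p\<bar>) * ?w0 p"
      using d0_nonneg[of p] by (intro mult_right_mono) auto
    ultimately have "\<bar>d0 p + d1 p\<bar> * ?w0 p \<le> d0 p * ?w0 p + \<bar>d1 p\<bar> * ?w1 p"
      by (simp add: distrib_right)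
    then show "ennreal (\<bar>d0 p + d1 p\<bar> * ?w0 p) \<le> ennreal (d0 p * ?w0 p) + ennreal (\<bar>d1 p\<bar> * ?w1 p)"
      using d0_nonneg[of p] by (simp add: ennreal_plus[symmetric] ennreal_leI del: ennreal_plus)
  qed
  also have "\<dots> = (\<integral>\<^sup>+p. ennreal (d0 p * ?w0 p) \<partial>lborel2) + (\<integral>\<^sup>+p. ennreal (\<bar>d1 p\<bar> * ?w1 p) \<partial>lborel2)"
    by (rule nn_integral_add) measurable
  also have "\<dots> \<le> ennreal (32 / \<epsilon> + 4 / (1 - a)) + ennreal d1_bound"
    by (intro add_mono nn_integral_d0_weight nn_integral_d1_moment eps)
  also have "\<dots> = ennreal (32 / \<epsilon> + 4 / (1 - a) + d1_bound)"
    using eps a_bounds d1_bound_nonneg by (simp add: ennreal_plus[symmetric] del: ennreal_plus)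
  also have "\<dots> \<le> ennreal (C / \<epsilon>)"
  proof (rule ennreal_leI)
    have "(4 / (1 - a) + d1_bound) * \<epsilon> \<le> (4 / (1 - a) + d1_bound) * 1"
      using eps a_bounds d1_bound_nonneg by (intro mult_left_mono) auto
    then show "32 / \<epsilon> + 4 / (1 - a) + d1_bound \<le> C / \<epsilon>"
      using eps by (simp add: C_def pos_le_divide_eq distrib_right)
  qed
  finally show "(\<integral>\<^sup>+p. ennreal (\<bar>d0 p + d1 p\<bar> * ?w0 p) \<partial>lborel2) \<le> ennreal (C / \<epsilon>)" .
  show "integrable lborel2 (\<lambda>p. d0 p * ?w0 p)"
  proof (rule integrableI_bounded)
    show "(\<integral>\<^sup>+p. ennreal (norm (d0 p * ?w0 p)) \<partial>lborel2) < \<infinity>"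
      using nn_integral_d0_weight[OF eps, of u] d0_nonneg
      by (simp add: abs_mult) (erule order_le_less_trans, simp)
  qed measurable
next
  show "integrable lborel2 (\<lambda>p. \<bar>d1 p\<bar> * (exp (a * \<bar>ln (fst p)\<bar>) * exp (a * \<bar>ln (snd p)\<bar>)))"
  proof (rule integrableI_bounded)
    show "(\<integral>\<^sup>+p. ennreal (norm (\<bar>d1 p\<bar> * (exp (a * \<bar>ln (fst p)\<bar>) * exp (a * \<bar>ln (snd p)\<bar>))))
        \<partial>lborel2) < \<infinity>"
      using nn_integral_d1_moment by (simp add: abs_mult) (erule order_le_less_trans, simp)
  qed measurable
  show "integrable lborel2 (\<lambda>p. d0 p * (\<bar>ln (fst p)\<bar> * exp (a * \<bar>ln (fst p)\<bar>) * exp (a * \<bar>ln (snd p)\<bar>)))"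
  proof (rule integrableI_bounded)
    show "(\<integral>\<^sup>+p. ennreal (norm (d0 p * (\<bar>ln (fst p)\<bar> * exp (a * \<bar>ln (fst p)\<bar>)
        * exp (a * \<bar>ln (snd p)\<bar>)))) \<partial>lborel2) < \<infinity>"
      using nn_integral_d0_moment d0_nonneg by (simp add: abs_mult)
  qed measurable
  show "ln (snd p) \<le> 0" if "d0 p \<noteq> 0" for p :: "real \<times> real"
    using that by (auto simp: d0_def triangle_def split: split_indicator_asm)
qed (use d0_nonneg d0_marginal C_pos in auto)

end

section \<open>The profile equation\<close>

lemma nn_integral_lborel2_scale:
  fixes H :: "real \<times> real \<Rightarrow> ennreal"
  assumes [measurable]: "H \<in> borel_measurable lborel2" and c: "0 < c"
  shows "(\<integral>\<^sup>+y. \<integral>\<^sup>+z. H (y, z) \<partial>lborel \<partial>lborel)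
      = (\<integral>\<^sup>+p. ennreal (c\<^sup>2) * H (c * fst p, c * snd p) \<partial>lborel2)"
proof -
  have inner: "(\<integral>\<^sup>+z. H (y, z) \<partial>lborel) = ennreal c * (\<integral>\<^sup>+t. H (y, c * t) \<partial>lborel)" for y
    using nn_integral_real_affine[of "\<lambda>z. H (y, z)" c 0] c by simp
  have "(\<integral>\<^sup>+y. \<integral>\<^sup>+z. H (y, z) \<partial>lborel \<partial>lborel)
      = (\<integral>\<^sup>+y. ennreal c * (\<integral>\<^sup>+t. H (y, c * t) \<partial>lborel) \<partial>lborel)"
    by (simp only: inner)
  also have "\<dots> = ennreal c * (\<integral>\<^sup>+s. ennreal c * (\<integral>\<^sup>+t. H (c * s, c * t) \<partial>lborel) \<partial>lborel)"
    using nn_integral_real_affine[of "\<lambda>y. ennreal c * (\<integral>\<^sup>+t. H (y, c * t) \<partial>lborel)" c 0] c by simp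
  also have "\<dots> = ennreal c * (ennreal c * (\<integral>\<^sup>+s. \<integral>\<^sup>+t. H (c * s, c * t) \<partial>lborel \<partial>lborel))"
    by (subst nn_integral_cmult) simp_all
  also have "(\<integral>\<^sup>+s. \<integral>\<^sup>+t. H (c * s, c * t) \<partial>lborel \<partial>lborel) = (\<integral>\<^sup>+p. H (c * fst p, c * snd p) \<partial>lborel2)"
    using lborel.nn_integral_fst[of "\<lambda>p. H (c * fst p, c * snd p)" lborel] by simp
  also have "ennreal c * (ennreal c * \<dots>) = ennreal (c\<^sup>2) * (\<integral>\<^sup>+p. H (c * fst p, c * snd p) \<partial>lborel2)"
    using c by (simp add: power2_eq_square ennreal_mult mult.assoc)
  also have "\<dots> = (\<integral>\<^sup>+p. ennreal (c\<^sup>2) * H (c * fst p, c * snd p) \<partial>lborel2)"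
    by (subst nn_integral_cmult) simp_all
  finally show ?thesis .
qed

section \<open>The candidate profile: regularity, mass and asymptotics\<close>

text \<open>The mass density G' in the variable u = ln x; \<open>profile\<close> is the same density
  in the variable x.\<close>

definition log_density :: "real \<Rightarrow> (real \<Rightarrow> real) \<Rightarrow> real \<Rightarrow> real" where
  "log_density \<epsilon> r u = \<epsilon> * exp (log_profile \<epsilon> r u)"

definition profile :: "real \<Rightarrow> (real \<Rightarrow> real) \<Rightarrow> real \<Rightarrow> real" where
  "profile \<epsilon> r x = log_density \<epsilon> r (ln x) / x"

context
  fixes \<epsilon> :: real and r s :: "real \<Rightarrow> real"
  assumes eps: "\<epsilon> > 0" and rs: "C1_small r s"
begin

lemma log_density_pos: "log_density \<epsilon> r u > 0"
  using eps by (simp add: log_density_def)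

lemma profile_pos: "x > 0 \<Longrightarrow> profile \<epsilon> r x > 0"
  using log_density_pos by (simp add: profile_def)

lemma continuous_on_log_density: "continuous_on UNIV (log_density \<epsilon> r)"
  unfolding log_density_def[abs_def] by (intro continuous_intros continuous_on_log_profile[OF eps rs])

lemma measurable_log_density [measurable]: "log_density \<epsilon> r \<in> borel_measurable borel"
  by (rule borel_measurable_continuous_onI[OF continuous_on_log_density])

lemma measurable_profile: "profile \<epsilon> r \<in> borel_measurable borel"
  unfolding profile_def[abs_def] by measurable

lemma DERIV_log_density: "(log_density \<epsilon> r has_real_derivative \<epsilon>
    * (exp (log_profile \<epsilon> r u) * log_profile' \<epsilon> r s u)) (at u)"
  unfolding log_density_def[abs_def]
  by (rule DERIV_cmult[OF DERIV_fun_exp[OF DERIV_log_profile[OF eps rs]]])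

lemma profile_C1: "profile \<epsilon> r C1_differentiable_on {0<..}"
proof -
  define D where "D x = ((\<epsilon> * (exp (log_profile \<epsilon> r (ln x)) * log_profile' \<epsilon> r s (ln x))) * (1 / x)
      * x - log_density \<epsilon> r (ln x) * 1) / (x * x)" for x
  have "(profile \<epsilon> r has_vector_derivative D x) (at x)" if "x \<in> {0<..}" for x
  proof -
    have "((\<lambda>x. log_density \<epsilon> r (ln x)) has_real_derivative
        (\<epsilon> * (exp (log_profile \<epsilon> r (ln x)) * log_profile' \<epsilon> r s (ln x))) * (1 / x)) (at x)"
      using that by (intro DERIV_chain2[OF DERIV_log_density DERIV_ln_divide]) auto
    from DERIV_divide[OF this DERIV_ident] show ?thesis
      using that by (simp add: profile_def[abs_def] D_def
          has_real_derivative_iff_has_vector_derivative[symmetric])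
  qed
  moreover have "continuous_on {0<..} D"
  proof -
    have "continuous_on {0<..} (\<lambda>x. h (ln x))" if "continuous_on UNIV h" for h :: "real \<Rightarrow> real"
      by (rule continuous_on_compose2[OF that]) (auto intro!: continuous_intros)
    note c = this[OF continuous_on_log_profile[OF eps rs]]
        this[OF continuous_on_log_profile'[OF eps rs]] this[OF continuous_on_log_density]
    show ?thesis unfolding D_def[abs_def]
      by (intro continuous_intros c) auto
  qed
  ultimately show ?thesis unfolding C1_differentiable_on_def by blast
qed

lemma DERIV_logistic_ln:
  assumes "0 < x"
  shows "((\<lambda>t. logistic \<epsilon> r (u + ln t)) has_real_derivative log_density \<epsilon> r (u + ln x) / x) (at x)"
proof -
  have "((\<lambda>t. u + ln t) has_real_derivative 1 / x) (at x)"
    using assms by (auto intro!: derivative_eq_intros)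
  from DERIV_chain2[OF DERIV_logistic[OF eps rs] this] show ?thesis by (simp add: log_density_def)
qed

lemma logistic_ln_at_0: "((\<lambda>t. logistic \<epsilon> r (u + ln t)) \<longlongrightarrow> 0) (at_right 0)"
proof -
  have "filterlim (\<lambda>t. u + ln t) at_bot (at_right 0)"
    using filterlim_tendsto_add_at_bot_iff[OF tendsto_const] ln_at_0 by blast
  then show ?thesis by (rule filterlim_compose[OF logistic_at_bot[OF eps rs]])
qed

lemma logistic_ln_at_top: "((\<lambda>t. logistic \<epsilon> r (u + ln t)) \<longlongrightarrow> 1) at_top"
  by (rule filterlim_compose[OF logistic_at_top[OF eps rs]
      filterlim_tendsto_add_at_top[OF tendsto_const ln_at_top]])

lemma continuous_on_log_density_ln:
  assumes "S \<subseteq> {0<..}"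
  shows "continuous_on S (\<lambda>t. log_density \<epsilon> r (u + ln t) / t)"
  using assms by (intro continuous_intros continuous_on_compose2[OF continuous_on_log_density]) auto

lemma log_density_quotient_nonneg: "0 < x \<Longrightarrow> 0 \<le> log_density \<epsilon> r u / x"
  by (rule divide_nonneg_pos[OF less_imp_le[OF log_density_pos]])

text \<open>With x = exp u this is the mass of \<open>profile\<close> below x, after rescaling that
  interval to the unit interval.\<close>

lemma mass_left: "(\<integral>\<^sup>+t\<in>{0<..<1}. ennreal (log_density \<epsilon> r (u + ln t) / t) \<partial>lborel)
    = ennreal (logistic \<epsilon> r u)"
proof -
  have "(\<integral>\<^sup>+t\<in>{0<..<1}. ennreal (log_density \<epsilon> r (u + ln t) / t) \<partial>lborel)
      = ennreal (logistic \<epsilon> r (u + ln 1) - 0)"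
  proof (rule nn_integral_FTC_greaterThanLessThan[OF _ DERIV_logistic_ln continuous_on_log_density_ln
        log_density_quotient_nonneg logistic_ln_at_0])
    show "((\<lambda>t. logistic \<epsilon> r (u + ln t)) \<longlongrightarrow> logistic \<epsilon> r (u + ln 1)) (at_left 1)"
      by (rule tendsto_mono[OF at_le[OF subset_UNIV]])
        (use DERIV_isCont[OF DERIV_logistic_ln, of 1] in \<open>simp add: isCont_def\<close>)
  qed auto
  then show ?thesis by simp
qed

lemma mass_right: "(\<integral>\<^sup>+t\<in>{1..}. ennreal (log_density \<epsilon> r (u + ln t) / t) \<partial>lborel)
    = ennreal (1 - logistic \<epsilon> r u)"
proof -
  have "(\<integral>\<^sup>+t\<in>{1..}. ennreal (log_density \<epsilon> r (u + ln t) / t) \<partial>lborel)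
      = ennreal (1 - logistic \<epsilon> r (u + ln 1))"
    by (rule nn_integral_FTC_atLeast[OF _ DERIV_logistic_ln log_density_quotient_nonneg
        logistic_ln_at_top]) simp_all
  then show ?thesis by simp
qed

text \<open>No normalising constant has to be chosen: G runs from 0 to 1 by construction.\<close>

lemma total_mass: "(\<integral>\<^sup>+x\<in>{0<..}. ennreal (profile \<epsilon> r x) \<partial>lborel) = 1"
proof -
  have "(\<integral>\<^sup>+x\<in>{0<..}. ennreal (log_density \<epsilon> r (0 + ln x) / x) \<partial>lborel) = ennreal (1 - 0)"
    by (rule nn_integral_FTC_greaterThan[OF DERIV_logistic_ln continuous_on_log_density_ln
        log_density_quotient_nonneg logistic_ln_at_0 logistic_ln_at_top]) auto
  then show ?thesis by (simp add: profile_def)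
qed

text \<open>On the strip the variables separate. The factors are the masses below and above x, so
  the product is G (1 - G), the logistic term.\<close>

lemma strip_integral:
  "integrable lborel2 (\<lambda>p. indicator strip p *
      (log_density \<epsilon> r (u + ln (fst p)) / fst p * (log_density \<epsilon> r (u + ln (snd p)) / snd p)))"
  (is "integrable _ ?f")
  "(\<integral>p. indicator strip p * (log_density \<epsilon> r (u + ln (fst p)) / fst p
      * (log_density \<epsilon> r (u + ln (snd p)) / snd p)) \<partial>lborel2)
     = exp (log_logistic \<epsilon> r u)"
proof -
  have nonneg: "0 \<le> ?f p" for p
    using log_density_pos by (auto simp: strip_def less_imp_le split: split_indicator)
  have "(\<integral>\<^sup>+p. ennreal (?f p) \<partial>lborel2)
      = (\<integral>\<^sup>+p\<in>strip. ennreal (log_density \<epsilon> r (u + ln (fst p)) / fst p)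
          * ennreal (log_density \<epsilon> r (u + ln (snd p)) / snd p) \<partial>lborel2)"
    using log_density_pos by (intro nn_integral_cong)
      (auto simp: strip_def less_imp_le ennreal_mult[symmetric] split: split_indicator)
  also have "\<dots> = (\<integral>\<^sup>+s\<in>{0<..<1}. ennreal (log_density \<epsilon> r (u + ln s) / s) \<partial>lborel)
      * (\<integral>\<^sup>+t\<in>{1..}. ennreal (log_density \<epsilon> r (u + ln t) / t) \<partial>lborel)"
    by (rule nn_integral_strip) measurable
  also have "\<dots> = ennreal (exp (log_logistic \<epsilon> r u))"
    unfolding mass_left mass_right exp_log_logistic
    using logistic_bounds[of \<epsilon> r u] by (simp add: ennreal_mult less_imp_le)
  finally have n: "(\<integral>\<^sup>+p. ennreal (?f p) \<partial>lborel2) = ennreal (exp (log_logistic \<epsilon> r u))" .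
  show i: "integrable lborel2 ?f"
    by (rule integrableI_nn_integral_finite[OF _ _ n]) (use nonneg in auto)
  show "(\<integral>p. ?f p \<partial>lborel2) = exp (log_logistic \<epsilon> r u)"
    using nn_integral_eq_integral[OF i] nonneg n by (simp add: integral_nonneg_AE)
qed

lemma profile_at_0:
  assumes "\<exists>m>0. \<forall>u\<le>0. exp (\<epsilon> * u) / m \<le> exp (log_profile \<epsilon> r u) \<and> exp (log_profile \<epsilon> r u)
      \<le> m * exp (\<epsilon> * u)"
  shows "profile \<epsilon> r \<in> \<Theta>[at_right 0](\<lambda>x. x powr (\<epsilon> - 1))"
proof -
  obtain m where m: "m > 0" "\<And>u. u \<le> 0 \<Longrightarrow> exp (\<epsilon> * u) / m \<le> exp (log_profile \<epsilon> r u)"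
    "\<And>u. u \<le> 0 \<Longrightarrow> exp (log_profile \<epsilon> r u) \<le> m * exp (\<epsilon> * u)" using assms by auto
  have e: "x powr (\<epsilon> - 1) = exp (\<epsilon> * ln x) / x" if "x > 0" for x
  proof -
    have "x powr (\<epsilon> - 1) = x powr \<epsilon> / x" using that by (simp add: powr_diff)
    moreover have "x powr \<epsilon> = exp (\<epsilon> * ln x)" using that by (simp add: powr_def)
    ultimately show ?thesis by (simp only:)
  qed
  have ev: "\<forall>\<^sub>F x in at_right 0. 0 < x \<and> x < (1::real)"
    using eventually_at_right_real[of 0 1] by simp
  have "profile \<epsilon> r \<in> O[at_right 0](\<lambda>x. x powr (\<epsilon> - 1))"
  proof (rule bigoI[where c = "\<epsilon> * m"])
    show "\<forall>\<^sub>F x in at_right 0. norm (profile \<epsilon> r x) \<le> \<epsilon> * m * norm (x powr (\<epsilon> - 1))"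
      using ev
    proof eventually_elim
      case (elim x)
      then have "\<epsilon> * exp (log_profile \<epsilon> r (ln x)) / x \<le> \<epsilon> * (m * exp (\<epsilon> * ln x)) / x"
        using m(3)[of "ln x"] eps by (intro divide_right_mono mult_left_mono) auto
      moreover have "norm (profile \<epsilon> r x) = profile \<epsilon> r x" using elim profile_pos[of x] by simp
      ultimately show ?case using elim by (simp only:) (simp add: profile_def log_density_def e mult_ac)
    qed
  qed
  moreover have "profile \<epsilon> r \<in> \<Omega>[at_right 0](\<lambda>x. x powr (\<epsilon> - 1))"
  proof (rule landau_omega.bigI[where c = "\<epsilon> / m"])
    show "\<forall>\<^sub>F x in at_right 0. norm (profile \<epsilon> r x) \<ge> \<epsilon> / m * norm (x powr (\<epsilon> - 1))"
      using ev
    proof eventually_elim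
      case (elim x)
      then have "\<epsilon> * (exp (\<epsilon> * ln x) / m) / x \<le> \<epsilon> * exp (log_profile \<epsilon> r (ln x)) / x"
        using m(2)[of "ln x"] eps by (intro divide_right_mono mult_left_mono) auto
      moreover have "norm (profile \<epsilon> r x) = profile \<epsilon> r x" using elim profile_pos[of x] by simp
      ultimately show ?case using elim by (simp only:) (simp add: profile_def log_density_def e mult_ac)
    qed
  qed (use eps m in auto)
  ultimately show ?thesis by (rule bigthetaI)
qed

lemma profile_at_top:
  assumes "\<exists>m>0. \<forall>u\<ge>0. exp (- (\<rho> * u)) / m \<le> exp (log_profile \<epsilon> r u) \<and> exp (log_profile \<epsilon> r u)
      \<le> m * exp (- (\<rho> * u))"
  shows "profile \<epsilon> r \<in> \<Theta>[at_top](\<lambda>x. 1 / x powr (1 + \<rho>))"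
proof -
  obtain m where m: "m > 0" "\<And>u. u \<ge> 0 \<Longrightarrow> exp (- (\<rho> * u)) / m \<le> exp (log_profile \<epsilon> r u)"
    "\<And>u. u \<ge> 0 \<Longrightarrow> exp (log_profile \<epsilon> r u) \<le> m * exp (- (\<rho> * u))" using assms by auto
  have e: "1 / x powr (1 + \<rho>) = exp (- (\<rho> * ln x)) / x" if "x > 0" for x
  proof -
    have "x powr (1 + \<rho>) = x * x powr \<rho>" using that by (simp add: powr_add)
    moreover have "x powr \<rho> = exp (\<rho> * ln x)" using that by (simp add: powr_def)
    ultimately show ?thesis by (simp only: exp_minus) (simp add: divide_inverse)
  qed
  have ev: "\<forall>\<^sub>F x in at_top. 1 \<le> (x::real)" by (rule eventually_ge_at_top)
  have "profile \<epsilon> r \<in> O[at_top](\<lambda>x. 1 / x powr (1 + \<rho>))"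
  proof (rule bigoI[where c = "\<epsilon> * m"])
    show "\<forall>\<^sub>F x in at_top. norm (profile \<epsilon> r x) \<le> \<epsilon> * m * norm (1 / x powr (1 + \<rho>))"
      using ev
    proof eventually_elim
      case (elim x)
      then have "\<epsilon> * exp (log_profile \<epsilon> r (ln x)) / x \<le> \<epsilon> * (m * exp (- (\<rho> * ln x))) / x"
        using m(3)[of "ln x"] eps by (intro divide_right_mono mult_left_mono) auto
      moreover have "norm (profile \<epsilon> r x) = profile \<epsilon> r x" using elim profile_pos[of x] by simp
      moreover have "norm (1 / x powr (1 + \<rho>)) = exp (- (\<rho> * ln x)) / x" using elim by (subst e) auto
      ultimately show ?case using elim by (simp only:) (simp add: profile_def log_density_def mult_ac)
    qed
  qed
  moreover have "profile \<epsilon> r \<in> \<Omega>[at_top](\<lambda>x. 1 / x powr (1 + \<rho>))"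
  proof (rule landau_omega.bigI[where c = "\<epsilon> / m"])
    show "\<forall>\<^sub>F x in at_top. norm (profile \<epsilon> r x) \<ge> \<epsilon> / m * norm (1 / x powr (1 + \<rho>))"
      using ev
    proof eventually_elim
      case (elim x)
      then have "\<epsilon> * (exp (- (\<rho> * ln x)) / m) / x \<le> \<epsilon> * exp (log_profile \<epsilon> r (ln x)) / x"
        using m(2)[of "ln x"] eps by (intro divide_right_mono mult_left_mono) auto
      moreover have "norm (profile \<epsilon> r x) = profile \<epsilon> r x" using elim profile_pos[of x] by simp
      moreover have "norm (1 / x powr (1 + \<rho>)) = exp (- (\<rho> * ln x)) / x" using elim by (subst e) auto
      ultimately show ?case using elim by (simp only:) (simp add: profile_def log_density_def mult_ac)
    qed
  qed (use eps m in auto)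
  ultimately show ?thesis by (rule bigthetaI)
qed

end

section \<open>From the fixed point to the equation\<close>

context near_additive_kernel
begin

definition full_weight :: "real \<times> real \<Rightarrow> real" where
  "full_weight p = (if 0 < fst p \<and> fst p < 1 \<and> 1
      - fst p < snd p then K (fst p) (snd p) / (fst p * (snd p)\<^sup>2) else 0)"

lemma full_weight_split: "full_weight p = (d0 p + d1 p) + indicator strip p * (1 / fst p * (1 / snd p))"
proof -
  obtain s t where p: "p = (s, t)" by (cases p)
  consider "(s, t) \<in> triangle" | "(s, t) \<in> strip" | "(s, t) \<notin> triangle" "(s, t) \<notin> strip" by blast
  then show ?thesis
  proof cases
    case 1
    then have "(s, t) \<notin> strip" "0 < s" "s < 1" "1 - s < t" "0 < t" by (auto simp: strip_def triangle_def)
    then show ?thesis using 1 by (simp add: p full_weight_def d0_def d1_def field_simps power2_eq_square)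
  next
    case 2
    then have "(s, t) \<notin> triangle" "0 < s" "s < 1" "1 - s < t" "0 < t"
        by (auto simp: strip_def triangle_def)
    then show ?thesis using 2 by (simp add: p full_weight_def d0_def d1_def field_simps power2_eq_square)
  next
    case 3
    then have "\<not> (0 < s \<and> s < 1 \<and> 1 - s < t)" by (auto simp: strip_def triangle_def)
    then show ?thesis using 3 by (auto simp: p full_weight_def d0_def d1_def)
  qed
qed

lemma full_weight_nonneg: "0 \<le> full_weight p"
  using K_nonneg[of "fst p" "snd p"] by (auto simp: full_weight_def)

context
  fixes \<epsilon> :: real and r s :: "real \<Rightarrow> real"
  assumes eps: "0 < \<epsilon>" "\<epsilon> < 1" "3 * \<epsilon> \<le> a" and rs: "C1_small r s" and fixed: "\<Psi> \<epsilon> r = r"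
begin

text \<open>The fixed-point equation unfolded: \<open>d0 + d1\<close> contributes G (1 - G) times
  \<open>\<Psi> \<epsilon> r u = r u\<close>, the strip contributes G (1 - G), and the sum is G (1 -
  G) (1 + r). The splitting is done with Bochner integrals because \<open>d1\<close> changes sign;
  the nonnegativity of \<open>full_weight\<close> allows the return to the nonnegative
  integral.\<close>

lemma nn_integral_full_weight:
  "(\<integral>\<^sup>+p. ennreal (full_weight p * (log_density \<epsilon> r (u + ln (fst p))
      * log_density \<epsilon> r (u + ln (snd p)))) \<partial>lborel2)
     = ennreal (exp (log_profile \<epsilon> r u))"
proof -
  let ?dd = "\<lambda>p. log_density \<epsilon> r (u + ln (fst p)) * log_density \<epsilon> r (u + ln (snd p))"
  let ?E = "\<lambda>p. exp (log_ratio \<epsilon> r u (ln (fst p)) (ln (snd p)))"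
  let ?S = "\<lambda>p. indicator strip p * (log_density \<epsilon> r (u + ln (fst p)) / fst p
      * (log_density \<epsilon> r (u + ln (snd p)) / snd p))"
  have E: "?dd p = \<epsilon>\<^sup>2 * exp (log_logistic \<epsilon> r u) * ?E p" for p
    by (simp add: log_density_def log_ratio_def exp_add exp_diff power2_eq_square)
  have split: "full_weight p * ?dd p = \<epsilon>\<^sup>2 * exp (log_logistic \<epsilon> r u) * ((d0 p + d1 p) * ?E p)
      + ?S p" for p
  proof -
    have "full_weight p * ?dd p = (d0 p + d1 p) * ?dd p + ?S p"
      unfolding full_weight_split by (simp add: algebra_simps)
    then show ?thesis unfolding E by (simp add: mult_ac)
  qed
  note i1 = integrable_exp_log_ratio[OF eps(1) less_imp_le[OF eps(2)] eps(3) rs, of u]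
  note i2 = strip_integral(1)[OF eps(1) rs, of u]
  have i: "integrable lborel2 (\<lambda>p. full_weight p * ?dd p)"
    unfolding split by (intro Bochner_Integration.integrable_add integrable_mult_right i1 i2)
  have "(\<integral>p. full_weight p * ?dd p \<partial>lborel2) = \<epsilon>\<^sup>2 * exp (log_logistic \<epsilon> r u)
      * (\<integral>p. (d0 p + d1 p) * ?E p \<partial>lborel2) + (\<integral>p. ?S p \<partial>lborel2)"
    unfolding split by (subst Bochner_Integration.integral_add[OF integrable_mult_right[OF i1] i2]) simp
  also have "\<dots> = exp (log_logistic \<epsilon> r u) * \<Psi> \<epsilon> r u + exp (log_logistic \<epsilon> r u)"
    unfolding strip_integral(2)[OF eps(1) rs] by (simp add: \<Psi>_def)
  also have "\<dots> = exp (log_profile \<epsilon> r u)"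
    unfolding fixed exp_log_profile[OF eps(1) rs] by (simp add: algebra_simps)
  finally have v: "(\<integral>p. full_weight p * ?dd p \<partial>lborel2) = exp (log_profile \<epsilon> r u)" .
  have "(\<integral>\<^sup>+p. ennreal (full_weight p * ?dd p) \<partial>lborel2) = ennreal (\<integral>p. full_weight p * ?dd p \<partial>lborel2)"
    by (rule nn_integral_eq_integral[OF i])
      (intro AE_I2 mult_nonneg_nonneg full_weight_nonneg less_imp_le log_density_pos[OF eps(1) rs])
  then show ?thesis by (simp only: v)
qed

text \<open>After the substitution y = x s, z = x t, homogeneity makes K(y,z)/z independent of x,
  and the Jacobian x^2 cancels the two factors 1/x in the densities. Only the shift by ln x inside
  \<open>log_density\<close> remains.\<close>

lemma profile_equation: "solves_profile_equation K (1 / \<epsilon>) (profile \<epsilon> r)"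
  unfolding solves_profile_equation_def
proof (intro allI impI)
  fix x :: real assume x: "0 < x"
  let ?g = "profile \<epsilon> r"
  \<comment> \<open>Domain and quadrant cutoff are put into the integrand, so that it is jointly
    measurable on the whole plane.\<close>
  define H where "H p = ennreal (indicator ({0..} \<times> {0..}) p *\<^sub>R K (fst p) (snd p) / snd p
      * ?g (fst p) * ?g (snd p))
      * indicator {p \<in> space lborel2. 0 < fst p \<and> fst p < x \<and> x - fst p < snd p} p" for p
  have [measurable]: "H \<in> borel_measurable lborel2"
  proof -
    note [measurable] = K_measurable measurable_profile[OF eps(1) rs]
    have [measurable]: "?g \<in> borel_measurable lborel" using measurable_profile[OF eps(1) rs] by simp
    show ?thesis unfolding H_def[abs_def] by measurable
  qed
  have "(\<integral>\<^sup>+y\<in>{0<..<x}. (\<integral>\<^sup>+z\<in>{x - y<..}. ennreal (K y z / z * ?g y * ?g z) \<partial>lborel) \<partial>lborel)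
      = (\<integral>\<^sup>+y. \<integral>\<^sup>+z. H (y, z) \<partial>lborel \<partial>lborel)"
  proof (rule nn_integral_cong)
    fix y :: real
    show "(\<integral>\<^sup>+z\<in>{x - y<..}. ennreal (K y z / z * ?g y * ?g z) \<partial>lborel) * indicator {0<..<x} y
        = (\<integral>\<^sup>+z. H (y, z) \<partial>lborel)"
    proof (cases "0 < y \<and> y < x")
      case True
      then have "(\<integral>\<^sup>+z\<in>{x - y<..}. ennreal (K y z / z * ?g y * ?g z) \<partial>lborel) = (\<integral>\<^sup>+z. H (y, z) \<partial>lborel)"
        by (intro nn_integral_cong) (auto simp: H_def space_pair_measure split: split_indicator)
      then show ?thesis using True by simp
    next
      case False
      then have "H (y, z) = 0" for z by (auto simp: H_def)
      then show ?thesis using False by (auto split: split_indicator)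
    qed
  qed
  also have "\<dots> = (\<integral>\<^sup>+p. ennreal (x\<^sup>2) * H (x * fst p, x * snd p) \<partial>lborel2)"
    by (rule nn_integral_lborel2_scale[OF _ x]) measurable
  also have "\<dots> = (\<integral>\<^sup>+p. ennreal (full_weight p
      * (log_density \<epsilon> r (ln x + ln (fst p)) * log_density \<epsilon> r (ln x + ln (snd p)))) \<partial>lborel2)"
  proof (rule nn_integral_cong)
    fix p :: "real \<times> real"
    obtain s t where p: "p = (s, t)" by (cases p)
    have region: "0 < x * s \<and> x * s < x \<and> x - x * s < x * t \<longleftrightarrow> 0 < s \<and> s < 1 \<and> 1 - s < t"
    proof -
      have "x - x * s < x * t \<longleftrightarrow> x * (1 - s) < x * t" by (simp add: algebra_simps)
      then show ?thesis using x by (simp add: zero_less_mult_iff mult_less_cancel_left_pos)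
    qed
    show "ennreal (x\<^sup>2) * H (x * fst p, x * snd p)
        = ennreal (full_weight p * (log_density \<epsilon> r (ln x + ln (fst p))
            * log_density \<epsilon> r (ln x + ln (snd p))))"
    proof (cases "0 < s \<and> s < 1 \<and> 1 - s < t")
      case True
      then have st: "0 < s" "0 < t" by auto
      have "H (x * s, x * t) = ennreal (K (x * s) (x * t) / (x * t) * ?g (x * s) * ?g (x * t))"
        using True region x st by (auto simp: H_def space_pair_measure)
      also have "K (x * s) (x * t) / (x * t) * ?g (x * s) * ?g (x * t)
          = K s t / t * (log_density \<epsilon> r (ln x + ln s) / (x * s))
              * (log_density \<epsilon> r (ln x + ln t) / (x * t))"
        using K_homogeneous[OF st x] x st by (simp add: profile_def ln_mult)
      finally have "H (x * s, x * t)
          = ennreal (K s t / t * (log_density \<epsilon> r (ln x + ln s) / (x * s))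
              * (log_density \<epsilon> r (ln x + ln t) / (x * t)))" .
      then have "ennreal (x\<^sup>2) * H (x * s, x * t)
          = ennreal (x\<^sup>2 * (K s t / t * (log_density \<epsilon> r (ln x + ln s) / (x * s))
              * (log_density \<epsilon> r (ln x + ln t) / (x * t))))"
        by (simp only: ennreal_mult'[OF zero_le_power2])
      also have "x\<^sup>2 * (K s t / t * (log_density \<epsilon> r (ln x + ln s) / (x * s))
          * (log_density \<epsilon> r (ln x + ln t) / (x * t)))
          = full_weight p * (log_density \<epsilon> r (ln x + ln s) * log_density \<epsilon> r (ln x + ln t))"
        using True x st by (simp add: p full_weight_def power2_eq_square)
      finally show ?thesis by (simp add: p)
    next
      case False
      then have "\<not> (0 < x * s \<and> x * s < x \<and> x - x * s < x * t)" using region by simp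
      then have "H (x * s, x * t) = 0" by (auto simp: H_def)
      then show ?thesis using False by (auto simp: p full_weight_def)
    qed
  qed
  also have "\<dots> = ennreal (exp (log_profile \<epsilon> r (ln x)))" by (rule nn_integral_full_weight)
  also have "\<dots> = ennreal (1 / \<epsilon> * x * ?g x)"
    using x eps by (simp add: profile_def log_density_def)
  finally show "ennreal (1 / \<epsilon> * x * ?g x) =
      (\<integral>\<^sup>+y\<in>{0<..<x}. (\<integral>\<^sup>+z\<in>{x - y<..}. ennreal (K y z / z * ?g y * ?g z) \<partial>lborel) \<partial>lborel)" by simp
qed

end

theorem profile_exists:
  assumes rho: "0 < \<rho>" "\<rho> < min (a / 3) (1 / (2028 * C))"
  shows "\<exists>g :: real \<Rightarrow> real. (\<forall>x>0. g x > 0) \<and> g C1_differentiable_on {0<..} \<and>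
    solves_profile_equation K ((1 + \<rho>) / \<rho>) g \<and> (\<integral>\<^sup>+x\<in>{0<..}. ennreal (g x) \<partial>lborel) = 1 \<and>
    g \<in> \<Theta>[at_right 0](\<lambda>x. x powr (- 1 / (1 + \<rho>))) \<and> g \<in> \<Theta>[at_top](\<lambda>x. 1 / x powr (1 + \<rho>))"
proof -
  \<comment> \<open>This makes 1/\<epsilon> equal to b. As \<epsilon> \<le> \<rho>, the first bound
    on \<open>\<rho>\<close> yields \<open>3 * \<epsilon> \<le> a\<close> and the second one the
    smallness condition of the contraction.\<close>
  define \<epsilon> where "\<epsilon> = \<rho> / (1 + \<rho>)"
  have e: "0 < \<epsilon>" "\<epsilon> < 1" "\<epsilon> \<le> \<rho>" "1 / \<epsilon> = (1 + \<rho>) / \<rho>" "\<epsilon> - 1 = - 1 / (1 + \<rho>)" "\<epsilon> / (1 - \<epsilon>) = \<rho>"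
    using rho by (simp_all add: \<epsilon>_def field_simps)
  have e3: "3 * \<epsilon> \<le> a" using e rho by simp
  have "\<epsilon> * C \<le> 1 / (2028 * C) * C" using e rho C_pos by (intro mult_right_mono) auto
  then have "\<epsilon> * C \<le> 1 / 2028" using C_pos by simp
  then obtain r s where rs: "C1_small r s" and fixed: "\<Psi> \<epsilon> r = r"
    using fixed_point[OF e(1) less_imp_le[OF e(2)] e3] by blast
  note asym = profile_asymptotics[OF e(1,2) e3 rs fixed]
  show ?thesis
  proof (intro exI[of _ "profile \<epsilon> r"] conjI)
    show "\<forall>x>0. profile \<epsilon> r x > 0" using profile_pos[OF e(1) rs] by blast
    show "profile \<epsilon> r C1_differentiable_on {0<..}" by (rule profile_C1[OF e(1) rs])
    show "solves_profile_equation K ((1 + \<rho>) / \<rho>) (profile \<epsilon> r)"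
      using profile_equation[OF e(1,2) e3 rs fixed] unfolding e(4) .
    show "(\<integral>\<^sup>+x\<in>{0<..}. ennreal (profile \<epsilon> r x) \<partial>lborel) = 1" by (rule total_mass[OF e(1) rs])
    show "profile \<epsilon> r \<in> \<Theta>[at_right 0](\<lambda>x. x powr (- 1 / (1 + \<rho>)))"
      using profile_at_0[OF e(1) rs asym(1)] unfolding e(5) .
    show "profile \<epsilon> r \<in> \<Theta>[at_top](\<lambda>x. 1 / x powr (1 + \<rho>))"
      using profile_at_top[OF e(1) rs asym(2)] unfolding e(6) .
  qed
qed

end

section \<open>Admissible kernels and the threshold for \<rho>\<close>

lemma admissible_kernel_near_additive:
  assumes "admissible_kernel K"
  shows "\<exists>K0 \<beta> Km. near_additive_kernel K K0 \<beta> Km"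
proof -
  from assms obtain K0 \<alpha> where cont: "continuous_on ({0..} \<times> {0..}) (\<lambda>(x, y). K x y)"
    and sym: "\<forall>x\<ge>0. \<forall>y\<ge>0. K x y = K y x \<and> K x y \<ge> 0"
    and hom: "\<forall>x>0. \<forall>y>0. \<forall>a>0. K (a * x) (a * y) = a * K x y"
    and K0: "K0 > 0" "\<alpha> > 0" "\<forall>x\<in>{0..1}. \<bar>K x 1 - 1\<bar> \<le> K0 * x powr \<alpha>"
    unfolding admissible_kernel_def by auto
  have "compact ((\<lambda>(x, y). K x y) ` ({0..1} \<times> {0..1}))"
    by (intro compact_continuous_image continuous_on_subset[OF cont] compact_Times) auto
  from compact_imp_bounded[OF this] obtain Km
    where Km: "\<forall>z \<in> (\<lambda>(x, y). K x y) ` ({0..1} \<times> {0..1}). norm z \<le> Km"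
    unfolding bounded_iff by blast
  have "near_additive_kernel K K0 (min \<alpha> 1) Km"
  proof
    show "\<bar>K x 1 - 1\<bar> \<le> K0 * x powr min \<alpha> 1" if "0 \<le> x" "x \<le> 1" for x
    proof -
      have "x powr \<alpha> \<le> x powr min \<alpha> 1" using that by (cases "x = 0") (auto intro: powr_mono')
      then have "K0 * x powr \<alpha> \<le> K0 * x powr min \<alpha> 1" using K0 by simp
      moreover have "\<bar>K x 1 - 1\<bar> \<le> K0 * x powr \<alpha>" using K0(3) that by simp
      ultimately show ?thesis by (rule order_trans[rotated])
    qed
    show "K x y \<le> Km" if "0 \<le> x" "x \<le> 1" "0 \<le> y" "y \<le> 1" for x y
    proof -
      have "K x y \<in> (\<lambda>(x, y). K x y) ` ({0..1} \<times> {0..1})" using that by force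
      from bspec[OF Km this] show ?thesis by simp
    qed
  qed (use cont sym hom K0 in auto)
  then show ?thesis by blast
qed

theorem theorem1p1:
  fixes K :: "real \<Rightarrow> real \<Rightarrow> real"
  assumes "admissible_kernel K"
  shows "\<exists>\<rho>0>0. \<forall>\<rho>. 0 < \<rho> \<and> \<rho> < \<rho>0 \<longrightarrow>
    (let b = (1 + \<rho>) / \<rho> in
      \<exists>g :: real \<Rightarrow> real.
        (\<forall>x>0. g x > 0) \<and>
        g C1_differentiable_on {0<..} \<and>
        solves_profile_equation K b g \<and>
        (\<integral>\<^sup>+x\<in>{0<..}. ennreal (g x) \<partial>lborel) = 1 \<and>
        g \<in> \<Theta>[at_right 0](\<lambda>x. x powr (- 1 / (1 + \<rho>))) \<and>
        g \<in> \<Theta>[at_top](\<lambda>x. 1 / x powr (1 + \<rho>)))"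
proof -
  obtain K0 \<beta> Km where "near_additive_kernel K K0 \<beta> Km"
    using admissible_kernel_near_additive[OF assms] by blast
  then interpret near_additive_kernel K K0 \<beta> Km .
  show ?thesis
  proof (intro exI[of _ "min (a / 3) (1 / (2028 * C))"] conjI allI impI)
    show "0 < min (a / 3) (1 / (2028 * C))" using a_bounds C_pos by simp
    show "let b = (1 + \<rho>) / \<rho> in \<exists>g. (\<forall>x>0. g x > 0) \<and> g C1_differentiable_on {0<..} \<and>
        solves_profile_equation K b g \<and> (\<integral>\<^sup>+x\<in>{0<..}. ennreal (g x) \<partial>lborel) = 1 \<and>
        g \<in> \<Theta>[at_right 0](\<lambda>x. x powr (- 1 / (1 + \<rho>))) \<and> g \<in> \<Theta>[at_top](\<lambda>x. 1 / x powr (1 + \<rho>))"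
      if "0 < \<rho> \<and> \<rho> < min (a / 3) (1 / (2028 * C))" for \<rho>
      unfolding Let_def by (rule profile_exists) (use that in auto)
  qed
qed

end
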